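(* Let $E/\mathbb{Q}$ be the elliptic curve $y^2=x^3-A$, where $A$ is a positive square-free integer such that $A\equiv1$ or $25 \pmod{36}$ and $\dim_{\mathbb{F}_3}\mathrm{Cl}(\mathbb{Q}(\sqrt{-A}))[3]=0$. For a nonzero cube-free integer $D$, let $E_D$ be the cubic twist $y^2=x^3-A\,D^2$. Then there is a positive constant $\epsilon<1$ such that $$\#\{D\in\mathcal{P}_3(X):\mathrm{rank}\,E_D(\mathbb{Q})=0\}\gg\frac{X}{(\log X)^\epsilon}.$$
   Context: $\mathrm{Cl}(F)$ is the ideal class group of the number field $F$. $\mathcal{P}_3(X)$ is the set of positive cube-free integers up to $X$. $A(X)\gg B(X)$ means $A(X)\ge cB(X)$ for all sufficiently large $X$, for some constant $c>0$ independent of $X$. *)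

theory Defs
  imports
    Complex_Main
    "HOL-Library.Extended_Nat"
    "HOL-Computational_Algebra.Polynomial"
    "HOL-Computational_Algebra.Squarefree"
    "HOL-Number_Theory.Residues"
    "Jordan_Normal_Form.Missing_VectorSpace"
begin

section \<open>Number fields and their class groups\<close>

text \<open>Number fields are represented as subfields \<open>K\<close> of the complex numbers.\<close>

definition quadratic_field :: "int \<Rightarrow> complex set" where
  "quadratic_field d = {a + b * csqrt (of_int d) | a b. a \<in> \<rat> \<and> b \<in> \<rat>}"

definition ring_of_integers :: "complex set \<Rightarrow> complex set" where
  "ring_of_integers K = {z \<in> K. algebraic_int z}"

definition fractional_ideal :: "complex set \<Rightarrow> complex set \<Rightarrow> bool" where
  "fractional_ideal K I \<longleftrightarrow>
     I \<subseteq> K \<and> 0 \<in> I \<and> I \<noteq> {0} \<and>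
     (\<forall>x\<in>I. \<forall>y\<in>I. x + y \<in> I) \<and>
     (\<forall>r\<in>ring_of_integers K. \<forall>x\<in>I. r * x \<in> I) \<and>
     (\<exists>d\<in>ring_of_integers K. d \<noteq> 0 \<and> (\<forall>x\<in>I. d * x \<in> ring_of_integers K))"

definition fractional_ideal_mult :: "complex set \<Rightarrow> complex set \<Rightarrow> complex set" where
  "fractional_ideal_mult I J =
     {(\<Sum>i<n. x i * y i) | (n::nat) x y. \<forall>i<n. x i \<in> I \<and> y i \<in> J}"

definition fractional_ideal_group :: "complex set \<Rightarrow> complex set monoid" where
  "fractional_ideal_group K =
     \<lparr>carrier = {I. fractional_ideal K I}, mult = fractional_ideal_mult, one = ring_of_integers K\<rparr>"

definition principal_fractional_ideals :: "complex set \<Rightarrow> complex set set" where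
  "principal_fractional_ideals K = {(\<lambda>r. a * r) ` ring_of_integers K | a. a \<in> K \<and> a \<noteq> 0}"

definition class_group :: "complex set \<Rightarrow> complex set set monoid" where
  "class_group K = fractional_ideal_group K Mod principal_fractional_ideals K"

text \<open>
  The \<open>p\<close>-torsion of a multiplicatively written abelian group, as a vector space over
  \<^term>\<open>residue_ring p\<close> in additive notation. The record fields \<open>mult\<close> and \<open>one\<close> exist only
  because module records extend ring records; they play no role in the vector space structure.
\<close>

definition torsion_space :: "int \<Rightarrow> ('a, 'b) monoid_scheme \<Rightarrow> (int, 'a) module" where
  "torsion_space p G =
     \<lparr>carrier = {x \<in> carrier G. x [^]\<^bsub>G\<^esub> p = \<one>\<^bsub>G\<^esub>},
      monoid.mult = undefined, one = undefined,
      zero = \<one>\<^bsub>G\<^esub>, add = monoid.mult G,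
      smult = (\<lambda>k x. x [^]\<^bsub>G\<^esub> k)\<rparr>"

definition torsion_dim :: "int \<Rightarrow> ('a, 'b) monoid_scheme \<Rightarrow> nat" where
  "torsion_dim p G = vectorspace.dim (residue_ring p) (torsion_space p G)"


section \<open>Elliptic curves in short Weierstrass form\<close>

text \<open>
  Points of \<open>y\<^sup>2 = x\<^sup>3 + a x + b\<close> over a field of characteristic other than 2 and 3;
  \<^term>\<open>None\<close> is the point at infinity.
\<close>

definition ec_points :: "'a::field \<Rightarrow> 'a \<Rightarrow> ('a \<times> 'a) option set" where
  "ec_points a b = insert None {Some (x, y) | x y. y ^ 2 = x ^ 3 + a * x + b}"

fun ec_add :: "'a::field \<Rightarrow> ('a \<times> 'a) option \<Rightarrow> ('a \<times> 'a) option \<Rightarrow> ('a \<times> 'a) option" where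
  "ec_add a None Q = Q"
| "ec_add a (Some P) None = Some P"
| "ec_add a (Some (x1, y1)) (Some (x2, y2)) =
     (if x1 = x2 \<and> y1 = - y2 then None
      else let l = (if x1 = x2 then (3 * x1 ^ 2 + a) / (2 * y1) else (y2 - y1) / (x2 - x1));
               x3 = l ^ 2 - x1 - x2
           in Some (x3, l * (x1 - x3) - y1))"

definition ec_group :: "'a::field \<Rightarrow> 'a \<Rightarrow> ('a \<times> 'a) option monoid" where
  "ec_group a b = \<lparr>carrier = ec_points a b, mult = ec_add a, one = None\<rparr>"

text \<open>The group of rational points of \<open>E\<^sub>D: y\<^sup>2 = x\<^sup>3 - A D\<^sup>2\<close>.\<close>

definition cubic_twist_group :: "int \<Rightarrow> int \<Rightarrow> (rat \<times> rat) option monoid" where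
  "cubic_twist_group A D = ec_group 0 (- of_int (A * D ^ 2))"


section \<open>Rank of an abelian group\<close>

definition Z_independent :: "('a, 'b) monoid_scheme \<Rightarrow> 'a set \<Rightarrow> bool" where
  "Z_independent G S \<longleftrightarrow>
     (\<forall>n :: 'a \<Rightarrow> int. (\<Otimes>\<^bsub>G\<^esub>x\<in>S. x [^]\<^bsub>G\<^esub> n x) = \<one>\<^bsub>G\<^esub> \<longrightarrow> (\<forall>x\<in>S. n x = 0))"

definition abelian_rank :: "('a, 'b) monoid_scheme \<Rightarrow> enat" where
  "abelian_rank G = (SUP S\<in>{S. finite S \<and> S \<subseteq> carrier G \<and> Z_independent G S}. enat (card S))"


section \<open>Cube-free integers\<close>

definition cubefree :: "'a::comm_monoid_mult \<Rightarrow> bool" where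
  "cubefree n \<longleftrightarrow> (\<forall>x. x ^ 3 dvd n \<longrightarrow> x dvd 1)"

definition cubefree_upto :: "real \<Rightarrow> int set" where
  "cubefree_upto X = {D. 0 < D \<and> cubefree D \<and> of_int D \<le> X}"

end

(*
  Call D good if A D^2 = 7 mod 9, D or D/4 is an odd integer, and every odd prime p dividing D satisfies
  p = 1 mod 3 and is inert in K = Q(sqrt(-A)). For good cube-free D the curve y^2 = x^3 - A D^2 has no
  affine rational point at all, by a descent through its 3-isogeny. As Cl(K)[3] = 0 and the units of K are
  cubes, b^2 + A D^2 c^6 = a^3 forces b + D c^3 sqrt(-A) to be a cube in the ring of integers. The
  inert primes put all of D into one of the two factors of D c^3, and a congruence modulo 9 excludes one
  of the two remaining cases. In the other case one obtains an element of Q(sqrt(3A)) whose norm is a cube;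
  it is itself a cube by reflection, for otherwise K has an unramified cyclic cubic extension N.
  Hilbert 90 together with Cl(K)[3] = 0 then makes every unit of N of norm 1 an (s - 1)-th multiple of
  another such unit, s generating the Galois group; applying this twice, it is a cube up to conjugation.
  Repeated extraction of cube roots shows that all conjugates of such a unit have absolute value 1,
  whereas the pigeonhole principle yields a unit with a conjugate of absolute value different from 1.

  The admissible primes have density 1/4, in the sense that the sum of log p / p up to x is
  (log x) / 4 + O(1). This follows from the Mertens estimates for three real characters, that is,
  from L(1, chi) <> 0. Hence the sum of 1/m over products m of such primes grows at least like a positive
  power (log x)^kappa, and the products m p with p of size about x/m give the lower bound
  x / (log x)^(1 - kappa) for the number of good D up to x. The congruence modulo 9 is arranged by
  multiplying with a factor 4 and a power of one fixed prime.
*)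
theory Submission
  imports
    Defs
    "Jordan_Normal_Form.Char_Poly"
    "HOL-Computational_Algebra.Nth_Powers"
    "HOL-Number_Theory.Number_Theory"
    "HOL-Real_Asymp.Real_Asymp"
begin

section \<open>Algebraic integers form a ring\<close>

text \<open>The class group hypothesis enters only as the rule that an ideal of K whose cube is
  principal is itself principal. It is used once for the ideal (alpha, a) of the descent and once
  for the contraction to K of a Galois-stable principal ideal of N, so reflection is reached without
  class field theory. The competing unit is sought in Z[th], th the real root of the cubic: the
  discriminant is negative, so a pigeonhole argument can make the real conjugate small while the
  complex pair stays under control. The primes are taken = 1 mod 3 because -3 is then a square
  modulo p, so that the norm forms of K and of Q(sqrt(3 A)), which alternate in the two isogeny
  steps, are anisotropic modulo p together. The residue 7 is chosen because 3 U - W, with W = 7 mod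
  9 and U a square, is 2 or 5 mod 9 and never a cube. As only the point at infinity survives, the
  rank is that of a trivial group and the group law never has to be verified. The exponent of log x
  need only be positive, so a crude growth step by 11/10 for each sixth power of z takes the place
  of the natural exponent 1/4.\<close>

definition Zspan :: "nat \<Rightarrow> (nat \<Rightarrow> complex) \<Rightarrow> complex set" where
  "Zspan n v = {(\<Sum>k<n. of_int (c k) * v k) | c. True}"

lemma Zspan_base: "k < n \<Longrightarrow> v k \<in> Zspan n v"
  unfolding Zspan_def
proof -
  assume k: "k < n"
  have "v k = (\<Sum>i<n. if i = k then v i else 0)" using k by simp
  also have "\<dots> = (\<Sum>i<n. of_int (if i = k then 1 else 0) * v i)" by (intro sum.cong) auto
  finally show "v k \<in> {(\<Sum>k<n. of_int (c k) * v k) | c. True}"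
    by (intro CollectI exI[of _ "\<lambda>i. if i = k then 1 else 0"] conjI TrueI)
qed

lemma Zspan_add: "x \<in> Zspan n v \<Longrightarrow> y \<in> Zspan n v \<Longrightarrow> x + y \<in> Zspan n v"
proof -
  assume "x \<in> Zspan n v" "y \<in> Zspan n v"
  then obtain c d where "x = (\<Sum>k<n. of_int (c k) * v k)" "y = (\<Sum>k<n. of_int (d k) * v k)"
    unfolding Zspan_def by auto
  then have "x + y = (\<Sum>k<n. of_int (c k + d k) * v k)"
    by (simp add: sum.distrib algebra_simps)
  then show ?thesis unfolding Zspan_def by (auto intro!: exI[of _ "\<lambda>k. c k + d k"])
qed

lemma Zspan_scale: "x \<in> Zspan n v \<Longrightarrow> of_int a * x \<in> Zspan n v"
proof -
  assume "x \<in> Zspan n v"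
  then obtain c where "x = (\<Sum>k<n. of_int (c k) * v k)"
    unfolding Zspan_def by auto
  then have "of_int a * x = (\<Sum>k<n. of_int (a * c k) * v k)"
    by (simp add: sum_distrib_left algebra_simps)
  then show ?thesis unfolding Zspan_def by (auto intro!: exI[of _ "\<lambda>k. a * c k"])
qed

lemma Zspan_0: "0 \<in> Zspan n v"
  unfolding Zspan_def by (auto intro!: exI[of _ "\<lambda>_. 0"])

lemma Zspan_sum: "(\<And>i. i \<in> I \<Longrightarrow> f i \<in> Zspan n v) \<Longrightarrow> (\<Sum>i\<in>I. f i) \<in> Zspan n v"
  by (induction I rule: infinite_finite_induct) (auto intro: Zspan_0 Zspan_add)

lemma Zspan_mult:
  assumes "\<And>k. k < n \<Longrightarrow> z * v k \<in> Zspan n v" "x \<in> Zspan n v"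
  shows "z * x \<in> Zspan n v"
proof -
  obtain c where c: "x = (\<Sum>k<n. of_int (c k) * v k)"
    using assms(2) unfolding Zspan_def by auto
  have "z * x = (\<Sum>k<n. of_int (c k) * (z * v k))"
    by (simp add: c sum_distrib_left algebra_simps)
  also have "\<dots> \<in> Zspan n v" by (intro Zspan_sum Zspan_scale assms(1)) auto
  finally show ?thesis .
qed

text \<open>Determinant trick: \<open>z\<close> is an eigenvalue of the integer matrix
  \<open>B\<close> that describes multiplication by \<open>z\<close> on the \<open>v k\<close>, and
  a characteristic polynomial is monic. The entry \<open>v k0\<close> makes the eigenvector
  nonzero.\<close>

lemma algebraic_int_module:
  assumes mv: "\<And>k. k < n \<Longrightarrow> z * v k \<in> Zspan n v" and nz: "k0 < n" "v k0 \<noteq> 0"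
  shows "algebraic_int z"
proof -
  have "\<exists>c. \<forall>k<n. z * v k = (\<Sum>l<n. of_int (c k l) * v l)"
    using mv unfolding Zspan_def by (auto simp: choice_iff' intro!: choice)
  then obtain c :: "nat \<Rightarrow> nat \<Rightarrow> int" where c: "\<And>k. k < n \<Longrightarrow> z * v k = (\<Sum>l<n. of_int (c k l) * v l)"
    by blast
  define B where "B = mat n n (\<lambda>(i,j). c i j)"
  have B: "B \<in> carrier_mat n n" by (simp add: B_def)
  define C where "C = map_mat (of_int :: int \<Rightarrow> complex) B"
  have C: "C \<in> carrier_mat n n" using B by (simp add: C_def)
  define w where "w = vec n v"
  have "C *\<^sub>v w = z \<cdot>\<^sub>v w"
  proof (rule eq_vecI)
    show "dim_vec (C *\<^sub>v w) = dim_vec (z \<cdot>\<^sub>v w)" using C by (simp add: w_def)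
    fix i assume "i < dim_vec (z \<cdot>\<^sub>v w)"
    then have i: "i < n" by (simp add: w_def)
    have "(C *\<^sub>v w) $ i = (\<Sum>l<n. of_int (c i l) * v l)"
      using i C by (simp add: w_def scalar_prod_def C_def B_def lessThan_atLeast0)
    then show "(C *\<^sub>v w) $ i = (z \<cdot>\<^sub>v w) $ i" using c[OF i] i by (simp add: w_def)
  qed
  moreover have "w \<noteq> 0\<^sub>v n"
  proof
    assume "w = 0\<^sub>v n"
    then have "w $ k0 = 0" using nz by simp
    then show False using nz by (simp add: w_def)
  qed
  ultimately have "eigenvalue C z" unfolding eigenvalue_def eigenvector_def using C
    by (intro exI[of _ w]) (auto simp: w_def)
  then have "poly (char_poly C) z = 0" using eigenvalue_root_char_poly[OF C] by simp
  moreover have "char_poly C = map_poly of_int (char_poly B)"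
    unfolding C_def by (rule of_int_hom.char_poly_hom[OF B])
  moreover have "lead_coeff (char_poly B) = 1" using degree_monic_char_poly[OF B] by auto
  ultimately show ?thesis unfolding algebraic_int_altdef_ipoly by auto
qed

lemma algebraic_int_power_reduce:
  fixes x :: complex
  assumes "algebraic_int x"
  obtains n c where "n > 0" "x ^ n = (\<Sum>i<n. of_int (c i) * x ^ i)"
proof -
  obtain p where p: "poly (map_poly of_int p) x = 0" "lead_coeff p = 1"
    using assms unfolding algebraic_int_altdef_ipoly by auto
  define n where "n = degree p"
  have dp: "degree (map_poly (of_int :: int \<Rightarrow> complex) p) = n" by (simp add: n_def degree_map_poly)
  have "0 = (\<Sum>i\<le>n. of_int (Polynomial.coeff p i) * x ^ i)"
    using p(1) unfolding poly_altdef dp by (simp add: coeff_map_poly)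
  also have "\<dots> = (\<Sum>i<n. of_int (Polynomial.coeff p i) * x ^ i) + x ^ n"
    using p(2) by (simp add: n_def lessThan_Suc_atMost[symmetric])
  finally have "x ^ n = (\<Sum>i<n. of_int (- Polynomial.coeff p i) * x ^ i)"
    by (simp add: sum_negf eq_neg_iff_add_eq_0 add.commute)
  moreover have "n > 0"
  proof (rule ccontr)
    assume "\<not> n > 0"
    then have "degree p = 0" by (simp add: n_def)
    then have "p = 1" using p(2) by (metis degree_eq_zeroE lead_coeff_pCons(2) one_pCons)
    then show False using p(1) by simp
  qed
  ultimately show ?thesis by (intro that)
qed

text \<open>The monomials x^i y^j below the degrees n and m of monic relations span a module stable
  under both x and y, hence under their sum and product.\<close>

lemma algebraic_int_add_mult:
  fixes x y :: complex
  assumes "algebraic_int x" "algebraic_int y"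
  shows "algebraic_int (x + y)" "algebraic_int (x * y)"
proof -
  obtain n c where n: "n > 0" and c: "x ^ n = (\<Sum>i<n. of_int (c i) * x ^ i)"
    using algebraic_int_power_reduce[OF assms(1)] by blast
  obtain m d where m: "m > 0" and d: "y ^ m = (\<Sum>i<m. of_int (d i) * y ^ i)"
    using algebraic_int_power_reduce[OF assms(2)] by blast
  \<comment> \<open>The pair (i, j) is coded as the index i * m + j.\<close>
  define v where "v = (\<lambda>k. x ^ (k div m) * y ^ (k mod m))"
  have v: "x ^ i * y ^ j \<in> Zspan (n * m) v" if "i < n" "j < m" for i j
  proof -
    have "i * m + j < Suc i * m" using that by simp
    also have "\<dots> \<le> n * m" using that by (intro mult_le_mono1) simp
    finally have "i * m + j < n * m" .
    then have "v (i * m + j) \<in> Zspan (n * m) v" by (rule Zspan_base)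
    then show ?thesis using that by (simp add: v_def)
  qed
  have X: "x * v k \<in> Zspan (n * m) v" if "k < n * m" for k
  proof -
    define i j where "i = k div m" and "j = k mod m"
    have ij: "i < n" "j < m" using that m by (auto simp: i_def j_def less_mult_imp_div_less)
    have e: "x * v k = x ^ Suc i * y ^ j" by (simp add: v_def i_def j_def)
    show ?thesis
    proof (cases "Suc i < n")
      case True then show ?thesis using e v ij by metis
    next
      case False
      then have "Suc i = n" using ij by simp
      then have "x * v k = (\<Sum>l<n. of_int (c l) * (x ^ l * y ^ j))"
        using e c by (simp only: sum_distrib_right mult.assoc)
      also have "\<dots> \<in> Zspan (n * m) v" by (intro Zspan_sum Zspan_scale v) (use ij in auto)
      finally show ?thesis .
    qed
  qed
  have Y: "y * v k \<in> Zspan (n * m) v" if "k < n * m" for k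
  proof -
    define i j where "i = k div m" and "j = k mod m"
    have ij: "i < n" "j < m" using that m by (auto simp: i_def j_def less_mult_imp_div_less)
    have e: "y * v k = x ^ i * y ^ Suc j" by (simp add: v_def i_def j_def)
    show ?thesis
    proof (cases "Suc j < m")
      case True then show ?thesis using e v ij by metis
    next
      case False
      then have "Suc j = m" using ij by simp
      then have "y * v k = (\<Sum>l<m. of_int (d l) * (x ^ i * y ^ l))"
        using e d by (simp only: sum_distrib_left mult.left_commute)
      also have "\<dots> \<in> Zspan (n * m) v" by (intro Zspan_sum Zspan_scale v) (use ij in auto)
      finally show ?thesis .
    qed
  qed
  have nz: "0 < n * m" "v 0 \<noteq> 0" using n m by (auto simp: v_def)
  show "algebraic_int (x + y)"
    by (rule algebraic_int_module[where v = v and n = "n * m" and ?k0.0 = 0, OF _ nz]) (auto simp: distrib_right intro!: Zspan_add X Y)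
  show "algebraic_int (x * y)"
    by (rule algebraic_int_module[where v = v and n = "n * m" and ?k0.0 = 0, OF _ nz]) (auto simp: mult.assoc intro!: Zspan_mult[OF X] Y)
qed

lemma algebraic_int_add [intro]: "algebraic_int (x::complex) \<Longrightarrow> algebraic_int y \<Longrightarrow> algebraic_int (x + y)"
  and algebraic_int_mult [intro]: "algebraic_int (x::complex) \<Longrightarrow> algebraic_int y \<Longrightarrow> algebraic_int (x * y)"
  by (simp_all add: algebraic_int_add_mult)

lemma algebraic_int_diff [intro]: "algebraic_int (x::complex) \<Longrightarrow> algebraic_int y \<Longrightarrow> algebraic_int (x - y)"
  using algebraic_int_add[of x "- y"] by auto

lemma algebraic_int_of_int [simp, intro]: "algebraic_int (of_int n :: complex)"
  by (rule int_imp_algebraic_int) simp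

lemma algebraic_int_power [intro]: "algebraic_int (x::complex) \<Longrightarrow> algebraic_int (x ^ n)"
  by (induction n) auto

section \<open>Torsion of a finite abelian group\<close>

text \<open>\<open>vectorspace.dim\<close> is the least size of a finite generating set, so its
  value 0 is informative only once such a set is known to exist; finiteness of the group supplies
  one. Then the empty set spans.\<close>

lemma (in comm_group) torsion_dim_3_eq_0_imp:
  assumes fin: "finite (carrier G)" and dim0: "torsion_dim 3 G = 0"
    and x: "x \<in> carrier G" "x \<otimes> x \<otimes> x = \<one>"
  shows "x = \<one>"
proof -
  define T where "T = torsion_space 3 G"
  have c: "carrier T = {x \<in> carrier G. x [^] (3::int) = \<one>}"
    and z: "\<zero>\<^bsub>T\<^esub> = \<one>" and a: "\<And>x y. x \<oplus>\<^bsub>T\<^esub> y = x \<otimes> y" and s: "\<And>k x. k \<odot>\<^bsub>T\<^esub> x = x [^] k"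
    by (simp_all add: T_def torsion_space_def)
  \<comment> \<open>Scalars are representatives in \<open>residue_ring 3\<close>; this hides the
    reduction modulo 3 in its operations from the exponents, as the module axioms require.\<close>
  have pm: "x [^] (k mod 3) = x [^] k" if "x \<in> carrier T" for x and k :: int
  proof -
    have x: "x \<in> carrier G" "x [^] (3::int) = \<one>" using that by (auto simp: c)
    have "x [^] k = x [^] (3 * (k div 3) + k mod 3)" by simp
    also have "\<dots> = (x [^] (3::int)) [^] (k div 3) \<otimes> x [^] (k mod 3)"
      unfolding int_pow_mult[OF x(1)] int_pow_pow[OF x(1)] ..
    also have "\<dots> = x [^] (k mod 3)" using x by simp
    finally show ?thesis by simp
  qed
  interpret res: residues 3 "residue_ring 3" by unfold_locales auto
  have "residues_prime 3" by unfold_locales simp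
  then have fld: "field (residue_ring 3)" using residues_prime.is_field[of 3] by simp
  have ab: "abelian_group T"
  proof (rule abelian_groupI)
    fix x assume x: "x \<in> carrier T"
    then show "\<exists>y\<in>carrier T. y \<oplus>\<^bsub>T\<^esub> x = \<zero>\<^bsub>T\<^esub>"
      by (intro bexI[of _ "inv x"]) (auto simp: c a z int_pow_inv)
  qed (auto simp: c a z int_pow_distrib m_ac)
  have md: "module (residue_ring 3) T"
  proof (rule moduleI)
    show "cring (residue_ring 3)" by (rule res.cring)
    show "abelian_group T" by (rule ab)
    fix x assume x: "x \<in> carrier T"
    then have xG: "x \<in> carrier G" by (simp add: c)
    fix k l
    show "k \<odot>\<^bsub>T\<^esub> x \<in> carrier T"
    proof -
      have "(x [^] k) [^] (3::int) = (x [^] (3::int)) [^] k"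
        using xG by (simp add: int_pow_pow mult.commute)
      then show ?thesis using x by (simp add: c s)
    qed
    show "(k \<oplus>\<^bsub>residue_ring 3\<^esub> l) \<odot>\<^bsub>T\<^esub> x = k \<odot>\<^bsub>T\<^esub> x \<oplus>\<^bsub>T\<^esub> l \<odot>\<^bsub>T\<^esub> x"
      using x xG by (simp add: s a res.res_add_eq pm int_pow_mult)
    show "(k \<otimes>\<^bsub>residue_ring 3\<^esub> l) \<odot>\<^bsub>T\<^esub> x = k \<odot>\<^bsub>T\<^esub> (l \<odot>\<^bsub>T\<^esub> x)"
      using x xG by (simp add: s a res.res_mult_eq pm int_pow_pow mult.commute)
    show "\<one>\<^bsub>residue_ring 3\<^esub> \<odot>\<^bsub>T\<^esub> x = x"
      using xG by (simp add: s res.res_one_eq)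
    fix y assume "y \<in> carrier T"
    then show "k \<odot>\<^bsub>T\<^esub> (x \<oplus>\<^bsub>T\<^esub> y) = k \<odot>\<^bsub>T\<^esub> x \<oplus>\<^bsub>T\<^esub> k \<odot>\<^bsub>T\<^esub> y"
      using xG by (simp add: s a c int_pow_distrib)
  qed
  have vs: "vectorspace (residue_ring 3) T"
    unfolding vectorspace_def using md fld by simp
  interpret V: vectorspace "residue_ring 3" T by (rule vs)
  have finT: "finite (carrier T)" using fin by (simp add: c)
  have "V.span (carrier T) = carrier T"
  proof
    show "V.span (carrier T) \<subseteq> carrier T" by (rule V.span_is_subset2) simp
    show "carrier T \<subseteq> V.span (carrier T)" by (rule V.in_own_span) simp
  qed
  then have "\<exists>n A. finite A \<and> card A = n \<and> A \<subseteq> carrier T \<and> V.gen_set A" using finT by blast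
  then have "\<exists>A. finite A \<and> card A = V.dim \<and> A \<subseteq> carrier T \<and> V.gen_set A"
    unfolding V.dim_def by (rule LeastI_ex)
  moreover have "V.dim = 0" using dim0 by (simp add: torsion_dim_def T_def)
  ultimately have "V.span {} = carrier T" by auto
  moreover have "x [^] (3::int) = x \<otimes> x \<otimes> x"
  proof -
    have "x [^] (3::int) = x [^] (1 + 1 + 1 :: int)" by simp
    then show ?thesis using x(1) by (simp only: int_pow_mult[OF x(1)] int_pow_1[OF x(1)])
  qed
  then have "x \<in> carrier T" using x by (simp add: c)
  ultimately have "x \<in> V.span {}" by simp
  then show ?thesis by (auto simp: V.span_def V.lincomb_def z)
qed

section \<open>Imaginary quadratic fields\<close>

text \<open>The square of the denominator would have to divide the squarefree
  \<open>A\<close>.\<close>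

lemma rat_square_int_imp_int:
  fixes q :: rat and A :: int
  assumes "squarefree A" "A \<noteq> 0" "of_int A * q ^ 2 \<in> \<int>"
  shows "q \<in> \<int>"
proof -
  obtain n d where q: "quotient_of q = (n, d)" by (cases "quotient_of q") auto
  have d: "d > 0" "coprime n d" "q = of_int n / of_int d"
    using quotient_of_denom_pos[OF q] quotient_of_coprime[OF q] quotient_of_div[OF q] by auto
  obtain k where k: "of_int A * q ^ 2 = of_int k" using assms(3) by (auto elim: Ints_cases)
  then have "of_int A * of_int n ^ 2 = (of_int k * of_int d ^ 2 :: rat)"
    using d by (simp add: power_divide field_simps)
  then have "A * n ^ 2 = k * d ^ 2" by (metis (mono_tags, lifting) of_int_eq_iff of_int_mult of_int_power)
  then have "d ^ 2 dvd n ^ 2 * A" by (metis dvd_triv_right mult.commute)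
  then have "d ^ 2 dvd A" using d(2) by (subst (asm) coprime_dvd_mult_right_iff) (auto simp: coprime_commute)
  then have "d dvd 1" using assms(1) by (auto simp: squarefree_def)
  then have "d = 1" using d(1) by simp
  then show ?thesis using d(3) by simp
qed

text \<open>Here - A = 3 mod 4, so that 1 and sqrt(- A) form an integral basis and no half-integers
  occur.\<close>

locale imag_quadratic =
  fixes A :: int
  assumes A_pos: "A > 0" and A_sqf: "squarefree A" and A_mod4: "A mod 4 = 1"
begin

definition rt :: complex where "rt = \<i> * of_real (sqrt (of_int A))"
abbreviation K :: "complex set" where "K \<equiv> quadratic_field (- A)"
abbreviation OK :: "complex set" where "OK \<equiv> ring_of_integers K"

lemma rt_sq: "rt * rt = - of_int A"
proof -
  have "rt * rt = - (of_real (sqrt (of_int A) * sqrt (of_int A)))"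
    by (simp add: rt_def complex_eq_iff)
  also have "sqrt (of_int A) * sqrt (of_int A) = real_of_int A"
    using A_pos real_sqrt_mult_self[of "real_of_int A"] by linarith
  finally show ?thesis by simp
qed

lemma cnj_rt: "cnj rt = - rt" by (simp add: rt_def)

lemma csqrt_eq_rt: "csqrt (of_int (- A)) = rt"
proof -
  have "csqrt (of_int (- A)) = csqrt (of_real (- of_int A))" by simp
  also have "\<dots> = \<i> * of_real (sqrt (of_int A))"
    using A_pos by (subst csqrt_of_real_nonpos) auto
  finally show ?thesis by (simp add: rt_def)
qed

lemma K_iff: "z \<in> K \<longleftrightarrow> (\<exists>a b :: rat. z = of_rat a + of_rat b * rt)"
  unfolding quadratic_field_def csqrt_eq_rt by (auto simp: Rats_def)

lemma K_I: "of_rat a + of_rat b * rt \<in> K" by (auto simp: K_iff)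

lemma K_of_rat [simp]: "of_rat a \<in> K" using K_I[of a 0] by simp
lemma K_of_int [simp]: "of_int a \<in> K" using K_of_rat[of "of_int a"] by simp
lemma K_of_nat [simp]: "of_nat a \<in> K" using K_of_rat[of "of_nat a"] by simp
lemma K_0 [simp]: "0 \<in> K" using K_of_rat[of 0] by simp
lemma K_1 [simp]: "1 \<in> K" using K_of_rat[of 1] by simp
lemma K_numeral [simp]: "numeral n \<in> K" using K_of_rat[of "numeral n"] by simp
lemma K_rt [simp]: "rt \<in> K" using K_I[of 0 1] by simp

lemma K_add [intro]: "x \<in> K \<Longrightarrow> y \<in> K \<Longrightarrow> x + y \<in> K"
proof -
  assume "x \<in> K" "y \<in> K"
  then obtain a b c d where "x = of_rat a + of_rat b * rt" "y = of_rat c + of_rat d * rt"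
    by (auto simp: K_iff)
  then have "x + y = of_rat (a + c) + of_rat (b + d) * rt" by (simp add: of_rat_add algebra_simps)
  then show ?thesis by (simp only: K_I)
qed

lemma K_mult [intro]: "x \<in> K \<Longrightarrow> y \<in> K \<Longrightarrow> x * y \<in> K"
proof -
  assume "x \<in> K" "y \<in> K"
  then obtain a b c d where e: "x = of_rat a + of_rat b * rt" "y = of_rat c + of_rat d * rt"
    by (auto simp: K_iff)
  have "x * y = of_rat a * of_rat c + (of_rat b * of_rat d) * (rt * rt) + (of_rat a * of_rat d + of_rat b * of_rat c) * rt"
    unfolding e by (simp add: algebra_simps)
  also have "\<dots> = of_rat (a * c - of_int A * b * d) + of_rat (a * d + b * c) * rt"
    unfolding rt_sq by (simp add: of_rat_add of_rat_diff of_rat_mult algebra_simps)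
  finally show ?thesis by (simp only: K_I)
qed

lemma K_minus [intro]: "x \<in> K \<Longrightarrow> - x \<in> K"
  using K_mult[of "of_int (-1)" x] K_of_int[of "-1"] by simp

lemma K_diff [intro]: "x \<in> K \<Longrightarrow> y \<in> K \<Longrightarrow> x - y \<in> K"
  using K_add[of x "- y"] by auto

lemma K_cnj [intro]: "x \<in> K \<Longrightarrow> cnj x \<in> K"
proof -
  assume "x \<in> K"
  then obtain a b where "x = of_rat a + of_rat b * rt" by (auto simp: K_iff)
  moreover have "cnj (of_rat q) = of_rat q" for q :: rat
    by (cases q) (simp add: of_rat_rat)
  ultimately have "cnj x = of_rat a + of_rat (- b) * rt" by (simp add: cnj_rt of_rat_minus)
  then show ?thesis by (simp only: K_I)
qed

lemma cnj_of_rat [simp]: "cnj (of_rat q) = of_rat q"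
    by (cases q) (simp add: of_rat_rat)

lemma K_norm_trace:
  assumes "x \<in> K"
  shows "x * cnj x \<in> \<rat>" "x + cnj x \<in> \<rat>"
proof -
  obtain a b where e: "x = of_rat a + of_rat b * rt" using assms by (auto simp: K_iff)
  have "x * cnj x = of_rat a * of_rat a - (of_rat b * of_rat b) * (rt * rt)"
    by (simp add: e cnj_rt algebra_simps)
  also have "\<dots> = of_rat (a * a + of_int A * b * b)"
    unfolding rt_sq by (simp add: of_rat_add of_rat_mult algebra_simps)
  finally show "x * cnj x \<in> \<rat>" by simp
  have "x + cnj x = of_rat (2 * a)" by (simp add: e cnj_rt of_rat_mult)
  then show "x + cnj x \<in> \<rat>" by simp
qed

lemma K_inverse [intro]: "x \<in> K \<Longrightarrow> inverse x \<in> K"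
proof -
  assume x: "x \<in> K"
  obtain q where q: "x * cnj x = of_rat q" using K_norm_trace(1)[OF x] by (auto simp: Rats_def)
  show ?thesis
  proof (cases "x = 0")
    case False
    then have "inverse x = cnj x * inverse (x * cnj x)" by (simp add: field_simps)
    also have "\<dots> = cnj x * of_rat (inverse q)" by (simp add: q of_rat_inverse)
    finally show ?thesis using x by auto
  qed auto
qed

lemma K_divide [intro]: "x \<in> K \<Longrightarrow> y \<in> K \<Longrightarrow> x / y \<in> K"
  by (simp add: divide_inverse K_mult K_inverse)

lemma K_power [intro]: "x \<in> K \<Longrightarrow> x ^ n \<in> K" by (induction n) auto

lemma OK_K: "x \<in> OK \<Longrightarrow> x \<in> K" by (simp add: ring_of_integers_def)
lemma OK_alg: "x \<in> OK \<Longrightarrow> algebraic_int x" by (simp add: ring_of_integers_def)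
lemma OK_I: "x \<in> K \<Longrightarrow> algebraic_int x \<Longrightarrow> x \<in> OK" by (simp add: ring_of_integers_def)

lemma OK_add [intro]: "x \<in> OK \<Longrightarrow> y \<in> OK \<Longrightarrow> x + y \<in> OK"
  and OK_mult [intro]: "x \<in> OK \<Longrightarrow> y \<in> OK \<Longrightarrow> x * y \<in> OK"
  and OK_minus [intro]: "x \<in> OK \<Longrightarrow> - x \<in> OK"
  and OK_diff [intro]: "x \<in> OK \<Longrightarrow> y \<in> OK \<Longrightarrow> x - y \<in> OK"
  and OK_cnj [intro]: "x \<in> OK \<Longrightarrow> cnj x \<in> OK"
  and OK_power [intro]: "x \<in> OK \<Longrightarrow> x ^ n \<in> OK"
  by (auto simp: ring_of_integers_def)

lemma OK_of_int [simp]: "of_int n \<in> OK" and OK_of_nat [simp]: "of_nat m \<in> OK"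
  by (auto simp: ring_of_integers_def)
lemma OK_0 [simp]: "0 \<in> OK" using OK_of_int[of 0] by simp
lemma OK_1 [simp]: "1 \<in> OK" using OK_of_int[of 1] by simp

lemma OK_rt [simp]: "rt \<in> OK"
proof -
  have "algebraic_int (csqrt (of_int (- A)))" by (intro algebraic_int_csqrt algebraic_int_of_int)
  then show ?thesis unfolding csqrt_eq_rt by (simp add: ring_of_integers_def)
qed

lemma OK_rat_int: "x \<in> OK \<Longrightarrow> x \<in> \<rat> \<Longrightarrow> x \<in> \<int>"
  using rational_algebraic_int_is_int OK_alg by blast

lemma OK_norm_trace:
  assumes "x \<in> OK"
  shows "x * cnj x \<in> \<int>" "x + cnj x \<in> \<int>"
  using assms by (auto intro!: OK_rat_int K_norm_trace OK_K)

text \<open>\<open>x\<close> is a root of X^2 - trace X + norm. The criterion decides integrality of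
  quotients of which only norm and trace are under control, as in the inversion of ideals.\<close>

lemma OK_iff_norm_trace:
  "x \<in> OK \<longleftrightarrow> x \<in> K \<and> x * cnj x \<in> \<int> \<and> x + cnj x \<in> \<int>"
proof
  assume *: "x \<in> K \<and> x * cnj x \<in> \<int> \<and> x + cnj x \<in> \<int>"
  then obtain n t where n: "x * cnj x = of_int n" and t: "x + cnj x = of_int t"
    by (auto elim!: Ints_cases)
  have "poly [:of_int n, - of_int t, 1:] x = x * x - of_int t * x + of_int n"
    by (simp add: algebra_simps)
  also have "\<dots> = x * x - (x + cnj x) * x + x * cnj x" by (simp only: n t)
  also have "\<dots> = 0" by (simp add: algebra_simps)
  finally have "algebraic_int x"
    by (intro algebraic_int.intros[of "[:of_int n, - of_int t, 1:]"])
      (auto simp: coeff_pCons split: nat.splits)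
  then show "x \<in> OK" using * by (simp add: OK_I)
qed (auto simp: OK_norm_trace OK_K)

lemma rt_nonzero: "rt \<noteq> 0" using rt_sq A_pos by auto

text \<open>Twice the coordinates are integers m, n with m^2 + A n^2 divisible by 4; as A = 1 mod 4
  and squares are 0 or 1 mod 4, both are even.\<close>

lemma OK_explicit: "x \<in> OK \<longleftrightarrow> (\<exists>u v :: int. x = of_int u + of_int v * rt)"
proof
  assume x: "x \<in> OK"
  then obtain a b where e: "x = of_rat a + of_rat b * rt" using OK_K[OF x] by (auto simp: K_iff)
  have "x * cnj x = of_rat a * of_rat a - (of_rat b * of_rat b) * (rt * rt)"
    by (simp add: e cnj_rt algebra_simps)
  also have "\<dots> = of_rat (a * a + of_int A * b * b)"
    unfolding rt_sq by (simp add: of_rat_add of_rat_mult algebra_simps)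
  finally have "of_rat (a * a + of_int A * b * b) \<in> (\<int> :: complex set)"
    using OK_norm_trace(1)[OF x] by simp
  moreover have ofrat_int: "q \<in> \<int>" if "of_rat q \<in> (\<int> :: complex set)" for q
    using that by (metis Ints_cases Ints_of_int of_rat_eq_iff of_rat_of_int_eq)
  ultimately have 1: "a * a + of_int A * b * b \<in> \<int>" by blast
  have "x + cnj x = of_rat (2 * a)" by (simp add: e cnj_rt of_rat_mult)
  then have "2 * a \<in> \<int>" using OK_norm_trace(2)[OF x] ofrat_int by metis
  then obtain m where m: "2 * a = of_int m" by (auto elim: Ints_cases)
  have "of_int A * (2 * b) ^ 2 = 4 * (a * a + of_int A * b * b) - (2 * a) ^ 2"
    by (simp add: power2_eq_square algebra_simps)
  also have "\<dots> \<in> \<int>" unfolding m using 1 by (intro Ints_diff Ints_mult Ints_power) auto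
  finally have "2 * b \<in> \<int>" using A_sqf A_pos by (metis rat_square_int_imp_int less_irrefl)
  then obtain n where n: "2 * b = of_int n" by (auto elim: Ints_cases)
  obtain k where k: "a * a + of_int A * b * b = of_int k" using 1 by (auto elim: Ints_cases)
  have "of_int (m ^ 2 + A * n ^ 2) = (2 * a) ^ 2 + of_int A * (2 * b) ^ 2" by (simp add: m n)
  also have "\<dots> = of_int (4 * k)" by (simp add: k[symmetric] power2_eq_square algebra_simps)
  finally have k: "m ^ 2 + A * n ^ 2 = 4 * k" by (simp only: of_int_eq_iff)
  then have *: "(m ^ 2 + n ^ 2) mod 4 = 0" using A_mod4
    by (metis mod_add_right_eq mod_mult_left_eq mod_mult_self1_is_0 mult_1)
  have sq: "x ^ 2 mod 4 = 1" if "odd x" for x :: int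
  proof -
    from that obtain j where "x = 2 * j + 1" by (elim oddE)
    then have "x ^ 2 = 4 * (j ^ 2 + j) + 1" by (simp add: power2_eq_square algebra_simps)
    then show ?thesis by presburger
  qed
  have sq': "x ^ 2 mod 4 = 0" if "even x" for x :: int
    using that by (auto elim!: evenE simp: power2_eq_square)
  define p q where "p = m ^ 2 mod 4" and "q = n ^ 2 mod 4"
  have "(p + q) mod 4 = 0" unfolding p_def q_def using * by (simp only: mod_add_eq)
  moreover have "p = (if even m then 0 else 1)" "q = (if even n then 0 else 1)"
    using sq sq' by (auto simp: p_def q_def)
  ultimately have "even m \<and> even n" by (auto split: if_splits)
  then obtain u v where "m = 2 * u" "n = 2 * v" by (auto elim!: evenE)
  then have "a = of_int u" "b = of_int v" using m n by auto
  then show "\<exists>u v :: int. x = of_int u + of_int v * rt" using e by auto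
qed (auto intro!: OK_add OK_mult)

lemma rt_Im: "Re rt = 0" "Im rt = sqrt (of_int A)" "Im rt > 0"
  using A_pos by (auto simp: rt_def)

lemma OK_eq_iff: "of_int u + of_int v * rt = of_int u' + of_int v' * rt \<longleftrightarrow> u = u' \<and> v = v'"
  using rt_Im by (auto simp: complex_eq_iff)

text \<open>A unit has norm u^2 + A v^2 = 1, so it is 1 or -1 unless A = 1, where i and - i appear
  as well. The exponent 4 covers both cases and is prime to 3: it makes z = (z^3)^3 a cube.\<close>

lemma OK_unit_power4:
  assumes "z \<in> OK" "inverse z \<in> OK" "z \<noteq> 0"
  shows "z ^ 4 = 1"
proof -
  obtain u v where z: "z = of_int u + of_int v * rt" using assms(1) OK_explicit by auto
  have nz: "z * cnj z = of_int (u ^ 2 + A * v ^ 2)"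
  proof -
    have "z * cnj z = of_int u ^ 2 - of_int v ^ 2 * (rt * rt)"
      by (simp add: z cnj_rt power2_eq_square algebra_simps)
    then show ?thesis by (simp add: rt_sq)
  qed
  obtain n where n: "inverse z * cnj (inverse z) = of_int n"
    using OK_norm_trace(1)[OF assms(2)] by (auto elim: Ints_cases)
  have "of_int ((u ^ 2 + A * v ^ 2) * n) = (z * cnj z) * (inverse z * cnj (inverse z))"
    by (simp only: of_int_mult nz n)
  also have "\<dots> = of_int 1" using assms(3) by (simp add: field_simps)
  finally have "(u ^ 2 + A * v ^ 2) * n = 1" by (simp only: of_int_eq_iff)
  moreover have "u ^ 2 + A * v ^ 2 \<ge> 0" using A_pos by simp
  ultimately have eq: "u ^ 2 + A * v ^ 2 = 1"
    using zmult_eq_1_iff[of "u ^ 2 + A * v ^ 2" n] by linarith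
  show ?thesis
  proof (cases "v = 0")
    case True
    then have "u ^ 2 = 1" using eq by simp
    then have "u = 1 \<or> u = -1" by (simp add: power2_eq_1_iff)
    then show ?thesis using True z by auto
  next
    case False
    have "v ^ 2 \<ge> 1" using False by (metis le_less_linear power2_eq_iff_nonneg power_zero_numeral zero_le_power2 int_one_le_iff_zero_less zero_less_power2)
    have "A * v ^ 2 \<le> 1" using eq zero_le_power2[of u] by linarith
    moreover have "A * 1 \<le> A * v ^ 2" "1 * v ^ 2 \<le> A * v ^ 2"
      using \<open>v ^ 2 \<ge> 1\<close> A_pos by (auto intro!: mult_left_mono mult_right_mono simp del: mult_1)
    ultimately have "A = 1" "v ^ 2 = 1" using \<open>v ^ 2 \<ge> 1\<close> A_pos by linarith+
    then have "u = 0" using eq by simp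
    have r: "rt * rt = -1" using rt_sq \<open>A = 1\<close> by (metis of_int_1)
    have "z ^ 4 = of_int (v ^ 2) * of_int (v ^ 2) * (rt * rt) * (rt * rt)"
      by (simp add: z \<open>u = 0\<close> power2_eq_square eval_nat_numeral algebra_simps)
    then show ?thesis by (simp only: r \<open>v ^ 2 = 1\<close>) simp
  qed
qed

end

section \<open>Fractional ideals\<close>

abbreviation fi_mult (infixl "\<cdot>" 70) where "fi_mult \<equiv> fractional_ideal_mult"

lemma fi_mult_I:
  fixes n :: nat
  assumes "z = (\<Sum>i<n. x i * y i)" "\<forall>i<n. x i \<in> I \<and> y i \<in> J"
  shows "z \<in> I \<cdot> J"
  unfolding fractional_ideal_mult_def mem_Collect_eq
  by (rule exI[of _ n], rule exI[of _ x], rule exI[of _ y]) (use assms in simp)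

lemma fi_mult_zero: "0 \<in> I \<cdot> J"
  by (rule fi_mult_I[where n = 0]) auto

lemma fi_mult_mem: "x \<in> I \<Longrightarrow> y \<in> J \<Longrightarrow> x * y \<in> I \<cdot> J"
  by (rule fi_mult_I[where n = 1 and x = "\<lambda>_. x" and y = "\<lambda>_. y"]) auto

lemma fi_mult_E:
  assumes "z \<in> I \<cdot> J"
  obtains n :: nat and x y where "z = (\<Sum>i<n. x i * y i)" "\<forall>i<n. x i \<in> I \<and> y i \<in> J"
  using assms unfolding fractional_ideal_mult_def by (elim CollectE exE conjE) (rule that)

lemma fi_mult_add:
  assumes "z \<in> I \<cdot> J" "w \<in> I \<cdot> J"
  shows "z + w \<in> I \<cdot> J"
proof -
  obtain n :: nat and x y where z: "z = (\<Sum>i<n. x i * y i)" "\<forall>i<n. x i \<in> I \<and> y i \<in> J"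
    using fi_mult_E[OF assms(1)] .
  obtain m :: nat and x' y' where w: "w = (\<Sum>i<m. x' i * y' i)" "\<forall>i<m. x' i \<in> I \<and> y' i \<in> J"
    using fi_mult_E[OF assms(2)] .
  define u v where "u = (\<lambda>i. if i < n then x i else x' (i - n))"
    and "v = (\<lambda>i. if i < n then y i else y' (i - n))"
  have "(\<Sum>i<n + m. u i * v i) = (\<Sum>i<n. u i * v i) + (\<Sum>i=n..<n+m. u i * v i)"
    by (simp add: lessThan_atLeast0 sum.atLeastLessThan_concat)
  also have "(\<Sum>i<n. u i * v i) = z" unfolding z by (intro sum.cong) (auto simp: u_def v_def)
  also have "(\<Sum>i=n..<n+m. u i * v i) = (\<Sum>i<m. u (i + n) * v (i + n))"
    by (rule sum.reindex_bij_witness[of _ "\<lambda>i. i + n" "\<lambda>i. i - n"]) auto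
  also have "\<dots> = w" unfolding w by (intro sum.cong) (auto simp: u_def v_def)
  finally have "z + w = (\<Sum>i<n + m. u i * v i)" by simp
  moreover have "\<forall>i<n + m. u i \<in> I \<and> v i \<in> J" using z(2) w(2) by (auto simp: u_def v_def)
  ultimately show ?thesis by (rule fi_mult_I)
qed

lemma fi_mult_induct [consumes 1, case_names zero add]:
  assumes "z \<in> I \<cdot> J" "P 0" "\<And>x y z. x \<in> I \<Longrightarrow> y \<in> J \<Longrightarrow> P z \<Longrightarrow> P (z + x * y)"
  shows "P z"
proof -
  obtain n :: nat and x y where z: "z = (\<Sum>i<n. x i * y i)" "\<forall>i<n. x i \<in> I \<and> y i \<in> J"
    using fi_mult_E[OF assms(1)] .
  have "m \<le> n \<Longrightarrow> P (\<Sum>i<m. x i * y i)" for m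
    by (induction m) (auto intro!: assms(2,3) simp: z(2))
  from this[of n] show ?thesis using z(1) by simp
qed

lemma fi_mult_mono: "I \<subseteq> I' \<Longrightarrow> J \<subseteq> J' \<Longrightarrow> I \<cdot> J \<subseteq> I' \<cdot> J'"
  unfolding fractional_ideal_mult_def by blast

lemma fi_mult_commute: "I \<cdot> J = J \<cdot> I"
proof -
  have "I \<cdot> J \<subseteq> J \<cdot> I" for I J
  proof
    fix z assume "z \<in> I \<cdot> J"
    then show "z \<in> J \<cdot> I"
    proof (induction rule: fi_mult_induct)
      case (add x y z)
      have "y * x \<in> J \<cdot> I" using add by (intro fi_mult_mem)
      from fi_mult_add[OF add.IH this] show ?case by (simp add: algebra_simps)
    qed (rule fi_mult_zero)
  qed
  then show ?thesis by blast
qed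

lemma fi_mult_subsetI:
  assumes "\<And>x y. x \<in> I \<Longrightarrow> y \<in> J \<Longrightarrow> x * y \<in> L" "0 \<in> L" "\<And>x y. x \<in> L \<Longrightarrow> y \<in> L \<Longrightarrow> x + y \<in> L"
  shows "I \<cdot> J \<subseteq> L"
proof
  fix z assume "z \<in> I \<cdot> J"
  then show "z \<in> L" by (induction rule: fi_mult_induct) (auto intro: assms)
qed

lemma fi_mult_scale:
  assumes "z \<in> I \<cdot> J" "\<And>x. x \<in> I \<Longrightarrow> r * x \<in> I'"
  shows "r * z \<in> I' \<cdot> J"
  using assms(1)
proof (induction rule: fi_mult_induct)
  case (add x y z)
  have "(r * x) * y \<in> I' \<cdot> J" using add assms(2) by (intro fi_mult_mem) auto
  from fi_mult_add[OF add.IH this] show ?case by (simp add: algebra_simps)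
qed (auto intro: fi_mult_zero)

lemma fi_mult_assoc: "(I \<cdot> J) \<cdot> L = I \<cdot> (J \<cdot> L)"
proof -
  have *: "(I \<cdot> J) \<cdot> L \<subseteq> I \<cdot> (J \<cdot> L)" for I J L
  proof (rule fi_mult_subsetI)
    fix z l assume z: "z \<in> I \<cdot> J" and l: "l \<in> L"
    show "z * l \<in> I \<cdot> (J \<cdot> L)" using z
    proof (induction rule: fi_mult_induct)
      case (add x y z)
      have "x * (y * l) \<in> I \<cdot> (J \<cdot> L)" using add l by (intro fi_mult_mem)
      from fi_mult_add[OF add.IH this] show ?case by (simp add: algebra_simps)
    qed (auto intro: fi_mult_zero)
  qed (auto intro: fi_mult_zero fi_mult_add)
  have "I \<cdot> (J \<cdot> L) = (L \<cdot> J) \<cdot> I" by (metis fi_mult_commute)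
  also have "\<dots> \<subseteq> L \<cdot> (J \<cdot> I)" by (rule *)
  also have "\<dots> = (I \<cdot> J) \<cdot> L" by (metis fi_mult_commute)
  finally show ?thesis using * by blast
qed

context imag_quadratic
begin

abbreviation fi where "fi \<equiv> fractional_ideal K"

lemma fi_subset: "fi I \<Longrightarrow> x \<in> I \<Longrightarrow> x \<in> K"
  and fi_zero: "fi I \<Longrightarrow> 0 \<in> I"
  and fi_add: "fi I \<Longrightarrow> x \<in> I \<Longrightarrow> y \<in> I \<Longrightarrow> x + y \<in> I"
  and fi_scale: "fi I \<Longrightarrow> x \<in> I \<Longrightarrow> r \<in> OK \<Longrightarrow> r * x \<in> I"
  and fi_denom: "fi I \<Longrightarrow> \<exists>d\<in>OK. d \<noteq> 0 \<and> (\<forall>x\<in>I. d * x \<in> OK)"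
  unfolding fractional_ideal_def by blast+

lemma fi_nonzero: "fi I \<Longrightarrow> \<exists>x\<in>I. x \<noteq> 0"
proof -
  assume "fi I"
  then have "0 \<in> I" "I \<noteq> {0}" unfolding fractional_ideal_def by metis+
  then show ?thesis by blast
qed

lemma fi_I:
  assumes "I \<subseteq> K" "0 \<in> I" "\<exists>x\<in>I. x \<noteq> 0" "\<And>x y. x \<in> I \<Longrightarrow> y \<in> I \<Longrightarrow> x + y \<in> I"
    "\<And>r x. r \<in> OK \<Longrightarrow> x \<in> I \<Longrightarrow> r * x \<in> I" "d \<in> OK" "d \<noteq> 0" "\<And>x. x \<in> I \<Longrightarrow> d * x \<in> OK"
  shows "fi I"
  unfolding fractional_ideal_def
  by (intro conjI ballI bexI[of _ d]) (use assms in auto)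

lemma fi_minus: "fi I \<Longrightarrow> x \<in> I \<Longrightarrow> - x \<in> I"
  using fi_scale[of I x "-1"] OK_of_int[of "-1"] by simp

lemma fi_diff: "fi I \<Longrightarrow> x \<in> I \<Longrightarrow> y \<in> I \<Longrightarrow> x - y \<in> I"
  using fi_add[of I x "- y"] fi_minus[of I y] by simp

lemma fi_int_denom:
  assumes "fi I"
  obtains e :: int where "e > 0" "\<And>x. x \<in> I \<Longrightarrow> of_int e * x \<in> OK"
proof -
  obtain d where d: "d \<in> OK" "d \<noteq> 0" "\<forall>x\<in>I. d * x \<in> OK" using fi_denom[OF assms] by auto
  obtain e where e: "d * cnj d = of_int e" using OK_norm_trace(1)[OF d(1)] by (auto elim: Ints_cases)
  have "of_int e = complex_of_real ((cmod d)\<^sup>2)" using e by (simp only: complex_norm_square)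
  then have "real_of_int e = (cmod d)\<^sup>2" by (metis of_real_eq_iff of_real_of_int_eq)
  then have "real_of_int e > 0" using d(2) by simp
  moreover have "of_int e * x \<in> OK" if "x \<in> I" for x
  proof -
    have "cnj d * (d * x) \<in> OK" using OK_mult[OF OK_cnj[OF d(1)]] d(3) that by blast
    then show ?thesis by (simp add: e[symmetric] algebra_simps)
  qed
  ultimately show ?thesis using that by auto
qed

lemma fi_mult_fi:
  assumes I: "fi I" and J: "fi J"
  shows "fi (I \<cdot> J)"
proof -
  obtain d where d: "d \<in> OK" "d \<noteq> 0" "\<forall>x\<in>I. d * x \<in> OK" using fi_denom[OF I] by auto
  obtain e where e: "e \<in> OK" "e \<noteq> 0" "\<forall>x\<in>J. e * x \<in> OK" using fi_denom[OF J] by auto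
  obtain x where x: "x \<in> I" "x \<noteq> 0" using fi_nonzero[OF I] by auto
  obtain y where y: "y \<in> J" "y \<noteq> 0" using fi_nonzero[OF J] by auto
  show ?thesis
  proof (rule fi_I[where d = "d * e"])
    show "I \<cdot> J \<subseteq> K" using fi_subset[OF I] fi_subset[OF J] by (intro fi_mult_subsetI K_mult K_add) auto
    show "\<exists>x\<in>I \<cdot> J. x \<noteq> 0" using x y by (intro bexI[of _ "x * y"] fi_mult_mem) auto
    show "r * z \<in> I \<cdot> J" if "r \<in> OK" "z \<in> I \<cdot> J" for r z
      using that fi_scale[OF I] by (intro fi_mult_scale[of z I J r I]) auto
    show "d * e * z \<in> OK" if "z \<in> I \<cdot> J" for z using that
    proof (induction rule: fi_mult_induct)
      case (add x y z)
      have "d * e * (z + x * y) = d * e * z + (d * x) * (e * y)" by (simp add: algebra_simps)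
      moreover have "(d * x) * (e * y) \<in> OK" by (rule OK_mult) (use add d e in blast)+
      ultimately show ?case using add.IH OK_add by metis
    qed auto
  qed (use d e in \<open>auto intro: fi_mult_zero fi_mult_add\<close>)
qed

lemma fi_OK: "fi OK"
  by (rule fi_I[where d = 1]) (auto simp: OK_K intro: bexI[of _ 1])

lemma fi_one: "fi I \<Longrightarrow> OK \<cdot> I = I"
proof
  assume I: "fi I"
  show "OK \<cdot> I \<subseteq> I" by (rule fi_mult_subsetI) (auto intro: fi_scale[OF I] fi_zero[OF I] fi_add[OF I])
  show "I \<subseteq> OK \<cdot> I" using fi_mult_mem[of 1 OK _ I] by auto
qed

section \<open>Inversion of fractional ideals\<close>

definition fi_inv :: "complex set \<Rightarrow> complex set" where
  "fi_inv I = {b \<in> K. \<forall>x\<in>I. b * x \<in> OK}"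

text \<open>In a quadratic field the product of an ideal with its conjugate is generated by a
  rational number N, so the conjugate divided by N is an inverse. This gives invertibility without
  factorisation into primes. N is found as the positive generator of the rationals with denominator
  e^2 in that product.\<close>

lemma fi_inv:
  assumes I: "fi I"
  shows "fi (fi_inv I)" "fi_inv I \<cdot> I = OK"
proof -
  obtain e :: int where e: "e > 0" "\<And>x. x \<in> I \<Longrightarrow> of_int e * x \<in> OK"
    using fi_int_denom[OF I] by metis
  define J where "J = cnj ` I"
  have J: "cnj x \<in> J" if "x \<in> I" for x using that by (auto simp: J_def)
  have scJ: "r * y \<in> J" if "y \<in> J" "r \<in> OK" for r y
  proof -
    obtain x where "y = cnj x" "x \<in> I" using \<open>y \<in> J\<close> by (auto simp: J_def)
    then have "r * y = cnj (cnj r * x)" "cnj r * x \<in> I" using that fi_scale[OF I] by auto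
    then show ?thesis using J by metis
  qed
  have scIJ: "r * z \<in> I \<cdot> J" if "z \<in> I \<cdot> J" "r \<in> OK" for z r
    using that fi_scale[OF I] by (intro fi_mult_scale[of z I J r I]) auto
  \<comment> \<open>\<open>S\<close> is an ideal of the integers; \<open>nrm\<close> and
    \<open>trc\<close> place the scaled norms of elements of \<open>I\<close> and the scaled traces
    of the products x * cnj y in it.\<close>
  define S where "S = {k :: int. of_int k / of_int (e ^ 2) \<in> I \<cdot> J}"
  have S_diff: "k - l \<in> S" if "k \<in> S" "l \<in> S" for k l
  proof -
    have "of_int k / of_int (e ^ 2) + (- 1) * (of_int l / of_int (e ^ 2)) \<in> I \<cdot> J"
      using that OK_of_int[of "-1"] by (intro fi_mult_add scIJ) (auto simp: S_def)
    then show ?thesis by (simp add: S_def diff_divide_distrib)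
  qed
  have S_mult: "m * k \<in> S" if "k \<in> S" for m k :: int
    using that scIJ[of "of_int k / of_int (e ^ 2)" "of_int m"] by (simp add: S_def)
  have nrm: "\<exists>k\<in>S. of_int (e ^ 2) * (x * cnj x) = of_int k" if x: "x \<in> I" for x
  proof -
    have "(of_int e * x) * cnj (of_int e * x) \<in> \<int>" using e x by (intro OK_norm_trace)
    then obtain k where "(of_int e * x) * cnj (of_int e * x) = of_int k" by (auto elim: Ints_cases)
    then have k: "of_int (e ^ 2) * (x * cnj x) = of_int k" by (simp add: power2_eq_square algebra_simps)
    then have "of_int k / of_int (e ^ 2) = x * cnj x" using e(1) by (simp add: field_simps)
    then have "k \<in> S" using x J by (auto simp: S_def intro: fi_mult_mem)
    then show ?thesis using k by auto
  qed
  have trc: "\<exists>k\<in>S. of_int (e ^ 2) * (x * cnj y + cnj (x * cnj y)) = of_int k" if x: "x \<in> I" and y: "y \<in> I" for x y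
  proof -
    have "(of_int e * x) * cnj (of_int e * y) + cnj ((of_int e * x) * cnj (of_int e * y)) \<in> \<int>"
      using OK_norm_trace(2)[OF OK_mult[OF e(2)[OF x] OK_cnj[OF e(2)[OF y]]]] .
    then obtain k where "(of_int e * x) * cnj (of_int e * y) + cnj ((of_int e * x) * cnj (of_int e * y)) = of_int k"
      by (auto elim: Ints_cases)
    then have k: "of_int (e ^ 2) * (x * cnj y + cnj (x * cnj y)) = of_int k" by (simp add: power2_eq_square algebra_simps)
    then have "of_int k / of_int (e ^ 2) = x * cnj y + y * cnj x" using e(1) by (simp add: field_simps)
    then have "k \<in> S" using x y J by (auto simp: S_def intro!: fi_mult_mem fi_mult_add)
    then show ?thesis using k by auto
  qed
  obtain x0 where x0: "x0 \<in> I" "x0 \<noteq> 0" using fi_nonzero[OF I] by auto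
  have "\<exists>n. n > 0 \<and> int n \<in> S"
  proof -
    obtain k where k: "k \<in> S" "of_int (e ^ 2) * (x0 * cnj x0) = of_int k" using nrm[OF x0(1)] by auto
    have "k \<noteq> 0" using k(2) x0(2) e(1) by auto
    moreover have "- k \<in> S" using S_mult[OF k(1), of "-1"] by simp
    ultimately show ?thesis using k(1) by (intro exI[of _ "nat \<bar>k\<bar>"]) (auto simp: abs_if)
  qed
  then obtain n where n: "n > 0" "int n \<in> S" and min: "\<And>m. m > 0 \<Longrightarrow> int m \<in> S \<Longrightarrow> n \<le> m"
    using exists_least_iff[of "\<lambda>n. n > 0 \<and> int n \<in> S"] by (metis not_le)
  have dvd: "int n dvd k" if "k \<in> S" for k
  proof -
    have "k - (k div int n) * int n \<in> S" using that n by (intro S_diff S_mult)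
    then have *: "k mod int n \<in> S" by (simp add: minus_div_mult_eq_mod)
    have "\<not> nat (k mod int n) > 0"
    proof
      assume "nat (k mod int n) > 0"
      then have "n \<le> nat (k mod int n)" using * by (intro min) auto
      moreover have "k mod int n < int n" "k mod int n \<ge> 0" using n by auto
      ultimately show False by linarith
    qed
    then have "k mod int n = 0" using n by (metis nat_0_iff not_gr_zero of_nat_0_less_iff order_antisym pos_mod_sign)
    then show ?thesis by auto
  qed
  define N :: complex where "N = of_int (int n) / of_int (e ^ 2)"
  have N0: "N \<noteq> 0" using n e by (simp add: N_def)
  have NIJ: "N \<in> I \<cdot> J" using n(2) by (simp add: N_def S_def)
  have NK: "N \<in> K" unfolding N_def by (intro K_divide K_of_int)
  have cN: "cnj N = N" by (simp add: N_def)
  have divN: "z / N \<in> \<int>" if "of_int (e ^ 2) * z = of_int k" "k \<in> S" for k z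
  proof -
    from dvd[OF that(2)] obtain l where l: "k = int n * l" by auto
    have "z / N = of_int l" using that(1) n e unfolding l N_def by (simp add: field_simps)
    then show ?thesis by simp
  qed
  have inOK: "x * cnj y / N \<in> OK" if x: "x \<in> I" and y: "y \<in> I" for x y
  proof -
    obtain k where k: "k \<in> S" "of_int (e ^ 2) * (x * cnj x) = of_int k" using nrm[OF x] by auto
    obtain l where l: "l \<in> S" "of_int (e ^ 2) * (y * cnj y) = of_int l" using nrm[OF y] by auto
    obtain m where m: "m \<in> S" "of_int (e ^ 2) * (x * cnj y + cnj (x * cnj y)) = of_int m" using trc[OF x y] by auto
    \<comment> \<open>The norm of the quotient is the product of two norms, each divided by N, and
      its trace is a trace divided by N: both are integers by the choice of N, and norm and trace
      decide integrality.\<close>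
    have "(x * cnj y / N) * cnj (x * cnj y / N) = (x * cnj x / N) * (y * cnj y / N)"
      by (simp add: cN)
    also have "\<dots> \<in> \<int>" using divN[OF k(2,1)] divN[OF l(2,1)] by (rule Ints_mult)
    finally have "(x * cnj y / N) * cnj (x * cnj y / N) \<in> \<int>" .
    moreover have "x * cnj y / N + cnj (x * cnj y / N) \<in> \<int>"
      using divN[OF m(2,1)] by (simp add: cN add_divide_distrib)
    moreover have "x * cnj y / N \<in> K" using x y fi_subset[OF I] NK by (intro K_divide K_mult K_cnj)
    ultimately show ?thesis by (simp add: OK_iff_norm_trace)
  qed
  have inv_mem: "cnj y / N \<in> fi_inv I" if "y \<in> I" for y
    using inOK[OF _ that] that fi_subset[OF I] NK by (auto simp: fi_inv_def mult.commute intro!: K_divide K_cnj)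
  show "fi (fi_inv I)"
  proof (rule fi_I[where d = "of_int e * x0"])
    show "of_int e * x0 \<in> OK" "of_int e * x0 \<noteq> 0" using e x0 by auto
    show "\<exists>x\<in>fi_inv I. x \<noteq> 0" using inv_mem[OF x0(1)] x0(2) N0 by (intro bexI) auto
    show "of_int e * x0 * b \<in> OK" if "b \<in> fi_inv I" for b
    proof -
      have "of_int e * (b * x0) \<in> OK" by (rule OK_mult) (use that x0 in \<open>auto simp: fi_inv_def\<close>)
      then show ?thesis by (simp add: algebra_simps)
    qed
    show "x + y \<in> fi_inv I" if "x \<in> fi_inv I" "y \<in> fi_inv I" for x y
      using that by (auto simp: fi_inv_def distrib_right)
    show "r * x \<in> fi_inv I" if "r \<in> OK" "x \<in> fi_inv I" for r x
      using that by (auto simp: fi_inv_def mult.assoc OK_K OK_mult K_mult)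
  qed (auto simp: fi_inv_def)
  show "fi_inv I \<cdot> I = OK"
  proof
    show "fi_inv I \<cdot> I \<subseteq> OK" by (rule fi_mult_subsetI) (auto simp: fi_inv_def)
    have "z / N \<in> fi_inv I \<cdot> I" if "z \<in> I \<cdot> J" for z using that
    proof (induction rule: fi_mult_induct)
      case (add x y z)
      obtain y' where "y = cnj y'" "y' \<in> I" using add by (auto simp: J_def)
      then have "(y / N) * x \<in> fi_inv I \<cdot> I" using add inv_mem by (intro fi_mult_mem) auto
      from fi_mult_add[OF add.IH this] show ?case by (simp add: algebra_simps add_divide_distrib)
    qed (auto intro: fi_mult_zero)
    from this[OF NIJ] have 1: "1 \<in> fi_inv I \<cdot> I" using N0 by simp
    show "OK \<subseteq> fi_inv I \<cdot> I"
    proof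
      fix r assume r: "r \<in> OK"
      have "r * 1 \<in> fi_inv I \<cdot> I"
      proof (rule fi_mult_scale[OF 1])
        fix x assume "x \<in> fi_inv I"
        then show "r * x \<in> fi_inv I" using r by (auto simp: fi_inv_def mult.assoc OK_K OK_mult K_mult)
      qed
      then show "r \<in> fi_inv I \<cdot> I" by simp
    qed
  qed
qed

definition FG where "FG = fractional_ideal_group K"
definition PI where "PI = principal_fractional_ideals K"

lemma FG_simps: "carrier FG = {I. fi I}" "I \<otimes>\<^bsub>FG\<^esub> J = I \<cdot> J" "\<one>\<^bsub>FG\<^esub> = OK"
  by (simp_all add: FG_def fractional_ideal_group_def)

lemma FG_comm_group: "comm_group FG"
proof (rule comm_groupI)
  fix I assume "I \<in> carrier FG"
  then show "\<exists>J\<in>carrier FG. J \<otimes>\<^bsub>FG\<^esub> I = \<one>\<^bsub>FG\<^esub>"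
    by (intro bexI[of _ "fi_inv I"]) (auto simp: FG_simps fi_inv)
qed (simp_all add: FG_simps fi_mult_fi fi_OK fi_mult_assoc fi_one, rule fi_mult_commute)

definition pr :: "complex \<Rightarrow> complex set" where "pr a = (\<lambda>r. a * r) ` OK"

lemma pr_fi: "a \<in> K \<Longrightarrow> a \<noteq> 0 \<Longrightarrow> fi (pr a)"
proof -
  assume a: "a \<in> K" "a \<noteq> 0"
  obtain e :: int where e: "e \<noteq> 0" "of_int e * a \<in> OK"
  proof -
    obtain p q where pq: "a = of_rat p + of_rat q * rt" using a K_iff by auto
    obtain p1 p2 where p: "quotient_of p = (p1, p2)" by (cases "quotient_of p")
    obtain q1 q2 where q: "quotient_of q = (q1, q2)" by (cases "quotient_of q")
    have p': "p2 > 0" "p = of_int p1 / of_int p2" and q': "q2 > 0" "q = of_int q1 / of_int q2"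
      using quotient_of_denom_pos[OF p] quotient_of_div[OF p] quotient_of_denom_pos[OF q] quotient_of_div[OF q] by auto
    have "of_int (p2 * q2) * a = of_int (p1 * q2) + of_int (p2 * q1) * rt"
      using p'(1) q'(1) unfolding pq p'(2) q'(2) by (simp add: of_rat_divide field_simps)
    then have "of_int (p2 * q2) * a \<in> OK" unfolding OK_explicit by blast
    then show ?thesis using p' q' by (intro that[of "p2 * q2"]) auto
  qed
  show ?thesis
  proof (rule fi_I[where d = "of_int e"])
    show "pr a \<subseteq> K" using a by (auto simp: pr_def OK_K intro!: K_mult)
    show "0 \<in> pr a" by (auto simp: pr_def intro!: image_eqI[of _ _ 0])
    show "\<exists>x\<in>pr a. x \<noteq> 0" using a by (auto simp: pr_def intro!: bexI[of _ 1])
    show "x + y \<in> pr a" if "x \<in> pr a" "y \<in> pr a" for x y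
      using that by (auto simp: pr_def distrib_left[symmetric])
    show "r * x \<in> pr a" if "r \<in> OK" "x \<in> pr a" for r x
      using that by (auto simp: pr_def mult.left_commute[of r a] intro!: imageI OK_mult)
    show "of_int e * x \<in> OK" if x: "x \<in> pr a" for x
    proof -
      obtain r where r: "x = a * r" "r \<in> OK" using x by (auto simp: pr_def)
      have "(of_int e * a) * r \<in> OK" by (rule OK_mult) (use e r in auto)
      then show ?thesis by (simp add: r mult.assoc)
    qed
  qed (use e in auto)
qed

lemma pr_mult: "pr a \<cdot> pr b = pr (a * b)"
proof
  have "0 \<in> pr (a * b)" by (auto simp: pr_def intro!: image_eqI[of _ _ 0])
  moreover have "x + y \<in> pr (a * b)" if "x \<in> pr (a * b)" "y \<in> pr (a * b)" for x y
    using that by (auto simp: pr_def distrib_left[symmetric])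
  moreover have "x * y \<in> pr (a * b)" if "x \<in> pr a" "y \<in> pr b" for x y
  proof -
    from that obtain r s where "x = a * r" "y = b * s" "r \<in> OK" "s \<in> OK" by (auto simp: pr_def)
    then show ?thesis by (auto simp: pr_def intro!: image_eqI[of _ _ "r * s"] OK_mult)
  qed
  ultimately show "pr a \<cdot> pr b \<subseteq> pr (a * b)" by (intro fi_mult_subsetI) auto
  show "pr (a * b) \<subseteq> pr a \<cdot> pr b"
  proof
    fix x assume "x \<in> pr (a * b)"
    then obtain r where r: "x = a * b * r" "r \<in> OK" by (auto simp: pr_def)
    have "(a * r) * (b * 1) \<in> pr a \<cdot> pr b" using r by (intro fi_mult_mem) (auto simp: pr_def)
    then show "x \<in> pr a \<cdot> pr b" by (simp add: r algebra_simps)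
  qed
qed

lemma pr_1: "pr 1 = OK" by (simp add: pr_def)

lemma PI_eq: "PI = {pr a | a. a \<in> K \<and> a \<noteq> 0}"
  by (simp add: PI_def principal_fractional_ideals_def pr_def)

lemma PI_subgroup: "subgroup PI FG"
proof -
  interpret FG: comm_group FG by (rule FG_comm_group)
  show ?thesis
  proof (rule FG.subgroupI)
    show "PI \<subseteq> carrier FG" by (auto simp: PI_eq FG_simps pr_fi)
    show "PI \<noteq> {}" by (auto simp: PI_eq intro: exI[of _ 1])
    fix I assume "I \<in> PI"
    then obtain a where a: "I = pr a" "a \<in> K" "a \<noteq> 0" by (auto simp: PI_eq)
    have "inv\<^bsub>FG\<^esub> I = pr (inverse a)"
      by (rule FG.comm_inv_char) (use a in \<open>auto simp: FG_simps pr_fi pr_mult pr_1 K_inverse\<close>)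
    then show "inv\<^bsub>FG\<^esub> I \<in> PI" using a by (auto simp: PI_eq)
    fix J assume "J \<in> PI"
    then obtain b where b: "J = pr b" "b \<in> K" "b \<noteq> 0" by (auto simp: PI_eq)
    then show "I \<otimes>\<^bsub>FG\<^esub> J \<in> PI" using a
      by (auto simp: PI_eq FG_simps pr_mult intro!: exI[of _ "a * b"])
  qed
qed

section \<open>Finiteness of the class group\<close>

lemma abs_less_power2: "\<bar>x\<bar> < c \<Longrightarrow> x\<^sup>2 < c\<^sup>2" for x c :: rat
  by (metis abs_ge_zero power2_abs power_strict_mono zero_less_numeral)

text \<open>Dirichlet approximation as a substitute for division with remainder: among (A + 1)^2 + 1
  multiples of \<alpha>, two have their coordinates modulo 1 in the same one of (A + 1)^2
  boxes.\<close>

lemma K_approx: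
  assumes "\<alpha> \<in> K"
  obtains k \<beta> where "1 \<le> k" "k \<le> nat ((A + 1)\<^sup>2)" "\<beta> \<in> OK" "cmod (of_nat k * \<alpha> - \<beta>) < 1"
proof -
  obtain a b where ab: "\<alpha> = of_rat a + of_rat b * rt" using assms K_iff by auto
  \<comment> \<open>Boxes of side 1 / M give a difference of norm below (1 + A) / M^2, and M = A + 1
    turns this into 1 / M.\<close>
  define M where "M = A + 1"
  have M: "M > 1" using A_pos by (simp add: M_def)
  define f where "f = (\<lambda>k::nat. (\<lfloor>of_int M * frac (of_nat k * a)\<rfloor>, \<lfloor>of_int M * frac (of_nat k * b)\<rfloor>))"
  have fr: "\<lfloor>of_int M * frac x\<rfloor> \<in> {0..<M}" for x :: rat
  proof -
    have "0 \<le> of_int M * frac x" "of_int M * frac x < of_int M * 1"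
      using M frac_lt_1[of x] by (auto intro!: mult_strict_left_mono)
    then show ?thesis by (simp add: floor_less_iff)
  qed
  have "\<not> inj_on f {0..nat (M\<^sup>2)}"
  proof
    assume inj: "inj_on f {0..nat (M\<^sup>2)}"
    have "f ` {0..nat (M\<^sup>2)} \<subseteq> {0..<M} \<times> {0..<M}" using fr by (auto simp: f_def)
    then have "card {0..nat (M\<^sup>2)} \<le> card ({0..<M} \<times> {0..<M})"
      by (intro card_inj_on_le[OF inj]) auto
    then show False using M by (simp add: card_cartesian_product power2_eq_square nat_mult_distrib)
  qed
  then obtain i j where ij: "i < j" "j \<le> nat (M\<^sup>2)" "f i = f j"
    unfolding inj_on_def by (metis atLeastAtMost_iff linorder_neqE_nat)
  define k where "k = j - i"
  have near: "\<bar>of_nat k * x - of_int (\<lfloor>of_nat j * x\<rfloor> - \<lfloor>of_nat i * x\<rfloor>)\<bar> < 1 / of_int M"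
    if "\<lfloor>of_int M * frac (of_nat i * x)\<rfloor> = \<lfloor>of_int M * frac (of_nat j * x)\<rfloor>" for x :: rat
  proof -
    have "\<bar>of_int M * frac (of_nat j * x) - of_int M * frac (of_nat i * x)\<bar> < 1"
      using that floor_correct[of "of_int M * frac (of_nat j * x)"] floor_correct[of "of_int M * frac (of_nat i * x)"]
      by linarith
    also have "of_int M * frac (of_nat j * x) - of_int M * frac (of_nat i * x)
       = of_int M * (of_nat k * x - of_int (\<lfloor>of_nat j * x\<rfloor> - \<lfloor>of_nat i * x\<rfloor>))"
      using ij(1) by (simp add: k_def frac_def of_nat_diff algebra_simps)
    finally have "of_int M * \<bar>of_nat k * x - of_int (\<lfloor>of_nat j * x\<rfloor> - \<lfloor>of_nat i * x\<rfloor>)\<bar> < 1"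
      using M by (simp add: abs_mult)
    then show ?thesis using M by (simp add: less_divide_eq mult.commute)
  qed
  define u v where "u = \<lfloor>of_nat j * a\<rfloor> - \<lfloor>of_nat i * a\<rfloor>" and "v = \<lfloor>of_nat j * b\<rfloor> - \<lfloor>of_nat i * b\<rfloor>"
  define x y where "x = of_nat k * a - of_int u" and "y = of_nat k * b - of_int v"
  have xy: "\<bar>x\<bar> < 1 / of_int M" "\<bar>y\<bar> < 1 / of_int M"
    using near[of a] near[of b] ij(3) by (auto simp: f_def u_def v_def x_def y_def)
  have "of_nat k * \<alpha> - (of_int u + of_int v * rt) = of_rat x + of_rat y * rt"
    by (simp add: ab x_def y_def of_rat_diff of_rat_mult algebra_simps)
  moreover have "cmod (of_rat x + of_rat y * rt) < 1"
  proof -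
    have re: "of_rat q = complex_of_real (of_rat q)" for q by (cases q) (simp add: of_rat_rat)
    have "(cmod (of_rat x + of_rat y * rt))\<^sup>2 = (of_rat x)\<^sup>2 + (of_rat y * sqrt (of_int A))\<^sup>2"
      unfolding re cmod_power2 by (simp add: rt_Im)
    also have "\<dots> = of_rat (x\<^sup>2 + of_int A * y\<^sup>2)"
      using A_pos by (simp add: power_mult_distrib of_rat_add of_rat_mult of_rat_power)
    also have "(of_rat (x\<^sup>2 + of_int A * y\<^sup>2) :: real) < of_rat ((1 / of_int M)\<^sup>2 + of_int A * (1 / of_int M)\<^sup>2)"
      unfolding of_rat_less
    proof -
      have "x\<^sup>2 + of_int A * y\<^sup>2 < (1 / of_int M)\<^sup>2 + of_int A * (1 / of_int M)\<^sup>2"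
      using A_pos M abs_less_power2[OF xy(1)] abs_less_power2[OF xy(2)]
      by (intro add_strict_mono mult_strict_left_mono) auto
      then show "x\<^sup>2 + of_int A * y\<^sup>2 < (1 / of_int M)\<^sup>2 + of_int A * (1 / of_int M)\<^sup>2" .
    qed
    also have "(1 / of_int M)\<^sup>2 + of_int A * (1 / of_int M)\<^sup>2 = (1 / of_int M :: rat)"
    proof -
      have "(1 / of_int M)\<^sup>2 + of_int A * (1 / of_int M)\<^sup>2 = (of_int M * (1 / of_int M)\<^sup>2 :: rat)"
        by (simp add: M_def algebra_simps)
      also have "\<dots> = 1 / of_int M" using M by (simp add: power2_eq_square)
      finally show ?thesis .
    qed
    also have "of_rat (1 / of_int M :: rat) \<le> (1 :: real)" using M by (simp add: of_rat_divide)
    finally have "(cmod (of_rat x + of_rat y * rt))\<^sup>2 < 1" by (simp add: of_rat_less)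
    then show ?thesis by (simp add: abs_square_less_1)
  qed
  ultimately have "cmod (of_nat k * \<alpha> - (of_int u + of_int v * rt)) < 1" by simp
  moreover have "of_int u + of_int v * rt \<in> OK" by (auto simp: OK_explicit)
  moreover have "1 \<le> k" "k \<le> nat ((A + 1)\<^sup>2)" using ij by (auto simp: k_def M_def)
  ultimately show ?thesis using that by blast
qed

text \<open>The factorial is a common multiple of all multipliers k that \<open>K_approx\<close> can
  return.\<close>

definition class_bound :: nat where "class_bound = fact (nat ((A + 1)\<^sup>2))"

text \<open>Minkowski-free finiteness: for an element b of I of least absolute value, the multiple (m / b) I
  is an integral ideal containing the fixed integer m.\<close>
lemma reduced_ideal:
  assumes I: "fi I"
  obtains a where "a \<in> K" "a \<noteq> 0" "pr a \<cdot> I \<subseteq> OK" "of_nat class_bound \<in> pr a \<cdot> I"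
proof -
  obtain e :: int where e: "e > 0" "\<And>x. x \<in> I \<Longrightarrow> of_int e * x \<in> OK" using fi_int_denom[OF I] by metis
  obtain x0 where x0: "x0 \<in> I" "x0 \<noteq> 0" using fi_nonzero[OF I] by auto
  \<comment> \<open>Scaling by the denominator \<open>e\<close> turns norms into natural numbers, so
    that an element of least absolute value exists.\<close>
  define P where "P = (\<lambda>n :: nat. \<exists>x\<in>I. x \<noteq> 0 \<and> (of_int e * x) * cnj (of_int e * x) = of_nat n)"
  have ex: "\<exists>n. (of_int e * x) * cnj (of_int e * x) = of_nat n" if "x \<in> I" for x
  proof -
    obtain k where k: "(of_int e * x) * cnj (of_int e * x) = of_int k"
      using OK_norm_trace(1)[OF e(2)[OF \<open>x \<in> I\<close>]] by (auto elim: Ints_cases)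
    have "complex_of_real (of_int k) = of_real ((cmod (of_int e * x))\<^sup>2)"
      using k by (simp only: complex_norm_square of_real_of_int_eq)
    then have "real_of_int k = (cmod (of_int e * x))\<^sup>2" by (simp only: of_real_eq_iff)
    then have "k \<ge> 0" by (metis of_int_0_le_iff zero_le_power2)
    then show ?thesis using k by (intro exI[of _ "nat k"]) simp
  qed
  have "P (LEAST n. P n)"
    by (rule LeastI_ex) (use ex[OF x0(1)] x0 in \<open>auto simp: P_def\<close>)
  then obtain b where b: "b \<in> I" "b \<noteq> 0" "(of_int e * b) * cnj (of_int e * b) = of_nat (LEAST n. P n)"
    by (auto simp: P_def)
  have min: "x = 0" if x: "x \<in> I" "cmod x < cmod b" for x
  proof (rule ccontr)
    assume "x \<noteq> 0"
    obtain n where n: "(of_int e * x) * cnj (of_int e * x) = of_nat n" using ex[OF x(1)] by auto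
    have "(LEAST n. P n) \<le> n" by (rule Least_le) (use n x \<open>x \<noteq> 0\<close> in \<open>auto simp: P_def\<close>)
    moreover have "of_real ((cmod (of_int e * b))\<^sup>2) = complex_of_real (of_nat (LEAST n. P n))"
      using b(3) by (simp only: complex_norm_square of_real_of_nat_eq)
    then have "(cmod (of_int e * b))\<^sup>2 = of_nat (LEAST n. P n)" by (simp only: of_real_eq_iff)
    moreover have "of_real ((cmod (of_int e * x))\<^sup>2) = complex_of_real (of_nat n)"
      using n by (simp only: complex_norm_square of_real_of_nat_eq)
    then have "(cmod (of_int e * x))\<^sup>2 = of_nat n" by (simp only: of_real_eq_iff)
    ultimately have "(cmod (of_int e * b))\<^sup>2 \<le> (cmod (of_int e * x))\<^sup>2" by simp
    then have "cmod (of_int e * b) \<le> cmod (of_int e * x)" by (rule power2_le_imp_le) simp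
    then show False using x(2) e(1) by (simp add: norm_mult)
  qed
  have bK: "b \<in> K" using fi_subset[OF I] b by simp
  have dv: "of_nat class_bound * x / b \<in> OK" if x: "x \<in> I" for x
  proof -
    have "x / b \<in> K" using x bK fi_subset[OF I] by (intro K_divide) auto
    then obtain k \<beta> where k: "1 \<le> k" "k \<le> nat ((A + 1)\<^sup>2)" "\<beta> \<in> OK" "cmod (of_nat k * (x / b) - \<beta>) < 1"
      using K_approx by metis
    \<comment> \<open>An element of \<open>I\<close> smaller than \<open>b\<close>, hence zero: some
      multiple k of x / b with k <= (A + 1)^2 is integral, and with it the
      \<open>class_bound\<close> multiple.\<close>
    define y where "y = of_nat k * x - \<beta> * b"
    have "y \<in> I" unfolding y_def using x b k by (intro fi_diff[OF I] fi_scale[OF I]) auto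
    moreover have "y = (of_nat k * (x / b) - \<beta>) * b" using b(2) by (simp add: y_def field_simps)
    then have "cmod y < cmod b" using k(4) b(2) by (simp add: norm_mult)
    ultimately have "y = 0" by (rule min)
    then have e1: "of_nat k * x / b = \<beta>" using b(2) by (simp add: y_def)
    have "k dvd class_bound" unfolding class_bound_def by (rule dvd_fact) (use k in auto)
    then obtain l where "class_bound = l * k" by (metis dvd_div_mult_self)
    then have "of_nat class_bound * x / b = of_nat l * (of_nat k * x / b)" by simp
    also have "\<dots> \<in> OK" unfolding e1 using k by (intro OK_mult) auto
    finally show ?thesis .
  qed
  have cb: "class_bound > 0" by (simp add: class_bound_def)
  show ?thesis
  proof (rule that[of "of_nat class_bound / b"])
    show "of_nat class_bound / b \<in> K" using bK by (intro K_divide) auto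
    show "of_nat class_bound / b \<noteq> 0" using b cb by simp
    show "pr (of_nat class_bound / b) \<cdot> I \<subseteq> OK"
    proof (rule fi_mult_subsetI)
      fix x y assume "x \<in> pr (of_nat class_bound / b)" and y: "y \<in> I"
      then obtain r where r: "x = of_nat class_bound / b * r" "r \<in> OK" by (auto simp: pr_def)
      have "r * (of_nat class_bound * y / b) \<in> OK" by (rule OK_mult[OF r(2) dv[OF y]])
      then show "x * y \<in> OK" by (simp add: r mult_ac)
    qed auto
    have "(of_nat class_bound / b * 1) * b \<in> pr (of_nat class_bound / b) \<cdot> I"
      using b(1) by (intro fi_mult_mem) (auto simp: pr_def)
    then show "of_nat class_bound \<in> pr (of_nat class_bound / b) \<cdot> I" using b(2) by simp
  qed
qed

text \<open>By \<open>reduced_ideal\<close> every class contains an integral ideal having the fixed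
  integer m as a member, and such an ideal is determined by its members in the finite set
  \<open>R\<close> of representatives modulo m.\<close>

lemma finite_class_group: "finite (carrier (FG Mod PI))"
proof -
  interpret FG: comm_group FG by (rule FG_comm_group)
  define m where "m = int class_bound"
  have m: "m > 0" by (simp add: m_def class_bound_def)
  define R where "R = (\<lambda>(u,v). of_int u + of_int v * rt) ` ({0..<m} \<times> {0..<m})"
  have finR: "finite R" by (simp add: R_def)
  define S where "S = {J. fi J \<and> J \<subseteq> OK \<and> of_int m \<in> J}"
  have "inj_on (\<lambda>J. J \<inter> R) S"
  proof (rule inj_onI)
    have sub: "J \<subseteq> J'" if J: "J \<in> S" "J' \<in> S" "J \<inter> R = J' \<inter> R" for J J'
    proof
      fix x assume x: "x \<in> J"
      then have "x \<in> OK" using J by (auto simp: S_def)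
      then obtain u v where uv: "x = of_int u + of_int v * rt" by (auto simp: OK_explicit)
      define q where "q = of_int (u div m) + of_int (v div m) * rt"
      have q: "q \<in> OK" by (auto simp: q_def OK_explicit)
      have qm: "q * of_int m \<in> J" "q * of_int m \<in> J'" using J q by (auto simp: S_def intro!: fi_scale)
      have "x - q * of_int m = of_int (u mod m) + of_int (v mod m) * rt"
        unfolding minus_div_mult_eq_mod[symmetric] by (simp add: uv q_def algebra_simps)
      then have "x - q * of_int m \<in> R" using m by (auto simp: R_def intro!: image_eqI[of _ _ "(u mod m, v mod m)"])
      moreover have "x - q * of_int m \<in> J" using J x qm by (intro fi_diff) (auto simp: S_def)
      ultimately have "x - q * of_int m \<in> J'" using J by blast
      then have "x - q * of_int m + q * of_int m \<in> J'" using qm J by (intro fi_add) (auto simp: S_def)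
      then show "x \<in> J'" by simp
    qed
    fix J J' assume "J \<in> S" "J' \<in> S" "J \<inter> R = J' \<inter> R"
    then show "J = J'" using sub[of J J'] sub[of J' J] by auto
  qed
  moreover have "(\<lambda>J. J \<inter> R) ` S \<subseteq> Pow R" by auto
  ultimately have finS: "finite S" using finR by (metis finite_Pow_iff finite_imageD finite_subset)
  have "carrier (FG Mod PI) \<subseteq> (\<lambda>J. PI #>\<^bsub>FG\<^esub> J) ` S"
  proof
    fix C assume "C \<in> carrier (FG Mod PI)"
    then obtain I where I: "C = PI #>\<^bsub>FG\<^esub> I" "fi I" by (auto simp: carrier_FactGroup FG_simps)
    obtain a where a: "a \<in> K" "a \<noteq> 0" "pr a \<cdot> I \<subseteq> OK" "of_nat class_bound \<in> pr a \<cdot> I"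
      using reduced_ideal[OF I(2)] by metis
    have "fi (pr a \<cdot> I)" using a I pr_fi by (intro fi_mult_fi)
    then have "pr a \<cdot> I \<in> S" using a by (auto simp: S_def m_def)
    moreover have "PI #>\<^bsub>FG\<^esub> (pr a \<otimes>\<^bsub>FG\<^esub> I) = (PI #>\<^bsub>FG\<^esub> pr a) #>\<^bsub>FG\<^esub> I"
      using subgroup.subset[OF PI_subgroup] a I pr_fi
      by (intro FG.coset_mult_assoc[symmetric]) (auto simp: FG_simps)
    moreover have "PI #>\<^bsub>FG\<^esub> pr a = PI"
      using a pr_fi PI_subgroup by (intro FG.coset_join2) (auto simp: FG_simps PI_eq)
    ultimately show "C \<in> (\<lambda>J. PI #>\<^bsub>FG\<^esub> J) ` S" using I by (auto simp: FG_simps intro!: image_eqI[of _ _ "pr a \<cdot> I"])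
  qed
  then show ?thesis using finS by (metis finite_imageI finite_subset)
qed

section \<open>Ideals with principal cube\<close>

lemma cube_principal_imp_principal:
  assumes tors: "torsion_dim 3 (class_group K) = 0"
    and I: "fi I" and c: "c \<in> K" "c \<noteq> 0" and cube: "I \<cdot> I \<cdot> I = pr c"
  shows "\<exists>a\<in>K. a \<noteq> 0 \<and> I = pr a"
proof -
  interpret FG: comm_group FG by (rule FG_comm_group)
  have CG: "class_group K = FG Mod PI" by (simp add: class_group_def FG_def PI_def)
  interpret CG: comm_group "class_group K"
    unfolding CG by (rule FG.abelian_FactGroup[OF PI_subgroup])
  interpret N: normal PI FG by (rule FG.normal_iff_subgroup[THEN iffD2, OF PI_subgroup])
  have IG: "I \<in> carrier FG" using I by (simp add: FG_simps)
  define x where "x = PI #>\<^bsub>FG\<^esub> I"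
  have x: "x \<in> carrier (class_group K)" using IG by (auto simp: x_def CG carrier_FactGroup)
  have "x \<otimes>\<^bsub>class_group K\<^esub> x \<otimes>\<^bsub>class_group K\<^esub> x = PI #>\<^bsub>FG\<^esub> (I \<otimes>\<^bsub>FG\<^esub> I \<otimes>\<^bsub>FG\<^esub> I)"
    using IG by (simp add: x_def CG N.rcos_sum)
  also have "\<dots> = PI #>\<^bsub>FG\<^esub> pr c" by (simp add: FG_simps cube)
  also have "\<dots> = PI" using c pr_fi PI_subgroup by (intro FG.coset_join2) (auto simp: FG_simps PI_eq)
  finally have x3: "x \<otimes>\<^bsub>class_group K\<^esub> x \<otimes>\<^bsub>class_group K\<^esub> x = \<one>\<^bsub>class_group K\<^esub>" by (simp only: CG one_FactGroup)
  have "finite (carrier (class_group K))" using finite_class_group by (simp only: CG)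
  from CG.torsion_dim_3_eq_0_imp[OF this tors x x3] have "x = \<one>\<^bsub>class_group K\<^esub>" .
  then have "PI #>\<^bsub>FG\<^esub> I = PI" by (simp only: x_def CG one_FactGroup)
  moreover have "I \<in> PI #>\<^bsub>FG\<^esub> I" by (rule FG.rcos_self[OF IG PI_subgroup])
  ultimately have "I \<in> PI" by metis
  then show ?thesis by (auto simp: PI_eq)
qed

text \<open>Conditions on elements in place of ideal factorisation: \<open>cube\<close> puts the
  third power of I inside (c), \<open>inv_cube\<close> puts the third power of the inverse inside (1
  / c), and together they force equality.\<close>

lemma principal_criterion:
  assumes tors: "torsion_dim 3 (class_group K) = 0"
    and I: "fi I" and c: "c \<in> K" "c \<noteq> 0"
    and cube: "\<And>x y z. x \<in> I \<Longrightarrow> y \<in> I \<Longrightarrow> z \<in> I \<Longrightarrow> x * y * z / c \<in> OK"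
    and inv_cube: "\<And>x y z. x \<in> fi_inv I \<Longrightarrow> y \<in> fi_inv I \<Longrightarrow> z \<in> fi_inv I \<Longrightarrow> x * y * z * c \<in> OK"
  shows "\<exists>a\<in>K. a \<noteq> 0 \<and> I = pr a"
proof (rule cube_principal_imp_principal[OF tors I c])
  define J where "J = fi_inv I"
  have J: "fi J" "J \<cdot> I = OK" using fi_inv[OF I] by (auto simp: J_def)
  have sub3: "M \<cdot> M \<cdot> M \<subseteq> pr d" if M: "\<And>x y z. x \<in> M \<Longrightarrow> y \<in> M \<Longrightarrow> z \<in> M \<Longrightarrow> x * y * z / d \<in> OK"
    and d: "d \<in> K" "d \<noteq> 0" for M d
  proof -
    have D: "fi (pr d)" using d pr_fi by auto
    have *: "w \<in> pr d" if "w / d \<in> OK" for w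
      using that d by (auto simp: pr_def intro!: image_eqI[of _ _ "w / d"])
    show ?thesis
    proof (rule fi_mult_subsetI)
      fix w z assume w: "w \<in> M \<cdot> M" and z: "z \<in> M"
      show "w * z \<in> pr d" using w
      proof (induction rule: fi_mult_induct)
        case (add x y w)
        have "x * y * z \<in> pr d" using * M add z by blast
        from fi_add[OF D add.IH this] show ?case by (simp add: distrib_right)
      qed (simp add: fi_zero[OF D])
    qed (auto intro: fi_zero[OF D] fi_add[OF D])
  qed
  have ic: "inverse c \<in> K" "inverse c \<noteq> 0" using c by auto
  have "J \<cdot> J \<cdot> J \<subseteq> pr (inverse c)"
    by (rule sub3) (use inv_cube ic in \<open>auto simp: J_def divide_inverse\<close>)
  then have "(J \<cdot> J \<cdot> J) \<cdot> (I \<cdot> I \<cdot> I) \<subseteq> pr (inverse c) \<cdot> (I \<cdot> I \<cdot> I)" by (intro fi_mult_mono) auto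
  also have "(J \<cdot> J \<cdot> J) \<cdot> (I \<cdot> I \<cdot> I) = (J \<cdot> I) \<cdot> (J \<cdot> I) \<cdot> (J \<cdot> I)"
    by (metis fi_mult_assoc fi_mult_commute)
  also have "\<dots> = OK" by (simp add: J fi_one[OF fi_OK])
  finally have "pr c \<cdot> OK \<subseteq> pr c \<cdot> (pr (inverse c) \<cdot> (I \<cdot> I \<cdot> I))" by (intro fi_mult_mono) auto
  also have "\<dots> = I \<cdot> I \<cdot> I"
    using c by (simp add: fi_mult_assoc[symmetric] pr_mult pr_1 fi_one fi_mult_fi I)
  finally have "pr c \<subseteq> I \<cdot> I \<cdot> I" using fi_one[OF pr_fi[OF c]] by (metis fi_mult_commute)
  moreover have "I \<cdot> I \<cdot> I \<subseteq> pr c" by (rule sub3) (use cube c in auto)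
  ultimately show "I \<cdot> I \<cdot> I = pr c" by blast
qed

end

section \<open>Unramified cyclic cubic extensions\<close>

text \<open>Elements of the cyclic cubic extension of K generated by a root of X^3 - 3 t X - 2 u are represented
  by their 3-periodic sequences of conjugates, so that the Galois action is the shift of the index.\<close>

definition omega :: complex where "omega = Complex (- 1 / 2) (sqrt 3 / 2)"

lemma omega_sq: "omega * omega = - 1 - omega"
  by (simp add: omega_def complex_eq_iff)

lemma omega_cube: "omega ^ 3 = 1"
  using omega_sq by (Groebner_Basis.algebra)

text \<open>x, y, z are the roots of X^3 - 3 T X - 2 U in Cardano form. Hypothesis \<open>d\<close>
  selects the square root of the discriminant: the difference product of the roots is - 54 r. This
  fixes their cyclic order and makes products of two roots linear in x and y over the field of r, up
  to the factor T.\<close>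

lemma resolvent_identities:
  fixes p q T U r om :: complex
  assumes om: "om * om = - 1 - om" and pq: "p * q = T" and s: "p ^ 3 + q ^ 3 = 2 * U"
    and d: "(p ^ 3 - q ^ 3) * (2 * om + 1) = 18 * r"
  defines "x \<equiv> p + q" and "y \<equiv> om * p + om * om * q" and "z \<equiv> om * om * p + om * q"
  shows "T * (x * x) = 2 * T * T + (U + 3 * r) * x + 6 * r * y"
    and "T * (x * y) = - T * T + (- U + 3 * r) * x - (U + 3 * r) * y"
    and "x + y + z = 0" and "x * y + y * z + z * x = - 3 * T" and "x * y * z = 2 * U"
    and "(x - y) ^ 3 - 9 * T * (x - y) = - 54 * r"
proof -
  \<comment> \<open>\<open>d\<close> determines 18 r rather than r, hence the factor 18, cancelled
    at once.\<close>
  have "18 * (T * (x * x)) = 18 * (2 * T * T + (U + 3 * r) * x + 6 * r * y)"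
    using om pq s d unfolding x_def y_def z_def by (Groebner_Basis.algebra)
  then show "T * (x * x) = 2 * T * T + (U + 3 * r) * x + 6 * r * y" by (simp only: mult_cancel_left) simp
  have "18 * (T * (x * y)) = 18 * (- T * T + (- U + 3 * r) * x - (U + 3 * r) * y)"
    using om pq s d unfolding x_def y_def z_def by (Groebner_Basis.algebra)
  then show "T * (x * y) = - T * T + (- U + 3 * r) * x - (U + 3 * r) * y" by (simp only: mult_cancel_left) simp
  show "x + y + z = 0" using om unfolding x_def y_def z_def by (Groebner_Basis.algebra)
  show "x * y + y * z + z * x = - 3 * T" using om pq unfolding x_def y_def z_def by (Groebner_Basis.algebra)
  show "x * y * z = 2 * U" using om s unfolding x_def y_def z_def by (Groebner_Basis.algebra)
  show "(x - y) ^ 3 - 9 * T * (x - y) = - 54 * r"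
    using om pq s d unfolding x_def y_def z_def by (Groebner_Basis.algebra)
qed

text \<open>By \<open>eq\<close>, u + 3 w sqrt(3 A) has norm t^3 in the mirror field. The
  coefficient 27 makes \<open>dd\<close> integral, and \<open>cop\<close> makes the conjugates of
  \<open>th\<close>, which are differences of conjugates of \<open>dd\<close>, generate the unit
  ideal; together this is the absence of ramification. \<open>w0\<close> separates the roots. For a
  reducible cubic the sequences form a split algebra, so invertibility is asked of every
  conjugate.\<close>

locale cubic_field = imag_quadratic +
  fixes t u w :: int
  assumes eq: "u ^ 2 = t ^ 3 + 27 * A * w ^ 2" and cop: "coprime (3 * t) (2 * u)" and w0: "w \<noteq> 0"
begin

text \<open>Cardano's formula: kp and kq are the two real radicals, with kp kq = t, so th 0, th 1, th 2 are
  the roots of X^3 - 3 t X - 2 u. Its discriminant is 108 (t^3 - u^2) = (54 w)^2 (- A), a square in K.\<close>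
definition rr :: complex where "rr = of_int w * rt"
definition kp :: complex where "kp = of_real (root 3 (of_int u + 3 * of_int w * sqrt (3 * of_int A)))"
definition kq :: complex where "kq = of_real (root 3 (of_int u - 3 * of_int w * sqrt (3 * of_int A)))"
definition th :: "nat \<Rightarrow> complex" where "th j = omega ^ j * kp + omega ^ (2 * j) * kq"

lemma t0: "t \<noteq> 0"
proof
  assume "t = 0"
  then have "is_unit (2 * u)" using cop by simp
  then show False by (metis dvd_mult_left not_is_unit_0 zdvd1_eq odd_one dvd_triv_left dvd_trans)
qed

lemma kp_kq: "kp * kq = of_int t" "kp ^ 3 + kq ^ 3 = 2 * of_int u"
  "(kp ^ 3 - kq ^ 3) * (2 * omega + 1) = 18 * rr"
proof -
  define s where "s = sqrt (3 * real_of_int A)"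
  have s2: "s * s = 3 * of_int A"
    unfolding s_def using A_pos by (simp add: real_sqrt_mult_self)
  have p3: "root 3 x ^ 3 = x" for x by (simp add: odd_real_root_pow)
  have "(of_int u + 3 * of_int w * s) * (of_int u - 3 * of_int w * s) = (of_int u) ^ 2 - 9 * (of_int w) ^ 2 * (s * s)"
    by (simp add: power2_eq_square algebra_simps)
  also have "\<dots> = of_int (u ^ 2 - 27 * A * w ^ 2)" unfolding s2 by simp
  also have "u ^ 2 - 27 * A * w ^ 2 = t ^ 3" using eq by simp
  finally have "root 3 (of_int u + 3 * of_int w * s) * root 3 (of_int u - 3 * of_int w * s) = root 3 (of_int t ^ 3)"
    by (simp add: real_root_mult[symmetric])
  also have "\<dots> = of_int t" by (simp add: odd_real_root_power_cancel)
  finally show "kp * kq = of_int t" unfolding kp_def kq_def s_def[symmetric]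
    by (simp only: of_real_mult[symmetric]) simp
  have kp3: "kp ^ 3 = of_int u + 3 * of_int w * of_real s" and kq3: "kq ^ 3 = of_int u - 3 * of_int w * of_real s"
    unfolding kp_def kq_def s_def[symmetric] of_real_power[symmetric] p3 by simp_all
  show "kp ^ 3 + kq ^ 3 = 2 * of_int u" by (simp add: kp3 kq3)
  have "sqrt 3 * s = 3 * sqrt (of_int A)"
    by (simp add: s_def real_sqrt_mult)
  then have "6 * of_int w * s * sqrt 3 = 18 * of_int w * sqrt (of_int A)" by (simp add: mult.commute)
  then show "(kp ^ 3 - kq ^ 3) * (2 * omega + 1) = 18 * rr"
    by (simp add: kp3 kq3 rr_def rt_def omega_def complex_eq_iff)
qed

lemma th_period: "th (j + 3) = th j"
proof -
  have "omega ^ (2 * (j + 3)) = omega ^ (2 * j) * (omega ^ 3 * omega ^ 3)"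
    by (simp add: power_add[symmetric])
  then show ?thesis by (simp add: th_def power_add omega_cube)
qed

lemma th_identities:
  shows th_sq: "th j * th j = 2 * of_int t + ((of_int u + 3 * rr) / of_int t) * th j + (6 * rr / of_int t) * th (j + 1)"
    and th_th1: "th j * th (j + 1) = - of_int t + ((- of_int u + 3 * rr) / of_int t) * th j - ((of_int u + 3 * rr) / of_int t) * th (j + 1)"
    and th_e1: "th j + th (j + 1) + th (j + 2) = 0"
    and th_e2: "th j * th (j + 1) + th (j + 1) * th (j + 2) + th (j + 2) * th j = - 3 * of_int t"
    and th_e3: "th j * th (j + 1) * th (j + 2) = 2 * of_int u"
    and th_diff: "(th j - th (j + 1)) ^ 3 - 9 * of_int t * (th j - th (j + 1)) = - 54 * rr"
proof -
  define p q where "p = omega ^ j * kp" and "q = omega ^ (2 * j) * kq"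
  have o3: "omega ^ (3 * k) = 1" for k by (simp add: power_mult omega_cube)
  have 1: "p * q = of_int t"
  proof -
    have "p * q = omega ^ (3 * j) * (kp * kq)" by (simp add: p_def q_def power_add[symmetric] algebra_simps)
    then show ?thesis by (simp add: o3 kp_kq)
  qed
  have p3: "p ^ 3 = kp ^ 3"
  proof -
    have "p ^ 3 = omega ^ (3 * j) * kp ^ 3" by (simp add: p_def power_mult_distrib power_mult[symmetric] mult.commute)
    then show ?thesis by (simp add: o3)
  qed
  have q3: "q ^ 3 = kq ^ 3"
  proof -
    have "q ^ 3 = omega ^ (3 * (2 * j)) * kq ^ 3" by (simp add: q_def power_mult_distrib power_mult[symmetric] mult.commute)
    then show ?thesis by (simp only: o3) simp
  qed
  have T0: "of_int t \<noteq> (0 :: complex)" using t0 by simp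
  have e: "th j = p + q" "th (j + 1) = omega * p + omega * omega * q"
    by (simp_all add: th_def p_def q_def power_add power2_eq_square algebra_simps)
  have e2: "th (j + 2) = omega * omega * p + omega * q"
  proof -
    have e: "2 * (j + 2) = 2 * j + (3 + 1)" by simp
    have "omega ^ (2 * (j + 2)) * kq = omega ^ 3 * (omega * q)"
      unfolding e power_add q_def by (simp only: power_one_right mult_ac)
    then have "omega ^ (2 * (j + 2)) * kq = omega * q" by (simp only: omega_cube mult_1_left)
    moreover have "omega ^ (j + 2) * kp = omega * omega * p"
      unfolding p_def power_add power2_eq_square by (simp only: mult_ac)
    ultimately show ?thesis by (simp only: th_def)
  qed
  note R = resolvent_identities[OF omega_sq 1, of "of_int u" rr, unfolded p3 q3, OF kp_kq(2,3), folded e e2]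
  have gen: "z = - T + (a / T) * x - (b / T) * y"
    if "T * z = - T * T + a * x - b * y" "T \<noteq> 0" for T z a b x y :: complex
  proof -
    have "z = (- T * T + a * x - b * y) / T" unfolding that(1)[symmetric] using that(2) by simp
    then show ?thesis using that(2) by (simp add: diff_divide_distrib add_divide_distrib)
  qed
  show "th j * th j = 2 * of_int t + ((of_int u + 3 * rr) / of_int t) * th j + (6 * rr / of_int t) * th (j + 1)"
    using R(1) T0 by (simp add: field_simps)
  show "th j * th (j + 1) = - of_int t + ((- of_int u + 3 * rr) / of_int t) * th j - ((of_int u + 3 * rr) / of_int t) * th (j + 1)"
    by (rule gen[OF R(2) T0])
  show "th j + th (j + 1) + th (j + 2) = 0" by (rule R(3))
  show "th j * th (j + 1) + th (j + 1) * th (j + 2) + th (j + 2) * th j = - 3 * of_int t" by (rule R(4))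
  show "th j * th (j + 1) * th (j + 2) = 2 * of_int u" by (rule R(5))
  show "(th j - th (j + 1)) ^ 3 - 9 * of_int t * (th j - th (j + 1)) = - 54 * rr" by (rule R(6))
qed

section \<open>Arithmetic of conjugate sequences\<close>

lemma th_2: "th (Suc (Suc j)) = - th j - th (Suc j)"
  using th_e1[of j] by (simp add: algebra_simps add_eq_0_iff)

lemma rr_K: "rr \<in> K" and rr_sq: "rr * rr = - of_int (A * w ^ 2)" and rr0: "rr \<noteq> 0"
proof -
  show "rr \<in> K" "rr \<noteq> 0" using w0 rt_nonzero by (auto simp: rr_def)
  have "rr * rr = of_int w * of_int w * (rt * rt)" by (simp add: rr_def mult_ac)
  then show "rr * rr = - of_int (A * w ^ 2)" unfolding rt_sq by (simp add: power2_eq_square mult_ac)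
qed

text \<open>One triple of coefficients for all j says that the entries are conjugate over K. The
  span of 1, \<open>th\<close> and its shift is stable under the shift because the roots add up to
  0, and closed under products by \<open>th_sq\<close> and \<open>th_th1\<close>.\<close>

definition inN :: "(nat \<Rightarrow> complex) \<Rightarrow> bool" where
  "inN x \<longleftrightarrow> (\<exists>a\<in>K. \<exists>b\<in>K. \<exists>c\<in>K. \<forall>j. x j = a + b * th j + c * th (j + 1))"

definition inR :: "(nat \<Rightarrow> complex) \<Rightarrow> bool" where
  "inR x \<longleftrightarrow> inN x \<and> (\<forall>j. algebraic_int (x j))"

lemma inN_I: "a \<in> K \<Longrightarrow> b \<in> K \<Longrightarrow> c \<in> K \<Longrightarrow> (\<And>j. x j = a + b * th j + c * th (j + 1)) \<Longrightarrow> inN x"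
  unfolding inN_def by blast

lemma inN_E:
  assumes "inN x"
  obtains a b c where "a \<in> K" "b \<in> K" "c \<in> K" "\<And>j. x j = a + b * th j + c * th (j + 1)"
  using assms unfolding inN_def by blast

lemma inN_const: "a \<in> K \<Longrightarrow> inN (\<lambda>_. a)"
  by (rule inN_I[of a 0 0]) auto

lemma inN_th: "inN th"
  by (rule inN_I[of 0 1 0]) auto

lemma inN_add: "inN x \<Longrightarrow> inN y \<Longrightarrow> inN (\<lambda>j. x j + y j)"
proof -
  assume "inN x" "inN y"
  then obtain a b c a' b' c' where *: "a \<in> K" "b \<in> K" "c \<in> K" "\<And>j. x j = a + b * th j + c * th (j + 1)"
    "a' \<in> K" "b' \<in> K" "c' \<in> K" "\<And>j. y j = a' + b' * th j + c' * th (j + 1)" by (metis inN_E)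
  show ?thesis
    by (rule inN_I[of "a + a'" "b + b'" "c + c'"]) (use * in \<open>auto simp: algebra_simps\<close>)
qed

lemma inN_scale: "k \<in> K \<Longrightarrow> inN x \<Longrightarrow> inN (\<lambda>j. k * x j)"
proof -
  assume k: "k \<in> K" and "inN x"
  then obtain a b c where *: "a \<in> K" "b \<in> K" "c \<in> K" "\<And>j. x j = a + b * th j + c * th (j + 1)" by (metis inN_E)
  show ?thesis
    by (rule inN_I[of "k * a" "k * b" "k * c"]) (use * k in \<open>auto simp: algebra_simps\<close>)
qed

lemma inN_minus: "inN x \<Longrightarrow> inN (\<lambda>j. - x j)"
  using inN_scale[of "-1" x] K_of_int[of "-1"] by simp

lemma inN_diff: "inN x \<Longrightarrow> inN y \<Longrightarrow> inN (\<lambda>j. x j - y j)"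
  using inN_add[of x "\<lambda>j. - y j"] inN_minus[of y] by simp

lemma inN_shift: "inN x \<Longrightarrow> inN (\<lambda>j. x (Suc j))"
proof -
  assume "inN x"
  then obtain a b c where *: "a \<in> K" "b \<in> K" "c \<in> K" "\<And>j. x j = a + b * th j + c * th (j + 1)" by (metis inN_E)
  show ?thesis
    by (rule inN_I[of a "- c" "b - c"]) (use * in \<open>auto simp: th_2 algebra_simps\<close>)
qed

lemma inN_shifts: "inN x \<Longrightarrow> inN (\<lambda>j. x (j + k))"
  by (induction k) (use inN_shift in \<open>fastforce simp: \<close>)+

lemma inN_th_products: "inN (\<lambda>j. th j * th j)" "inN (\<lambda>j. th j * th (Suc j))"
proof -
  have k: "(of_int u + 3 * rr) / of_int t \<in> K" "6 * rr / of_int t \<in> K" "(- of_int u + 3 * rr) / of_int t \<in> K"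
    using rr_K by (auto intro!: K_divide K_add K_mult K_minus)
  show "inN (\<lambda>j. th j * th j)" by (rule inN_I[OF _ k(1,2) th_sq]) auto
  have "- ((of_int u + 3 * rr) / of_int t) \<in> K" using k by auto
  then show "inN (\<lambda>j. th j * th (Suc j))"
    by (intro inN_I[of "- of_int t" "(- of_int u + 3 * rr) / of_int t" "- ((of_int u + 3 * rr) / of_int t)"])
      (use th_th1 k in \<open>auto simp: algebra_simps intro!: K_minus\<close>)
qed

lemma inN_mult:
  assumes "inN x" "inN y"
  shows "inN (\<lambda>j. x j * y j)"
proof -
  have 1: "inN (\<lambda>j. th j * y j)" if "inN y" for y
  proof -
    obtain a b c where *: "a \<in> K" "b \<in> K" "c \<in> K" "\<And>j. y j = a + b * th j + c * th (j + 1)" using inN_E[OF \<open>inN y\<close>] by metis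
    have "inN (\<lambda>j. a * th j + b * (th j * th j) + c * (th j * th (Suc j)))"
      using * by (intro inN_add inN_scale inN_th inN_th_products)
    then show ?thesis using * by (simp add: algebra_simps)
  qed
  have 2: "inN (\<lambda>j. th (Suc j) * y j)"
  proof -
    obtain a b c where *: "a \<in> K" "b \<in> K" "c \<in> K" "\<And>j. y j = a + b * th j + c * th (j + 1)" using assms(2) by (metis inN_E)
    have "inN (\<lambda>j. a * th (Suc j) + b * (th j * th (Suc j)) + c * (th (Suc j) * th (Suc j)))"
      using * inN_shift[OF inN_th] inN_shift[OF inN_th_products(1)]
      by (intro inN_add inN_scale inN_th_products) auto
    then show ?thesis using * by (simp add: algebra_simps)
  qed
  obtain a b c where *: "a \<in> K" "b \<in> K" "c \<in> K" "\<And>j. x j = a + b * th j + c * th (j + 1)" using assms(1) by (metis inN_E)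
  have "inN (\<lambda>j. a * y j + b * (th j * y j) + c * (th (Suc j) * y j))"
    using * 1 2 assms by (intro inN_add inN_scale)
  then show ?thesis using * by (simp add: algebra_simps)
qed

lemma inN_period: "inN x \<Longrightarrow> x (j + 3) = x j"
proof -
  assume "inN x"
  then obtain a b c where *: "\<And>j. x j = a + b * th j + c * th (j + 1)" by (metis inN_E)
  show ?thesis using th_period[of j] th_period[of "j + 1"] by (simp add: * add.commute add.left_commute)
qed

text \<open>Averaging over the three conjugates removes \<open>b\<close> and \<open>c\<close>, since
  the sum of the roots is 0.\<close>

lemma inN_const_iff: "inN (\<lambda>_. a) \<longleftrightarrow> a \<in> K"
proof
  assume "inN (\<lambda>_. a)"
  then obtain k b c where *: "k \<in> K" "\<And>j. a = k + b * th j + c * th (j + 1)" by (metis inN_E)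
  have "3 * a = (k + b * th 0 + c * th 1) + (k + b * th 1 + c * th 2) + (k + b * th 2 + c * th 3)"
  proof -
    have "a = k + b * th 0 + c * th 1" using *(2)[of 0] by simp
    moreover have "a = k + b * th 1 + c * th 2" using *(2)[of 1] by (simp add: numeral_2_eq_2)
    moreover have "a = k + b * th 2 + c * th 3" using *(2)[of 2] by simp
    ultimately show ?thesis by (Groebner_Basis.algebra)
  qed
  also have "\<dots> = 3 * k + (b + c) * (th 0 + th 1 + th 2)"
    using th_period[of 0] by (simp add: algebra_simps)
  also have "th 0 + th 1 + th 2 = 0" using th_e1[of 0] by (simp add: numeral_2_eq_2)
  finally show "a \<in> K" using *(1) by simp
qed (rule inN_const)

definition nrm :: "(nat \<Rightarrow> complex) \<Rightarrow> complex" where "nrm x = x 0 * x 1 * x 2"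
definition trc :: "(nat \<Rightarrow> complex) \<Rightarrow> complex" where "trc x = x 0 + x 1 + x 2"

lemma period_cases:
  assumes "\<And>j. x (j + 3) = x (j :: nat)"
  shows "x j = x (j mod 3)"
proof -
  have "x (r + 3 * q) = x r" for q r
  proof (induction q)
    case (Suc q)
    have "x (r + 3 * Suc q) = x ((r + 3 * q) + 3)" by (simp add: add_ac)
    then show ?case by (simp only: assms Suc)
  qed simp
  from this[of "j mod 3" "j div 3"] show ?thesis by simp
qed

lemma nrm_trc:
  assumes "inN x"
  shows "x j * x (j + 1) * x (j + 2) = nrm x" "x j + x (j + 1) + x (j + 2) = trc x" "nrm x \<in> K" "trc x \<in> K"
proof -
  have p: "x (Suc (Suc (Suc 0))) = x 0" "x (Suc (Suc (Suc (Suc 0)))) = x (Suc 0)"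
    using inN_period[OF assms, of 0] inN_period[OF assms, of 1] by (simp_all add: eval_nat_numeral)
  have *: "f j = f (0 :: nat)" if "f 1 = f 0" "f 2 = f 0" "\<And>j. f (j + 3) = f j" for f :: "nat \<Rightarrow> complex" and j
  proof -
    have "f j = f (j mod 3)" using that(3) by (rule period_cases)
    moreover have "j mod 3 = 0 \<or> j mod 3 = 1 \<or> j mod 3 = 2" by auto
    ultimately show ?thesis using that by auto
  qed
  have q: "x (j + 3) = x j" "x (j + 3 + 1) = x (j + 1)" "x (j + 3 + 2) = x (j + 2)" for j
  proof -
    have e: "j + 3 + 1 = j + 1 + 3" "j + 3 + 2 = j + 2 + 3" by simp_all
    show "x (j + 3) = x j" "x (j + 3 + 1) = x (j + 1)" "x (j + 3 + 2) = x (j + 2)"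
      unfolding e by (rule inN_period[OF assms])+
  qed
  have 1: "x j * x (j + 1) * x (j + 2) = nrm x" for j
  proof -
    have "x j * x (j + 1) * x (j + 2) = x 0 * x (0 + 1) * x (0 + 2)"
      by (rule *[of "\<lambda>j. x j * x (j + 1) * x (j + 2)"]) (simp_all only: q, simp_all add: p eval_nat_numeral)
    then show ?thesis by (simp add: nrm_def eval_nat_numeral)
  qed
  have 2: "x j + x (j + 1) + x (j + 2) = trc x" for j
  proof -
    have "x j + x (j + 1) + x (j + 2) = x 0 + x (0 + 1) + x (0 + 2)"
      by (rule *[of "\<lambda>j. x j + x (j + 1) + x (j + 2)"]) (simp_all only: q, simp_all add: p eval_nat_numeral)
    then show ?thesis by (simp add: trc_def eval_nat_numeral)
  qed
  show "x j * x (j + 1) * x (j + 2) = nrm x" "x j + x (j + 1) + x (j + 2) = trc x" by (rule 1, rule 2)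
  have "inN (\<lambda>j. x j * x (j + 1) * x (j + 2))"
    using inN_shifts[OF assms, of 1] inN_shifts[OF assms, of 2] assms by (intro inN_mult) auto
  then show "nrm x \<in> K" unfolding 1 by (simp add: inN_const_iff)
  have "inN (\<lambda>j. x j + x (j + 1) + x (j + 2))"
    using inN_shifts[OF assms, of 1] inN_shifts[OF assms, of 2] assms by (intro inN_add) auto
  then show "trc x \<in> K" unfolding 2 by (simp add: inN_const_iff)
qed

lemma inN_inverse:
  assumes x: "inN x" and nz: "\<And>j. x j \<noteq> 0"
  shows "inN (\<lambda>j. inverse (x j))"
proof -
  have "inverse (x j) = inverse (nrm x) * (x (j + 1) * x (j + 2))" for j
    using nrm_trc(1)[OF x, of j, symmetric] nz by (simp add: field_simps)
  moreover have "inN (\<lambda>j. inverse (nrm x) * (x (j + 1) * x (j + 2)))"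
    using nrm_trc(3)[OF x] inN_shifts[OF x, of 1] inN_shifts[OF x, of 2] by (intro inN_scale inN_mult) auto
  ultimately show ?thesis by simp
qed

lemma inR_N: "inR x \<Longrightarrow> inN x" and inR_alg: "inR x \<Longrightarrow> algebraic_int (x j)" by (auto simp: inR_def)

lemma inR_cong: "inR x \<Longrightarrow> (\<And>j. x j = y j) \<Longrightarrow> inR y"
proof -
  assume x: "inR x" and "\<And>j. x j = y j"
  then have "x = y" by blast
  then show "inR y" using x by simp
qed

lemma inR_add: "inR x \<Longrightarrow> inR y \<Longrightarrow> inR (\<lambda>j. x j + y j)"
  and inR_diff: "inR x \<Longrightarrow> inR y \<Longrightarrow> inR (\<lambda>j. x j - y j)"
  and inR_minus: "inR x \<Longrightarrow> inR (\<lambda>j. - x j)"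
  and inR_mult: "inR x \<Longrightarrow> inR y \<Longrightarrow> inR (\<lambda>j. x j * y j)"
  and inR_shift: "inR x \<Longrightarrow> inR (\<lambda>j. x (Suc j))"
  and inR_shifts: "inR x \<Longrightarrow> inR (\<lambda>j. x (j + k))"
  and inR_const: "a \<in> OK \<Longrightarrow> inR (\<lambda>_. a)"
  by (auto simp: inR_def inN_add inN_diff inN_minus inN_mult inN_shift inN_shifts inN_const OK_K OK_alg)

lemma inR_const_iff: "inR (\<lambda>_. a) \<longleftrightarrow> a \<in> OK"
  by (auto simp: inR_def inN_const_iff ring_of_integers_def)

lemma inR_nrm_trc:
  assumes x: "inR x"
  shows "nrm x \<in> OK" "trc x \<in> OK"
proof -
  show "nrm x \<in> OK" using nrm_trc(3)[OF inR_N[OF x]] inR_alg[OF x] by (intro OK_I) (auto simp: nrm_def)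
  show "trc x \<in> OK" using nrm_trc(4)[OF inR_N[OF x]] inR_alg[OF x] by (intro OK_I) (auto simp: trc_def)
qed

definition dd :: "nat \<Rightarrow> complex" where "dd j = (th j - th (j + 1)) / 3"

text \<open>These integral elements, with conjugate differences equal to the conjugates of the root itself,
  witness that the extension is unramified.\<close>
lemma dd_R: "inR dd" and dd_diff: "dd j - dd (j + 1) = - th (j + 1)" and th_R: "inR th"
proof -
  have N: "inN dd"
    by (rule inN_I[of 0 "1 / 3" "- 1 / 3"]) (auto simp: dd_def field_simps intro!: K_divide K_minus)
  have *: "algebraic_int (dd j)" for j
  proof -
    have "dd j ^ 3 - of_int t * dd j = ((th j - th (j + 1)) ^ 3 - 9 * of_int t * (th j - th (j + 1))) / 27"
      by (simp add: dd_def field_simps power3_eq_cube)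
    also have "\<dots> = - 2 * rr" unfolding th_diff by simp
    finally have "(dd j ^ 3 - of_int t * dd j) ^ 2 = 4 * (rr * rr)" by (simp add: power2_eq_square)
    then have e: "(dd j ^ 3 - of_int t * dd j) ^ 2 = - of_int (4 * A * w ^ 2)" unfolding rr_sq by simp
    \<comment> \<open>\<open>dd j\<close> satisfies X^3 - t X = - 2 rr with \<open>rr\<close>
      irrational; squaring yields the monic integer polynomial X^6 - 2 t X^4 + t^2 X^2 + 4 A
      w^2.\<close>
    have "poly [:of_int (4 * A * w ^ 2), 0, of_int (t ^ 2), 0, of_int (- 2 * t), 0, 1:] (dd j)
      = (dd j ^ 3 - of_int t * dd j) ^ 2 + of_int (4 * A * w ^ 2)"
      by (simp add: algebra_simps power2_eq_square power3_eq_cube)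
    also have "\<dots> = 0" unfolding e by simp
    finally have p: "poly [:of_int (4 * A * w ^ 2), 0, of_int (t ^ 2), 0, of_int (- 2 * t), 0, 1:] (dd j) = 0" .
    show ?thesis
      by (rule algebraic_int.intros[OF _ _ p]) (auto simp: coeff_pCons simp del: of_int_mult of_int_power of_int_minus split: nat.splits)
  qed
  show R: "inR dd" using N * by (simp add: inR_def)
  show d: "dd j - dd (j + 1) = - th (j + 1)" for j
  proof -
    have "dd j - dd (j + 1) = (th j - 2 * th (Suc j) + th (Suc (Suc j))) / 3"
      by (simp add: dd_def diff_divide_distrib add_divide_distrib)
    also have "\<dots> = - th (j + 1)" unfolding th_2 by simp
    finally show ?thesis .
  qed
  have "th j = dd (j + 3) - dd (j + 2)" for j
    using d[of "j + 2"] th_period[of j] by (simp add: eval_nat_numeral) (metis minus_diff_eq minus_minus)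
  moreover have "inR (\<lambda>j. dd (j + 3) - dd (j + 2))" by (intro inR_diff inR_shifts R)
  ultimately show "inR th" by presburger
qed

lemma th_distinct: "th j \<noteq> th (j + 1)"
  using th_diff[of j] rr0 by auto

end

section \<open>Units of norm one under the class group hypothesis\<close>

locale cubic_unramified = cubic_field +
  assumes tors: "torsion_dim 3 (class_group K) = 0"
begin

text \<open>\<open>G c\<close> is the Lagrange resolvent of \<open>c\<close> for the cocycle 1, e, e
  s(e). It cannot vanish for 1, \<open>th\<close> and the square of \<open>th\<close> at once: the
  conjugates being distinct, the Vandermonde argument would force its first coefficient, which is 1,
  to be 0.\<close>

lemma hilbert_90:
  assumes e: "inR e" "nrm e = 1"
  obtains g where "inN g" "\<And>j. g j \<noteq> 0" "\<And>j. e j * g (j + 1) = g j"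
proof -
  define G where "G = (\<lambda>c j. c j + e j * c (j + 1) + e j * e (j + 1) * c (j + 2))"
  have eN: "inN e" by (rule inR_N[OF e(1)])
  have inNG: "inN (G c)" if "inN c" for c
    unfolding G_def using that inN_shifts[OF that, of 1] inN_shifts[OF that, of 2] inN_shifts[OF eN, of 1] eN
    by (intro inN_add inN_mult) auto
  have rec: "e j * G c (j + 1) = G c j" if "inN c" for c j
  proof -
    have "e j * G c (j + 1) = e j * c (j + 1) + e j * e (j + 1) * c (j + 2) + (e j * e (j + 1) * e (j + 2)) * c (j + 3)"
      by (simp add: G_def algebra_simps eval_nat_numeral)
    then show ?thesis using nrm_trc(1)[OF eN, of j] e(2) inN_period[OF that, of j]
      by (simp add: G_def)
  qed
  have "\<exists>c. inN c \<and> G c 0 \<noteq> 0"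
  proof (rule ccontr)
    assume "\<nexists>c. inN c \<and> G c 0 \<noteq> 0"
    then have z: "G c 0 = 0" if "inN c" for c using that by blast
    define a b where "a = e 0" and "b = e 0 * e 1"
    have "1 + a + b = 0" using z[OF inN_const[of 1]] by (simp add: G_def a_def b_def)
    moreover have "th 0 + a * th 1 + b * th 2 = 0" using z[OF inN_th]
      by (simp add: G_def a_def b_def eval_nat_numeral)
    moreover have "th 0 * th 0 + a * (th 1 * th 1) + b * (th 2 * th 2) = 0"
      using z[OF inN_th_products(1)] by (simp add: G_def a_def b_def eval_nat_numeral)
    ultimately have "(th 0 - th 1) * (th 2 - th 0) = 0" by (Groebner_Basis.algebra)
    moreover have "th 2 \<noteq> th 0"
      using th_distinct[of 2] th_period[of 0] by (simp add: eval_nat_numeral)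
    ultimately show False using th_distinct[of 0] by simp
  qed
  then obtain c where c: "inN c" "G c 0 \<noteq> 0" by blast
  show ?thesis
  proof (rule that[OF inNG[OF c(1)]])
    show "G c j \<noteq> 0" for j
    proof (induction j)
      case (Suc j)
      then show ?case using rec[OF c(1), of j] by auto
    qed (rule c(2))
  qed (rule rec[OF c(1)])
qed

lemma inR_int_multiple:
  assumes "inN x"
  obtains m :: int where "m \<noteq> 0" "inR (\<lambda>j. of_int m * x j)"
proof -
  obtain a b c where *: "a \<in> K" "b \<in> K" "c \<in> K" "\<And>j. x j = a + b * th j + c * th (j + 1)"
    using inN_E[OF assms] by metis
  have d: "\<exists>m::int. m \<noteq> 0 \<and> of_int m * z \<in> OK" if z: "z \<in> K" for z
  proof (cases "z = 0")
    case False
    obtain m where m: "m > 0" "\<And>y. y \<in> pr z \<Longrightarrow> of_int m * y \<in> OK" using fi_int_denom[OF pr_fi[OF z False]] by metis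
    have "z \<in> pr z" by (auto simp: pr_def intro!: image_eqI[of _ _ 1])
    then show ?thesis using m by (intro exI[of _ m]) auto
  qed (auto intro: exI[of _ 1])
  obtain k l m where k: "k \<noteq> 0" "of_int k * a \<in> OK" and l: "l \<noteq> 0" "of_int l * b \<in> OK"
    and m: "m \<noteq> 0" "of_int m * c \<in> OK" using d[OF *(1)] d[OF *(2)] d[OF *(3)] by blast
  have "inR (\<lambda>j. of_int (l * m) * (of_int k * a) + (of_int (k * m) * (of_int l * b)) * th j
      + (of_int (k * l) * (of_int m * c)) * th (Suc j))"
    by (intro inR_add inR_mult[OF inR_const th_R] inR_mult[OF inR_const inR_shift[OF th_R]] inR_const
      OK_mult[OF OK_of_int k(2)] OK_mult[OF OK_of_int l(2)] OK_mult[OF OK_of_int m(2)])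
  moreover have "(\<lambda>j. of_int (l * m) * (of_int k * a) + (of_int (k * m) * (of_int l * b)) * th j
      + (of_int (k * l) * (of_int m * c)) * th (Suc j)) = (\<lambda>j. of_int (k * l * m) * x j)"
    by (rule ext) (simp add: * algebra_simps)
  ultimately show ?thesis using k l m by (intro that[of "k * l * m"]) auto
qed

text \<open>A Galois-stable principal ideal (g) descends to an ideal of K because the extension is unramified,
  and the cube of that ideal is generated by the norm of g.\<close>
lemma norm_one_quotient:
  assumes e: "inR e" "nrm e = 1"
  obtains \<epsilon> where "inR \<epsilon>" "inR (\<lambda>j. inverse (\<epsilon> j))" "\<And>j. \<epsilon> j \<noteq> 0" "\<And>j. e j * \<epsilon> (j + 1) = \<epsilon> j"
proof -
  obtain g where g: "inN g" "\<And>j. g j \<noteq> 0" "\<And>j. e j * g (j + 1) = g j" using hilbert_90[OF e] by metis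
  have ig: "inN (\<lambda>j. inverse (g j))" using g by (intro inN_inverse)
  \<comment> \<open>The contraction of the ideal (g) to K.\<close>
  define I where "I = {x \<in> K. inR (\<lambda>j. x * inverse (g j))}"
  \<comment> \<open>(g) is Galois-stable: quotients of conjugates of g are products of conjugates of
    e, the inverse of an entry of e being the product of the next two.\<close>
  have gq: "inR (\<lambda>j. g (j + k) * inverse (g j))" for k
  proof (induction k)
    case 0
    then show ?case using g by (simp add: inR_const)
  next
    case (Suc k)
    have 1: "inR (\<lambda>j. e (j + k + 1) * e (j + k + 2))"
      using inR_mult[OF inR_shifts[OF e(1), of "k + 1"] inR_shifts[OF e(1), of "k + 2"]] by (simp add: add.assoc)
    have "g (j + Suc k) * inverse (g j) = (g (j + k) * inverse (g j)) * (e (j + k + 1) * e (j + k + 2))" for j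
    proof -
      have "e (j + k) * (e (j + k + 1) * e (j + k + 2)) = 1"
        using nrm_trc(1)[OF inR_N[OF e(1)], of "j + k"] e(2) by (simp add: mult.assoc)
      then have "g (j + k + 1) = g (j + k) * (e (j + k + 1) * e (j + k + 2))"
        using g(3)[of "j + k"] by (Groebner_Basis.algebra)
      then show ?thesis by (simp add: mult_ac)
    qed
    then show ?case by (intro inR_cong[OF inR_mult[OF Suc 1]]) (simp only:)
  qed
  \<comment> \<open>By this stability, traces of elements of (g) stay in (g), and they lie in
    K.\<close>
  have tr_mem: "trc (\<lambda>j. x j * g j) \<in> I" if x: "inR x" for x
  proof -
    have xg: "inN (\<lambda>j. x j * g j)" using x g inR_N by (intro inN_mult)
    have "inR (\<lambda>j. x j * (g (j + 0) * inverse (g j)) + x (j + 1) * (g (j + 1) * inverse (g j)) + x (j + 2) * (g (j + 2) * inverse (g j)))"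
      by (intro inR_add inR_mult[OF x gq] inR_mult[OF inR_shifts[OF x] gq])
    moreover have "x j * (g (j + 0) * inverse (g j)) + x (j + 1) * (g (j + 1) * inverse (g j)) + x (j + 2) * (g (j + 2) * inverse (g j))
      = trc (\<lambda>j. x j * g j) * inverse (g j)" for j
      unfolding nrm_trc(2)[OF xg, of j, symmetric] by (simp add: algebra_simps)
    ultimately have "inR (\<lambda>j. trc (\<lambda>j. x j * g j) * inverse (g j))" by simp
    then show ?thesis using nrm_trc(4)[OF xg] by (simp add: I_def)
  qed
  have ng: "nrm g \<in> K" "nrm g \<noteq> 0" using nrm_trc(3)[OF g(1)] g(2) by (auto simp: nrm_def)
  have I: "fi I"
  proof -
    obtain m :: int where m: "m \<noteq> 0" "inR (\<lambda>j. of_int m * g j)" using inR_int_multiple[OF g(1)] by metis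
    obtain n :: int where n: "n \<noteq> 0" "inR (\<lambda>j. of_int n * inverse (g j))" using inR_int_multiple[OF ig] by metis
    show ?thesis
    proof (rule fi_I[where d = "of_int m"])
      show "I \<subseteq> K" by (auto simp: I_def)
      show "0 \<in> I" by (simp add: I_def inR_const)
      show "\<exists>x\<in>I. x \<noteq> 0" using n by (intro bexI[of _ "of_int n"]) (auto simp: I_def)
      show "x + y \<in> I" if "x \<in> I" "y \<in> I" for x y
        using that inR_add by (auto simp: I_def distrib_right)
      show "r * x \<in> I" if "r \<in> OK" "x \<in> I" for r x
        using that inR_mult[OF inR_const[of r]] by (auto simp: I_def OK_K mult.assoc)
      show "of_int m * x \<in> OK" if "x \<in> I" for x
      proof -
        have "inR (\<lambda>j. (of_int m * g j) * (x * inverse (g j)))"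
          by (rule inR_mult[OF m(2)]) (use that in \<open>auto simp: I_def\<close>)
        moreover have "(of_int m * g j) * (x * inverse (g j)) = of_int m * x" for j using g(2)[of j] by (simp add: field_simps)
        ultimately show ?thesis by (simp add: inR_const_iff)
      qed
    qed (use m in auto)
  qed
  \<comment> \<open>The inclusion that needs the extension to be unramified: (g) is contained in the
    ideal that \<open>I\<close> generates upstairs.\<close>
  have bg: "inR (\<lambda>j. b * g j)" if b: "b \<in> fi_inv I" for b
  proof -
    have bK: "b \<in> K" using b by (simp add: fi_inv_def)
    have bt: "b * trc (\<lambda>j. x j * g j) \<in> OK" if "inR x" for x using b tr_mem[OF that] by (auto simp: fi_inv_def)
    \<comment> \<open>Sum (x j - x (k + 1)) (z j - z (k + 2)) b g k over the three residues k modulo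
      3: only k = j survives, and expanding gives traces of multiples of g, which b makes
      integral.\<close>
    have key: "inR (\<lambda>j. (x j - x (j + 1)) * (z j - z (j + 2)) * (b * g j))" if x: "inR x" and z: "inR z" for x z
    proof -
      let ?g = "\<lambda>x. b * trc (\<lambda>j. x j * g j)"
      have s: "inR (\<lambda>j. x (j + 1))" "inR (\<lambda>j. z (j + 2))" "inR (\<lambda>j. x (j + 1) * z (j + 2))"
        by (rule inR_shifts[OF x], rule inR_shifts[OF z], rule inR_mult[OF inR_shifts[OF x] inR_shifts[OF z]])
      have "inR (\<lambda>j. x j * z j * ?g (\<lambda>_. 1) - x j * ?g (\<lambda>j. z (j + 2)) - z j * ?g (\<lambda>j. x (j + 1)) + ?g (\<lambda>j. x (j + 1) * z (j + 2)))"
        by (intro inR_add inR_diff inR_mult[OF inR_mult[OF x z] inR_const] inR_mult[OF x inR_const]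
          inR_mult[OF z inR_const] inR_const[OF bt] bt s inR_const[OF OK_1])
      moreover have "x j * z j * ?g (\<lambda>_. 1) - x j * ?g (\<lambda>j. z (j + 2)) - z j * ?g (\<lambda>j. x (j + 1)) + ?g (\<lambda>j. x (j + 1) * z (j + 2))
         = (x j - x (j + 1)) * (z j - z (j + 2)) * (b * g j)" for j
      proof -
        have N: "inN (\<lambda>j. 1 * g j)" "inN (\<lambda>j. z (j + 2) * g j)" "inN (\<lambda>j. x (j + 1) * g j)" "inN (\<lambda>j. x (j + 1) * z (j + 2) * g j)"
          using g(1) s inR_N by (auto intro!: inN_mult)
        have p: "x (j + 3) = x j" "z (j + 3) = z j" "z (j + 4) = z (j + 1)"
          using inN_period[OF inR_N[OF x], of j] inN_period[OF inR_N[OF z], of j] inN_period[OF inR_N[OF z], of "j + 1"]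
          by (auto simp: eval_nat_numeral)
        show ?thesis
          unfolding nrm_trc(2)[OF N(1), of j, symmetric] nrm_trc(2)[OF N(2), of j, symmetric]
            nrm_trc(2)[OF N(3), of j, symmetric] nrm_trc(2)[OF N(4), of j, symmetric]
          using p by (simp add: eval_nat_numeral) (simp add: algebra_simps)
      qed
      ultimately show ?thesis by (rule inR_cong)
    qed
    \<comment> \<open>For shifts of \<open>dd\<close> both differences in \<open>key\<close> are
      conjugates of \<open>th\<close> up to sign.\<close>
    have tt: "inR (\<lambda>j. th (j + i) * th (j + k) * (b * g j))" for i k
    proof -
      have "inR (\<lambda>j. dd (j + (i + 2)))" "inR (\<lambda>j. dd (j + k))" by (intro inR_shifts dd_R)+
      from key[OF this] have "inR (\<lambda>j. (dd (j + (i + 2)) - dd (j + 1 + (i + 2))) * (dd (j + k) - dd (j + 2 + k)) * (b * g j))" .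
      moreover have "dd (j + (i + 2)) - dd (j + 1 + (i + 2)) = - th (j + i)" for j
        using dd_diff[of "j + (i + 2)"] th_period[of "j + i"] by (simp add: eval_nat_numeral)
      moreover have "dd (j + k) - dd (j + 2 + k) = th (j + k)" for j
      proof -
        have "dd (j + k) - dd (j + 2 + k) = (dd (j + k) - dd (j + k + 1)) + (dd (j + k + 1) - dd (j + k + 1 + 1))"
          by (simp add: eval_nat_numeral)
        also have "\<dots> = th (j + k)" unfolding dd_diff using th_2[of "j + k"] by simp
        finally show ?thesis .
      qed
      ultimately have "inR (\<lambda>j. - th (j + i) * th (j + k) * (b * g j))"
        by (simp only:)
      from inR_minus[OF this] show ?thesis by simp
    qed
    \<comment> \<open>The elementary symmetric functions of the roots, - 3 t and 2 u, now multiply b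
      g into the integers, and 3 t and 2 u are coprime.\<close>
    have "inR (\<lambda>j. - (th (j + 0) * th (j + 1) * (b * g j) + th (j + 1) * th (j + 2) * (b * g j) + th (j + 2) * th (j + 0) * (b * g j)))"
      by (intro inR_minus inR_add tt)
    moreover have "- (th (j + 0) * th (j + 1) * (b * g j) + th (j + 1) * th (j + 2) * (b * g j) + th (j + 2) * th (j + 0) * (b * g j)) = of_int (3 * t) * (b * g j)" for j
    proof -
      have "- (th (j + 0) * th (j + 1) * (b * g j) + th (j + 1) * th (j + 2) * (b * g j) + th (j + 2) * th (j + 0) * (b * g j))
        = - (th j * th (j + 1) + th (j + 1) * th (j + 2) + th (j + 2) * th j) * (b * g j)" by (simp add: algebra_simps)
      then show ?thesis unfolding th_e2 by simp
    qed
    ultimately have r3: "inR (\<lambda>j. of_int (3 * t) * (b * g j))" by (rule inR_cong)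
    have "inR (\<lambda>j. th (j + 2) * (th (j + 0) * th (j + 1) * (b * g j)))" by (rule inR_mult[OF inR_shifts[OF th_R] tt])
    moreover have "th (j + 2) * (th (j + 0) * th (j + 1) * (b * g j)) = of_int (2 * u) * (b * g j)" for j
      using th_e3[of j] by (simp add: mult_ac)
    ultimately have r2: "inR (\<lambda>j. of_int (2 * u) * (b * g j))" by (rule inR_cong)
    obtain p q where pq: "p * (3 * t) + q * (2 * u) = 1" using cop by (metis coprime_iff_gcd_eq_1 bezout_int)
    have "inR (\<lambda>j. of_int p * (of_int (3 * t) * (b * g j)) + of_int q * (of_int (2 * u) * (b * g j)))"
      by (intro inR_add inR_mult[OF inR_const r3] inR_mult[OF inR_const r2] OK_of_int)
    moreover have "of_int p * (of_int (3 * t) * (b * g j)) + of_int q * (of_int (2 * u) * (b * g j)) = b * g j" for j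
    proof -
      have "of_int p * (of_int (3 * t) * (b * g j)) + of_int q * (of_int (2 * u) * (b * g j)) = of_int (p * (3 * t) + q * (2 * u)) * (b * g j)"
        by (simp add: algebra_simps)
      then show ?thesis by (simp only: pq) simp
    qed
    ultimately show ?thesis by (rule inR_cong)
  qed
  have sh: "inR (\<lambda>j. f (j + k))" if "inR f" for f k using inR_shifts[OF that] .
  have "\<exists>a\<in>K. a \<noteq> 0 \<and> I = pr a"
  proof (rule principal_criterion[OF tors I ng])
    fix x y z assume xyz: "x \<in> I" "y \<in> I" "z \<in> I"
    then have "inR (\<lambda>j. (x * inverse (g j)) * (y * inverse (g (j + 1))) * (z * inverse (g (j + 2))))"
      using inR_mult[OF inR_mult[of "\<lambda>j. x * inverse (g j)", OF _ sh[of "\<lambda>j. y * inverse (g j)" 1]] sh[of "\<lambda>j. z * inverse (g j)" 2]]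
      by (simp add: I_def)
    moreover have "(x * inverse (g j)) * (y * inverse (g (j + 1))) * (z * inverse (g (j + 2))) = x * y * z / nrm g" for j
      unfolding nrm_trc(1)[OF g(1), of j, symmetric] by (simp add: field_simps)
    ultimately show "x * y * z / nrm g \<in> OK" by (simp add: inR_const_iff)
  next
    fix x y z assume xyz: "x \<in> fi_inv I" "y \<in> fi_inv I" "z \<in> fi_inv I"
    then have "inR (\<lambda>j. (x * g j) * (y * g (j + 1)) * (z * g (j + 2)))"
      using inR_mult[OF inR_mult[OF bg[of x] sh[OF bg[of y], of 1]] sh[OF bg[of z], of 2]] by simp
    then have "inR (\<lambda>j. x * y * z * nrm g)"
    proof (rule inR_cong)
      fix j
      show "(x * g j) * (y * g (j + 1)) * (z * g (j + 2)) = x * y * z * nrm g"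
        unfolding nrm_trc(1)[OF g(1), of j, symmetric] by (simp add: mult_ac)
    qed
    then show "x * y * z * nrm g \<in> OK" by (simp add: inR_const_iff)
  qed
  then obtain a where a: "a \<in> K" "a \<noteq> 0" "I = pr a" by blast
  have "a \<in> I" unfolding a(3) by (auto simp: pr_def intro!: image_eqI[of _ _ 1])
  then have 1: "inR (\<lambda>j. a * inverse (g j))" by (simp add: I_def)
  have "inverse a \<in> fi_inv I" using a unfolding a(3) by (auto simp: fi_inv_def pr_def mult.assoc[symmetric])
  then have 2: "inR (\<lambda>j. inverse a * g j)" by (rule bg)
  show ?thesis
  proof (rule that[OF 2])
    show "inR (\<lambda>j. inverse (inverse a * g j))" using 1 a by simp
    show "inverse a * g j \<noteq> 0" for j using a g by simp
    show "e j * (inverse a * g (j + 1)) = inverse a * g j" for j using g(3)[of j] by (simp add: mult.left_commute)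
  qed
qed

text \<open>A factor n from K does not affect the quotient; with n the norm of the unit f itself,
  the new norm is n^3 n = n^4 = 1.\<close>

lemma norm_one_quotient_norm_one:
  assumes e: "inR e" "nrm e = 1"
  obtains \<epsilon> where "inR \<epsilon>" "nrm \<epsilon> = 1" "\<And>j. e j * \<epsilon> (j + 1) = \<epsilon> j"
proof -
  obtain f where f: "inR f" "inR (\<lambda>j. inverse (f j))" "\<And>j. f j \<noteq> 0" "\<And>j. e j * f (j + 1) = f j"
    using norm_one_quotient[OF e] by metis
  define n where "n = nrm f"
  have n: "n \<in> OK" using inR_nrm_trc[OF f(1)] by (simp add: n_def)
  have "inverse n = nrm (\<lambda>j. inverse (f j))" by (simp add: n_def nrm_def)
  then have "inverse n \<in> OK" using inR_nrm_trc[OF f(2)] by simp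
  moreover have "n \<noteq> 0" using f(3) by (simp add: n_def nrm_def)
  ultimately have n4: "n ^ 4 = 1" using OK_unit_power4[OF n] by simp
  show ?thesis
  proof (rule that)
    show "inR (\<lambda>j. n * f j)" using f n by (intro inR_mult inR_const)
    have "nrm (\<lambda>j. n * f j) = n ^ 3 * nrm f" by (simp add: nrm_def power3_eq_cube mult_ac)
    also have "\<dots> = n ^ 4" by (simp add: n_def eval_nat_numeral)
    finally show "nrm (\<lambda>j. n * f j) = 1" by (simp add: n4)
    show "e j * (n * f (j + 1)) = n * f j" for j using f(4)[of j] by (simp add: mult.left_commute)
  qed
qed

text \<open>With e = f / s(f) and f = h / s(h), e is h to the power (1 - s)^2 = (1 + s + s^2) - 3 s.
  As h has norm 1, e is the cube of 1 / s(h) = h s^2(h).\<close>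

lemma norm_one_cube:
  assumes e: "inR e" "nrm e = 1"
  obtains \<psi> where "inR \<psi>" "nrm \<psi> = 1" "\<And>j. e j = \<psi> j ^ 3"
proof -
  obtain f where f: "inR f" "nrm f = 1" "\<And>j. e j * f (j + 1) = f j" using norm_one_quotient_norm_one[OF e] by metis
  obtain h where h: "inR h" "nrm h = 1" "\<And>j. f j * h (j + 1) = h j" using norm_one_quotient_norm_one[OF f(1,2)] by metis
  have n: "h j * h (j + 1) * h (j + 2) = 1" for j using nrm_trc(1)[OF inR_N[OF h(1)]] h(2) by simp
  show ?thesis
  proof (rule that)
    show R: "inR (\<lambda>j. h j * h (j + 2))" using h by (intro inR_mult inR_shifts)
    have "nrm (\<lambda>j. h j * h (j + 2)) = nrm h * nrm h"
      using inN_period[OF inR_N[OF h(1)], of 0] inN_period[OF inR_N[OF h(1)], of 1]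
      by (simp add: nrm_def eval_nat_numeral mult_ac)
    then show "nrm (\<lambda>j. h j * h (j + 2)) = 1" by (simp add: h)
    fix j
    have F: "f j * h (j + 1) = h j" "f (j + 1) * h (j + 2) = h (j + 1)" "e j * f (j + 1) = f j"
      using h(3)[of j] h(3)[of "j + 1"] f(3)[of j] by (auto simp: eval_nat_numeral)
    have "e j * (h (j + 1) * h (j + 1)) = e j * ((f (j + 1) * h (j + 2)) * h (j + 1))" by (simp only: F(2))
    also have "\<dots> = (e j * f (j + 1)) * h (j + 1) * h (j + 2)" by (simp only: mult_ac)
    also have "\<dots> = h j * h (j + 2)" by (simp only: F)
    finally have E: "e j * (h (j + 1) * h (j + 1)) = h j * h (j + 2)" .
    have "(h j * h (j + 2)) ^ 3 = (h j * h (j + 2)) * (h j * h (j + 2)) ^ 2" by (simp add: eval_nat_numeral)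
    also have "\<dots> = (e j * (h (j + 1) * h (j + 1))) * (h j * h (j + 2)) ^ 2" by (simp only: E)
    also have "\<dots> = e j * (h j * h (j + 1) * h (j + 2)) ^ 2" by (simp only: power2_eq_square mult_ac)
    finally show "e j = (h j * h (j + 2)) ^ 3" by (simp only: n) simp
  qed
qed

end

section \<open>Absolute values of norm-one units\<close>

context cubic_unramified
begin

lemma finite_OK_bounded: "finite {z \<in> OK. cmod z \<le> B}"
proof -
  define M where "M = \<lceil>B\<rceil> + 1"
  have "{z \<in> OK. cmod z \<le> B} \<subseteq> (\<lambda>(u,v). of_int u + of_int v * rt) ` ({-M..M} \<times> {-M..M})"
  proof
    fix z assume "z \<in> {z \<in> OK. cmod z \<le> B}"
    then obtain u v where z: "z = of_int u + of_int v * rt" "cmod z \<le> B" by (auto simp: OK_explicit)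
    have "\<bar>of_int u\<bar> \<le> B" using abs_Re_le_cmod[of z] z by (simp add: rt_Im)
    moreover have "\<bar>of_int v\<bar> \<le> B"
    proof -
      have "sqrt (of_int A) \<ge> 1" using A_pos by simp
      then have "\<bar>real_of_int v\<bar> * 1 \<le> \<bar>of_int v\<bar> * sqrt (of_int A)" by (intro mult_left_mono) auto
      also have "\<dots> = \<bar>Im z\<bar>" using A_pos by (simp add: z rt_Im abs_mult)
      also have "\<dots> \<le> B" using abs_Im_le_cmod[of z] z by simp
      finally show ?thesis by simp
    qed
    ultimately have "u \<in> {-M..M}" "v \<in> {-M..M}" unfolding M_def by (auto simp: abs_le_iff) linarith+
    then show "z \<in> (\<lambda>(u,v). of_int u + of_int v * rt) ` ({-M..M} \<times> {-M..M})" using z by auto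
  qed
  then show ?thesis by (rule finite_subset) auto
qed

text \<open>Bounded conjugates bound the coefficients of X^3 - a X^2 + b X - 1, and these lie in the
  discrete ring \<open>OK\<close>, so only finitely many cubics arise.\<close>

lemma finite_bounded_units: "finite {x 0 | x. inR x \<and> nrm x = 1 \<and> (\<forall>j. cmod (x j) \<le> B)}"
proof -
  define B' where "B' = \<bar>B\<bar>"
  define E1 where "E1 = {z \<in> OK. cmod z \<le> 3 * B'}"
  define E2 where "E2 = {z \<in> OK. cmod z \<le> 3 * (B' * B')}"
  have fin: "finite (E1 \<times> E2)" unfolding E1_def E2_def using finite_OK_bounded by auto
  have "{x 0 | x. inR x \<and> nrm x = 1 \<and> (\<forall>j. cmod (x j) \<le> B)}
      \<subseteq> (\<Union>(a,b)\<in>E1 \<times> E2. {z. poly [:-1, b, - a, 1:] z = 0})"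
  proof
    fix z assume "z \<in> {x 0 | x. inR x \<and> nrm x = 1 \<and> (\<forall>j. cmod (x j) \<le> B)}"
    then obtain x where x: "z = x 0" "inR x" "nrm x = 1" "\<And>j. cmod (x j) \<le> B" by auto
    \<comment> \<open>The trace of \<open>y\<close> is the second elementary symmetric function of
      the conjugates of \<open>x\<close>.\<close>
    define y where "y = (\<lambda>j. x j * x (j + 1))"
    have y: "inR y" unfolding y_def by (rule inR_mult[OF x(2) inR_shifts[OF x(2)]])
    have B: "cmod (x j) \<le> B'" for j using x(4)[of j] by (simp add: B'_def)
    have "cmod (trc x) \<le> cmod (x 0) + cmod (x 1) + cmod (x 2)"
      unfolding trc_def by (meson norm_triangle_le add_mono norm_triangle_ineq order_refl)
    then have 1: "trc x \<in> E1" using B[of 0] B[of 1] B[of 2] inR_nrm_trc[OF x(2)] by (simp add: E1_def)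
    have yB: "cmod (y j) \<le> B' * B'" for j
      unfolding y_def norm_mult using B by (intro mult_mono) (auto simp: B'_def)
    have "cmod (trc y) \<le> cmod (y 0) + cmod (y 1) + cmod (y 2)"
      unfolding trc_def by (meson norm_triangle_le add_mono norm_triangle_ineq order_refl)
    then have 2: "trc y \<in> E2" using yB[of 0] yB[of 1] yB[of 2] inR_nrm_trc[OF y] by (simp add: E2_def)
    have "x 3 = x 0" using inN_period[OF inR_N[OF x(2)], of 0] by simp
    then have t: "trc y = x 0 * x 1 + x 1 * x 2 + x 2 * x 0" by (simp add: trc_def y_def eval_nat_numeral)
    have tx: "trc x = x 0 + x 1 + x 2" by (simp add: trc_def)
    have "poly [:-1, trc y, - trc x, 1:] z = (x 0 - x 0) * (x 0 - x 1) * (x 0 - x 2) + (nrm x - 1)"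
      unfolding t tx nrm_def x(1) by (simp add: algebra_simps)
    then have "poly [:-1, trc y, - trc x, 1:] z = 0" using x(3) by simp
    then show "z \<in> (\<Union>(a,b)\<in>E1 \<times> E2. {z. poly [:-1, b, - a, 1:] z = 0})" using 1 2 by blast
  qed
  moreover have "finite {z. poly [:-1, b, - a, 1:] z = 0}" for a b :: complex
    by (rule poly_roots_finite) simp
  then have "finite (\<Union>(a,b)\<in>E1 \<times> E2. {z. poly [:-1, b, - a, 1:] z = 0})" using fin by auto
  ultimately show ?thesis by (rule finite_subset)
qed

text \<open>\<open>norm_one_cube\<close> gives an infinite chain of cube roots, all of norm 1.
  Taking cube roots moves absolute values towards 1, so the chain meets only finitely many values; a
  repetition makes one of them a root of unity, and \<open>e 0\<close> is a power of it.\<close>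

lemma norm_one_abs_1:
  assumes e: "inR e" "nrm e = 1"
  shows "cmod (e 0) = 1"
proof -
  define U where "U = {x. inR x \<and> nrm x = 1}"
  have "\<exists>f. \<forall>n. (f n \<in> U \<and> (n = 0 \<longrightarrow> f n = e)) \<and> (\<forall>j. f n j = f (Suc n) j ^ 3)"
  proof (rule dependent_nat_choice)
    show "\<exists>x. x \<in> U \<and> (0 = (0::nat) \<longrightarrow> x = e)" using e by (auto simp: U_def)
    fix x and n :: nat assume "x \<in> U \<and> (n = 0 \<longrightarrow> x = e)"
    then obtain y where "inR y" "nrm y = 1" "\<And>j. x j = y j ^ 3"
      using norm_one_cube[of x] by (auto simp: U_def)
    then show "\<exists>y. (y \<in> U \<and> (Suc n = 0 \<longrightarrow> y = e)) \<and> (\<forall>j. x j = y j ^ 3)"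
      by (intro exI[of _ y]) (simp add: U_def)
  qed
  then obtain f where f: "\<And>n. f n \<in> U" "f 0 = e" "\<And>n j. f n j = f (Suc n) j ^ 3" by metis
  \<comment> \<open>The 1 in the maximum is for small entries: their cube roots grow, but not beyond
    1.\<close>
  define B where "B = max 1 (max (cmod (e 0)) (max (cmod (e 1)) (cmod (e 2))))"
  have eB: "cmod (e j) \<le> B" for j
  proof -
    have "e j = e (j mod 3)" by (rule period_cases) (use inN_period[OF inR_N[OF e(1)]] in simp)
    moreover have "j mod 3 = 0 \<or> j mod 3 = 1 \<or> j mod 3 = 2" by auto
    ultimately show ?thesis by (auto simp: B_def)
  qed
  have fB: "cmod (f n j) \<le> B" for n j
  proof (induction n)
    case (Suc n)
    show ?case
    proof (rule ccontr)
      assume "\<not> cmod (f (Suc n) j) \<le> B"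
      then have *: "cmod (f (Suc n) j) > B" by simp
      moreover have "B \<ge> 1" by (simp add: B_def)
      ultimately have "cmod (f (Suc n) j) ^ 1 \<le> cmod (f (Suc n) j) ^ 3" by (intro power_increasing) auto
      then have "cmod (f (Suc n) j) \<le> cmod (f n j)" by (simp add: f(3)[of n] norm_power)
      then show False using * Suc by simp
    qed
  qed (simp add: f eB)
  have "range (\<lambda>n. f n 0) \<subseteq> {x 0 | x. inR x \<and> nrm x = 1 \<and> (\<forall>j. cmod (x j) \<le> B)}"
    using f(1) fB by (auto simp: U_def)
  then have "finite (range (\<lambda>n. f n 0))" using finite_bounded_units finite_subset by blast
  then have "\<not> inj (\<lambda>n. f n 0)" using finite_imageD infinite_UNIV_nat by blast
  then obtain m n where mn: "m < n" "f m 0 = f n 0" unfolding inj_def by (metis linorder_neqE_nat)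
  have pw: "f m j = f (m + k) j ^ (3 ^ k)" for m k j
  proof (induction k)
    case (Suc k)
    have "f (m + k) j = f (m + Suc k) j ^ 3" using f(3)[of "m + k"] by simp
    then show ?case using Suc by (simp add: power_mult mult.commute)
  qed simp
  have "f m 0 = f m 0 ^ (3 ^ (n - m))" using pw[of m 0 "n - m"] mn by simp
  then have *: "cmod (f m 0) = cmod (f m 0) ^ (3 ^ (n - m))" by (metis norm_power)
  have "f m 0 \<noteq> 0" using f(1)[of m] by (auto simp: U_def nrm_def)
  define k where "k = (3::nat) ^ (n - m)"
  have k: "k > 1" unfolding k_def by (rule one_less_power) (use mn in auto)
  have "cmod (f m 0) ^ (k - 1) = 1"
  proof -
    have "cmod (f m 0) * cmod (f m 0) ^ (k - 1) = cmod (f m 0) * 1"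
      using * k by (simp add: k_def[symmetric] power_Suc[symmetric])
    then show ?thesis using \<open>f m 0 \<noteq> 0\<close> by simp
  qed
  then have "cmod (f m 0) = 1" using k power_eq_iff_eq_base[of "k - 1" "cmod (f m 0)" 1] by simp
  moreover have "f 0 0 = f m 0 ^ (3 ^ m)" using pw[of 0 0 m] by simp
  ultimately show ?thesis using f(2) by (simp add: norm_power)
qed

end

section \<open>A unit with a conjugate off the unit circle\<close>

context cubic_unramified
begin

lemma th0_real: "Im (th 0) = 0" and th12_cnj: "th 2 = cnj (th 1)"
proof -
  show "Im (th 0) = 0" by (simp add: th_def kp_def kq_def)
  have "cnj omega = omega * omega" by (simp add: omega_sq) (simp add: omega_def complex_eq_iff)
  moreover have "omega ^ 4 = omega" using omega_cube by (Groebner_Basis.algebra)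
  ultimately show "th 2 = cnj (th 1)"
    by (simp add: th_def kp_def kq_def power2_eq_square eval_nat_numeral)
qed

text \<open>Elements of Z[\<open>th\<close>] by integer coordinates. For an irreducible cubic this
  is an order in a field with one real place (index 0) and one complex place (indices 1 and 2),
  where the unit rank is 1.\<close>

definition quad :: "int \<times> int \<times> int \<Rightarrow> nat \<Rightarrow> complex" where
  "quad = (\<lambda>(a, b, c) j. of_int a + of_int b * th j + of_int c * (th j * th j))"

lemma quad_R: "inR (quad v)"
  unfolding quad_def by (cases v) (auto intro!: inR_add inR_mult[OF inR_const] inR_mult[OF th_R th_R] inR_const th_R)

lemma quad_diff: "quad (a, b, c) j - quad (a', b', c') j = quad (a - a', b - b', c - c') j"
  by (simp add: quad_def algebra_simps)

lemma rational_root_imp_int: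
  assumes "th 0 \<in> \<rat> \<or> (\<exists>q\<in>\<rat>. q ^ 3 - 3 * of_int t * q - 2 * of_int u = (0 :: complex))"
  shows "\<exists>r :: int. r ^ 3 - 3 * t * r - 2 * u = 0"
proof -
  have "th 0 ^ 3 - 3 * of_int t * th 0 - 2 * of_int u = 0"
    using th_e1[of 0] th_e2[of 0] th_e3[of 0] by (Groebner_Basis.algebra)
  then obtain q :: complex where q: "q \<in> \<rat>" "q ^ 3 - 3 * of_int t * q - 2 * of_int u = 0" using assms by blast
  have "poly [: of_int (- 2 * u), of_int (- 3 * t), 0, 1:] q = q ^ 3 - 3 * of_int t * q - 2 * of_int u"
    by (simp add: algebra_simps power3_eq_cube)
  then have p: "poly [: of_int (- 2 * u), of_int (- 3 * t), 0, 1:] q = 0" using q(2) by simp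
  have "algebraic_int q"
    by (rule algebraic_int.intros[OF _ _ p]) (auto simp: coeff_pCons simp del: of_int_mult of_int_minus split: nat.splits)
  then have "q \<in> \<int>" using q(1) rational_algebraic_int_is_int by blast
  then obtain r where "q = of_int r" by (auto elim: Ints_cases)
  then have "of_int (r ^ 3 - 3 * t * r - 2 * u) = (0 :: complex)" using q(2) by simp
  then show ?thesis by (metis of_int_eq_0_iff)
qed

lemma quad_nonzero:
  assumes no: "\<not> (\<exists>r :: int. r ^ 3 - 3 * t * r - 2 * u = 0)" and nz: "(a, b, c) \<noteq> (0, 0, 0)"
  shows "quad (a, b, c) 0 \<noteq> 0"
proof
  assume z: "quad (a, b, c) 0 = 0"
  have cub: "th 0 * (th 0 * th 0) = 3 * of_int t * th 0 + 2 * of_int u"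
    using th_e1[of 0] th_e2[of 0] th_e3[of 0] by (Groebner_Basis.algebra)
  have irr: "p = 0 \<and> q = 0" if "p * th 0 + q = 0" "p \<in> \<rat>" "q \<in> \<rat>" for p q
  proof -
    have "p = 0"
    proof (rule ccontr)
      assume "p \<noteq> 0"
      then have "th 0 = - q / p" using that(1) by (simp add: field_simps add_eq_0_iff2)
      then have "th 0 \<in> \<rat>" using that by simp
      then show False using rational_root_imp_int no by blast
    qed
    then show ?thesis using that by simp
  qed
  have c: "c \<noteq> 0"
  proof
    assume "c = 0"
    then have "of_int b * th 0 + of_int a = 0" using z by (simp add: quad_def add.commute)
    from irr[OF this] have "b = 0" "a = 0" by auto
    then show False using nz \<open>c = 0\<close> by simp
  qed
  define \<beta> \<gamma> :: complex where "\<beta> = of_int b / of_int c" and "\<gamma> = of_int a / of_int c"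
  have rat: "\<beta> \<in> \<rat>" "\<gamma> \<in> \<rat>" by (auto simp: \<beta>_def \<gamma>_def)
  have sq: "th 0 * th 0 = - \<beta> * th 0 - \<gamma>"
  proof -
    have "of_int c * (th 0 * th 0) = - of_int b * th 0 - of_int a" using z
      by (simp add: quad_def eq_neg_iff_add_eq_0 algebra_simps)
    then show ?thesis using c by (simp add: \<beta>_def \<gamma>_def field_simps)
  qed
  have "(\<beta> * \<beta> - \<gamma> - 3 * of_int t) * th 0 + (\<beta> * \<gamma> - 2 * of_int u) = 0"
    using sq cub by (Groebner_Basis.algebra)
  from irr[OF this] rat have "\<beta> * \<beta> - \<gamma> - 3 * of_int t = 0" "\<beta> * \<gamma> - 2 * of_int u = 0" by auto
  \<comment> \<open>If \<open>th 0\<close> is a root of X^2 + \<beta> X + \<gamma>, the third root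
    of the cubic is the rational number \<beta>, as the roots have sum 0.\<close>
  then have "\<beta> ^ 3 - 3 * of_int t * \<beta> - 2 * of_int u = 0" by (Groebner_Basis.algebra)
  then show False using rational_root_imp_int no rat by blast
qed

text \<open>The norm lies in \<open>OK\<close> and is real, because conjugates 1 and 2 are complex
  conjugate; so it is a rational integer.\<close>

lemma quad_norm:
  assumes no: "\<not> (\<exists>r :: int. r ^ 3 - 3 * t * r - 2 * u = 0)" and nz: "v \<noteq> (0, 0, 0)"
  obtains n :: int where "n \<noteq> 0" "nrm (quad v) = of_int n" "cmod (quad v 0) * cmod (quad v 1) ^ 2 = of_int \<bar>n\<bar>"
proof -
  obtain a b c where v: "v = (a, b, c)" by (cases v)
  have c12: "quad v 2 = cnj (quad v 1)" by (simp add: v quad_def th12_cnj)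
  have r0: "cnj (quad v 0) = quad v 0" using th0_real by (simp add: v quad_def complex_eq_iff)
  have N: "nrm (quad v) \<in> OK" by (rule inR_nrm_trc[OF quad_R])
  have cn: "cnj (nrm (quad v)) = nrm (quad v)" by (simp add: nrm_def c12 r0 mult_ac)
  obtain x y where xy: "nrm (quad v) = of_int x + of_int y * rt" using N by (auto simp: OK_explicit)
  have "y = 0" using cn rt_nonzero by (simp add: xy cnj_rt)
  then have n: "nrm (quad v) = of_int x" by (simp add: xy)
  have "quad v 0 \<noteq> 0" using quad_nonzero[OF no] nz v by metis
  moreover have "cmod (quad v 0) * cmod (quad v 1) ^ 2 = cmod (nrm (quad v))"
    by (simp add: nrm_def c12 norm_mult power2_eq_square)
  moreover have "quad v 1 \<noteq> 0"
  proof
    assume *: "quad v 1 = 0"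
    have "of_int b * (th 1 - th 2) + of_int c * ((th 1 + th 2) * (th 1 - th 2)) = 0"
    proof -
      have "quad v 1 - quad v 2 = 0" using * c12 by simp
      then show ?thesis by (simp add: v quad_def algebra_simps)
    qed
    moreover have "th 1 \<noteq> th 2" using th_distinct[of 1] by (simp add: numeral_2_eq_2)
    moreover have "th 1 + th 2 = - th 0" using th_e1[of 0] by (simp add: numeral_2_eq_2 add_eq_0_iff)
    ultimately have "(th 1 - th 2) * (of_int b - of_int c * th 0) = 0" by (Groebner_Basis.algebra)
    then have "quad (b, - c, 0) 0 = 0" using \<open>th 1 \<noteq> th 2\<close> by (simp add: quad_def)
    then have "b = 0" "c = 0" using quad_nonzero[OF no, of b "- c" 0] by auto
    then show False using * nz v by (simp add: quad_def)
  qed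
  ultimately have "nrm (quad v) \<noteq> 0" "cmod (quad v 0) * cmod (quad v 1) ^ 2 = of_int \<bar>x\<bar>"
    by (auto simp: n)
  then show ?thesis using n by (intro that[of x]) auto
qed

text \<open>Pigeonhole at the real place for coefficients in {0..Q}: two values closer than 2 M /
  Q^2 have a difference whose complex conjugates are O(Q), so its norm is bounded independently of
  Q.\<close>

lemma dirichlet:
  assumes no: "\<not> (\<exists>r :: int. r ^ 3 - 3 * t * r - 2 * u = 0)"
  obtains C :: real where "\<And>\<delta>. \<delta> > 0 \<Longrightarrow> \<exists>v. v \<noteq> (0, 0, 0) \<and> cmod (quad v 0) < \<delta> \<and> cmod (nrm (quad v)) \<le> C"
proof -
  define M where "M = 1 + cmod (th 0) + cmod (th 0) ^ 2"
  define M' where "M' = 1 + cmod (th 1) + cmod (th 1) ^ 2"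
  have M: "M \<ge> 1" "M' \<ge> 1" by (auto simp: M_def M'_def)
  have "\<exists>v. v \<noteq> (0, 0, 0) \<and> cmod (quad v 0) < \<delta> \<and> cmod (nrm (quad v)) \<le> 2 * M * M' ^ 2" if \<delta>: "\<delta> > 0" for \<delta>
  proof -
    obtain Q :: nat where Q: "of_nat Q > 2 * M / \<delta>" using reals_Archimedean2 by blast
    have "2 * M / \<delta> > 0" using M \<delta> by simp
    then have Q0: "Q > 0" using Q by (cases Q) auto
    define B where "B = {0..int Q} \<times> {0..int Q} \<times> {0..int Q}"
    \<comment> \<open>The scaling maps values of size at most M Q into [- Q^3 / 2, Q^3 / 2], so at
      most Q^3 + 2 cells face (Q + 1)^3 triples.\<close>
    define f where "f = (\<lambda>v. \<lfloor>Re (quad v 0) * of_nat Q ^ 2 / (2 * M)\<rfloor>)"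
    have bnd: "\<bar>Re (quad v 0)\<bar> \<le> M * of_nat Q" and bnd1: "cmod (quad v 1) \<le> M' * of_nat Q"
      if v: "v = (a, b, c)" "\<bar>a\<bar> \<le> int Q" "\<bar>b\<bar> \<le> int Q" "\<bar>c\<bar> \<le> int Q" for v a b c
    proof -
      have *: "cmod (quad v j) \<le> (1 + cmod (th j) + cmod (th j) ^ 2) * of_nat Q" for j
      proof -
        have q: "cmod (of_int a) \<le> of_nat Q" "cmod (of_int b) \<le> of_nat Q" "cmod (of_int c) \<le> of_nat Q"
          using v(2-4) by (auto simp: norm_of_int)
        have "cmod (quad v j) \<le> cmod (of_int a) + cmod (of_int b * th j) + cmod (of_int c * (th j * th j))"
          unfolding v quad_def by (simp add: norm_triangle_mono norm_triangle_le)
        also have "\<dots> \<le> of_nat Q + of_nat Q * cmod (th j) + of_nat Q * (cmod (th j)) ^ 2"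
          unfolding norm_mult power2_eq_square using q by (intro add_mono mult_right_mono) auto
        finally show ?thesis by (simp add: algebra_simps)
      qed
      show "\<bar>Re (quad v 0)\<bar> \<le> M * of_nat Q" using *[of 0] abs_Re_le_cmod[of "quad v 0"] by (simp add: M_def)
      show "cmod (quad v 1) \<le> M' * of_nat Q" using *[of 1] by (simp add: M'_def)
    qed
    define X where "X = real Q ^ 3 / 2"
    have fB: "f v \<in> {\<lfloor>- X\<rfloor> .. \<lfloor>X\<rfloor>}" if "v \<in> B" for v
    proof -
      obtain a b c where v: "v = (a, b, c)" by (cases v)
      have "\<bar>Re (quad v 0)\<bar> \<le> M * of_nat Q" using that by (intro bnd[OF v]) (auto simp: B_def v)
      then have "\<bar>Re (quad v 0)\<bar> * of_nat Q ^ 2 / (2 * M) \<le> M * of_nat Q * of_nat Q ^ 2 / (2 * M)"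
        using M by (intro divide_right_mono mult_right_mono) auto
      also have "\<dots> = X" using M by (simp add: X_def power2_eq_square power3_eq_cube)
      finally have "\<bar>Re (quad v 0) * of_nat Q ^ 2 / (2 * M)\<bar> \<le> X" using M by (simp add: abs_mult)
      then have "- X \<le> Re (quad v 0) * of_nat Q ^ 2 / (2 * M)" "Re (quad v 0) * of_nat Q ^ 2 / (2 * M) \<le> X"
        by linarith+
      then show ?thesis unfolding f_def atLeastAtMost_iff by (intro conjI floor_mono)
    qed
    have "\<not> inj_on f B"
    proof
      assume inj: "inj_on f B"
      have cB: "card B = (Q + 1) * ((Q + 1) * (Q + 1))"
        by (simp add: B_def card_cartesian_product nat_add_distrib)
      have "card B \<le> card {\<lfloor>- X\<rfloor> .. \<lfloor>X\<rfloor>}" using fB by (intro card_inj_on_le[OF inj]) auto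
      then have "int ((Q + 1) * ((Q + 1) * (Q + 1))) \<le> int (nat (\<lfloor>X\<rfloor> + 1 - \<lfloor>- X\<rfloor>))"
        unfolding cB by (simp only: of_nat_le_iff card_atLeastAtMost_int)
      also have "\<dots> = \<lfloor>X\<rfloor> + 1 - \<lfloor>- X\<rfloor>"
      proof -
        have "\<lfloor>- X\<rfloor> \<le> \<lfloor>X\<rfloor>" by (intro floor_mono) (simp add: X_def)
        then show ?thesis by simp
      qed
      finally have "real ((Q + 1) * ((Q + 1) * (Q + 1))) \<le> of_int (\<lfloor>X\<rfloor> + 1 - \<lfloor>- X\<rfloor>)"
        by (metis of_int_le_iff of_int_of_nat_eq)
      also have "\<dots> \<le> 2 * X + 2" by linarith
      also have "\<dots> = real (Q ^ 3 + 2)" by (simp add: X_def)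
      finally have "(Q + 1) * ((Q + 1) * (Q + 1)) \<le> Q ^ 3 + 2" by (simp only: of_nat_le_iff)
      then show False using Q0 by (simp add: power3_eq_cube algebra_simps)
    qed
    then obtain v v' where vv: "v \<in> B" "v' \<in> B" "v \<noteq> v'" "f v = f v'" unfolding inj_on_def by blast
    obtain a b c a' b' c' where v: "v = (a, b, c)" "v' = (a', b', c')" by (cases v; cases v')
    define d where "d = (a - a', b - b', c - c')"
    have d: "quad d j = quad v j - quad v' j" for j by (simp add: d_def v quad_diff)
    have d0: "d \<noteq> (0, 0, 0)" using vv(3) by (auto simp: d_def v)
    have c1: "cmod (quad d 1) \<le> M' * of_nat Q"
      by (rule bnd1[OF d_def]) (use vv in \<open>auto simp: B_def v\<close>)
    have "\<bar>Re (quad v 0) * of_nat Q ^ 2 / (2 * M) - Re (quad v' 0) * of_nat Q ^ 2 / (2 * M)\<bar> < 1"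
      using vv(4) unfolding f_def by linarith
    also have "Re (quad v 0) * of_nat Q ^ 2 / (2 * M) - Re (quad v' 0) * of_nat Q ^ 2 / (2 * M)
      = Re (quad d 0) * (of_nat Q ^ 2 / (2 * M))"
      by (simp add: d algebra_simps diff_divide_distrib)
    finally have "\<bar>Re (quad d 0)\<bar> * (of_nat Q ^ 2 / (2 * M)) < 1" using M by (simp add: abs_mult)
    then have re: "\<bar>Re (quad d 0)\<bar> < 2 * M / of_nat Q ^ 2" using M Q0 by (simp add: field_simps)
    have "Im (quad d 0) = 0" using th0_real by (simp add: d_def quad_def)
    then have cm: "cmod (quad d 0) = \<bar>Re (quad d 0)\<bar>" by (simp add: cmod_eq_Re)
    obtain n where n: "nrm (quad d) = of_int n" "cmod (quad d 0) * cmod (quad d 1) ^ 2 = of_int \<bar>n\<bar>"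
      using quad_norm[OF no d0] by metis
    have "cmod (nrm (quad d)) = cmod (quad d 0) * cmod (quad d 1) ^ 2" unfolding n by simp
    also have "\<dots> \<le> 2 * M / of_nat Q ^ 2 * (M' * of_nat Q) ^ 2"
      using re cm c1 M by (intro mult_mono power_mono) auto
    also have "\<dots> = 2 * M * M' ^ 2" using Q0 by (simp add: power_mult_distrib)
    finally have 1: "cmod (nrm (quad d)) \<le> 2 * M * M' ^ 2" .
    have "2 * M / of_nat Q ^ 2 \<le> 2 * M / of_nat Q"
      using M Q0 by (intro divide_left_mono) (auto simp: power2_eq_square)
    also have "\<dots> < \<delta>" using Q \<delta> Q0 by (simp add: field_simps)
    finally have "cmod (quad d 0) < \<delta>" using re cm by simp
    then show ?thesis using 1 d0 by blast
  qed
  then show ?thesis using that by blast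
qed

text \<open>Otherwise infinitely many elements of Z[\<open>th\<close>] have bounded norm and
  distinct absolute values at the real place. Two of them share the norm n and the coordinates
  modulo n; their quotient is a unit of norm 1 that contradicts
  \<open>norm_one_abs_1\<close>.\<close>

theorem cubic_has_integer_root: "\<exists>r :: int. r ^ 3 - 3 * t * r - 2 * u = 0"
proof (rule ccontr)
  assume no: "\<not> (\<exists>r :: int. r ^ 3 - 3 * t * r - 2 * u = 0)"
  obtain C where C: "\<And>\<delta>. \<delta> > 0 \<Longrightarrow> \<exists>v. v \<noteq> (0, 0, 0) \<and> cmod (quad v 0) < \<delta> \<and> cmod (nrm (quad v)) \<le> C"
    using dirichlet[OF no] by metis
  define S where "S = {v. v \<noteq> (0, 0, 0) \<and> cmod (nrm (quad v)) \<le> C}"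
  define X where "X = (\<lambda>v. cmod (quad v 0)) ` S"
  have pos: "x > 0" if "x \<in> X" for x
  proof -
    from that obtain v where "x = cmod (quad v 0)" "v \<noteq> (0, 0, 0)" unfolding X_def S_def by blast
    then show ?thesis using quad_nonzero[OF no] by (cases v) auto
  qed
  have infX: "infinite X"
  proof
    assume fin: "finite X"
    have "X \<noteq> {}" using C[of 1] by (auto simp: X_def S_def)
    then have "Min X > 0" using fin pos by auto
    then obtain v where v: "v \<noteq> (0, 0, 0)" "cmod (quad v 0) < Min X" "cmod (nrm (quad v)) \<le> C" using C by blast
    then have "cmod (quad v 0) \<in> X" by (auto simp: X_def S_def)
    then show False using v(2) fin by (metis Min_le not_le)
  qed
  define pick where "pick = (\<lambda>x. SOME v. v \<in> S \<and> cmod (quad v 0) = x)"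
  have pick: "pick x \<in> S" "cmod (quad (pick x) 0) = x" if "x \<in> X" for x
  proof -
    have "\<exists>v. v \<in> S \<and> cmod (quad v 0) = x" using that by (auto simp: X_def)
    from someI_ex[OF this] show "pick x \<in> S" "cmod (quad (pick x) 0) = x" by (auto simp: pick_def)
  qed
  define N where "N = (\<lambda>v. \<lfloor>Re (nrm (quad v))\<rfloor>)"
  have N: "nrm (quad v) = of_int (N v)" "N v \<noteq> 0" "\<bar>N v\<bar> \<le> \<lceil>C\<rceil>" if v: "v \<in> S" for v
  proof -
    obtain n where n: "n \<noteq> 0" "nrm (quad v) = of_int n" using quad_norm[OF no, of v] v by (auto simp: S_def)
    then have "N v = n" by (simp add: N_def)
    moreover have "real_of_int \<bar>n\<bar> \<le> C" using v n by (simp add: S_def)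
    then have "\<bar>n\<bar> \<le> \<lceil>C\<rceil>" by linarith
    ultimately show "nrm (quad v) = of_int (N v)" "N v \<noteq> 0" "\<bar>N v\<bar> \<le> \<lceil>C\<rceil>" using n by auto
  qed
  define key where "key = (\<lambda>v. case v of (a, b, c) \<Rightarrow> (N v, a mod N v, b mod N v, c mod N v))"
  define J where "J = {- \<lceil>C\<rceil>..\<lceil>C\<rceil>}"
  have "(key \<circ> pick) ` X \<subseteq> J \<times> J \<times> J \<times> J"
  proof
    fix y assume "y \<in> (key \<circ> pick) ` X"
    then obtain x where x: "x \<in> X" "y = key (pick x)" by auto
    obtain a b c where v: "pick x = (a, b, c)" by (cases "pick x")
    have m: "\<bar>a mod N (pick x)\<bar> \<le> \<bar>N (pick x)\<bar>" for a
      using abs_mod_less[OF N(2)[OF pick(1)[OF x(1)]], of a] by simp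
    show "y \<in> J \<times> J \<times> J \<times> J"
      using N(3)[OF pick(1)[OF x(1)]] m[of a] m[of b] m[of c] unfolding x(2) key_def v J_def by (auto simp: abs_le_iff)
  qed
  then have "finite ((key \<circ> pick) ` X)" by (rule finite_subset) (auto simp: J_def)
  from pigeonhole_infinite[OF infX this] obtain x0 where x0: "x0 \<in> X" "infinite {x \<in> X. (key \<circ> pick) x = (key \<circ> pick) x0}" by blast
  have "\<not> {x \<in> X. (key \<circ> pick) x = (key \<circ> pick) x0} \<subseteq> {x0}" using x0(2) finite_subset by blast
  then obtain x1 where x1: "x1 \<in> X" "key (pick x1) = key (pick x0)" "x1 \<noteq> x0" by auto
  obtain a b c where v: "pick x0 = (a, b, c)" by (cases "pick x0")
  obtain a' b' c' where v': "pick x1 = (a', b', c')" by (cases "pick x1")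
  define n where "n = N (pick x0)"
  have n: "n = N (pick x1)" "a' mod n = a mod n" "b' mod n = b mod n" "c' mod n = c mod n"
    using x1(2) unfolding key_def v v' n_def by auto
  have "n dvd a' - a" "n dvd b' - b" "n dvd c' - c" using n by (metis mod_eq_dvd_iff)+
  then obtain k l m where klm: "a' - a = n * k" "b' - b = n * l" "c' - c = n * m" by (auto elim!: dvdE)
  define \<alpha> \<beta> where "\<alpha> = quad (pick x1)" and "\<beta> = quad (pick x0)"
  have nb: "nrm \<beta> = of_int n" and na: "nrm \<alpha> = of_int n" "n \<noteq> 0"
    using N[OF pick(1)[OF x0(1)]] N(1)[OF pick(1)[OF x1(1)]] by (auto simp: \<alpha>_def \<beta>_def n_def n(1)[unfolded n_def])
  have diff: "\<alpha> j - \<beta> j = of_int n * quad (k, l, m) j" for j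
    unfolding \<alpha>_def \<beta>_def v v' quad_diff klm by (simp add: quad_def algebra_simps)
  have bR: "inR \<beta>" by (simp add: \<beta>_def quad_R)
  have bn: "\<beta> j * (\<beta> (j + 1) * \<beta> (j + 2)) = of_int n" for j
    using nrm_trc(1)[OF inR_N[OF bR], of j] nb by (simp add: mult.assoc)
  \<comment> \<open>This is \<alpha> / \<beta> = 1 + (\<alpha> - \<beta>) / \<beta>: since n divides
    \<alpha> - \<beta> and n / \<beta> is the product of the other two conjugates, no division
    remains.\<close>
  define \<eta> where "\<eta> = (\<lambda>j. 1 + quad (k, l, m) j * (\<beta> (j + 1) * \<beta> (j + 2)))"
  have R: "inR \<eta>" unfolding \<eta>_def
    by (intro inR_add inR_mult[OF quad_R] inR_mult[OF inR_shifts[OF bR] inR_shifts[OF bR]] inR_const OK_1)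
  have eb: "\<eta> j * \<beta> j = \<alpha> j" for j
  proof -
    have "\<eta> j * \<beta> j = \<beta> j + quad (k, l, m) j * (\<beta> j * (\<beta> (j + 1) * \<beta> (j + 2)))"
      unfolding \<eta>_def by (simp only: distrib_left distrib_right mult_1_left mult_1_right mult_ac)
    also have "\<dots> = \<beta> j + (\<alpha> j - \<beta> j)" unfolding bn diff by (simp only: mult.commute)
    finally show ?thesis by simp
  qed
  have "nrm \<eta> * nrm \<beta> = nrm \<alpha>" by (simp add: nrm_def eb[symmetric] mult_ac)
  then have "nrm \<eta> = 1" using na nb by simp
  then have "cmod (\<eta> 0) = 1" by (rule norm_one_abs_1[OF R])
  then have "cmod (\<beta> 0) = cmod (\<alpha> 0)" using eb[of 0] by (metis mult_1 norm_mult)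
  then have "x0 = x1" using pick(2)[OF x0(1)] pick(2)[OF x1(1)] by (simp add: \<alpha>_def \<beta>_def)
  then show False using x1(3) by simp
qed

end

section \<open>Descent\<close>

lemma int_coprime_primeI:
  fixes a b :: int
  assumes "\<And>p. prime p \<Longrightarrow> p dvd a \<Longrightarrow> p dvd b \<Longrightarrow> False" "a \<noteq> 0 \<or> b \<noteq> 0"
  shows "coprime a b"
proof (rule ccontr)
  assume "\<not> coprime a b"
  then have "\<not> is_unit (gcd a b)" by (simp add: coprime_iff_gcd_eq_1)
  moreover have "gcd a b \<noteq> 0" using assms(2) by auto
  ultimately obtain p where "p dvd gcd a b" "prime p" using prime_divisor_exists by blast
  then show False using assms(1)[of p] by auto
qed

lemma coprime_cube_factors:
  fixes x y z :: int
  assumes "coprime x y" "x * y = z ^ 3"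
  obtains s t where "x = s ^ 3" "y = t ^ 3"
proof -
  have "nat \<bar>x\<bar> * nat \<bar>y\<bar> = nat \<bar>z\<bar> ^ 3"
    using assms(2) by (metis abs_mult nat_abs_mult_distrib nat_power_eq power_abs abs_ge_zero)
  moreover have "coprime (nat \<bar>x\<bar>) (nat \<bar>y\<bar>)" using assms(1) by (simp add: coprime_int_iff[symmetric])
  ultimately have "is_nth_power 3 (nat \<bar>x\<bar>)" "is_nth_power 3 (nat \<bar>y\<bar>)"
    by (metis is_nth_power_mult_coprime_nat_iff is_nth_power_nth_power)+
  then obtain s t where st: "nat \<bar>x\<bar> = s ^ 3" "nat \<bar>y\<bar> = t ^ 3" by (auto simp: is_nth_power_def)
  have *: "\<exists>r. w = r ^ 3" if "nat \<bar>w\<bar> = k ^ 3" for w k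
  proof -
    have "\<bar>w\<bar> = int k ^ 3" using that by (metis abs_ge_zero int_nat_eq of_nat_power)
    then have "w = int k ^ 3 \<or> w = (- int k) ^ 3" by (auto simp: abs_if split: if_splits)
    then show ?thesis by blast
  qed
  show ?thesis using *[OF st(1)] *[OF st(2)] that by blast
qed

lemma int_sq_mod4: "even x \<Longrightarrow> x ^ 2 mod 4 = (0 :: int)" "odd x \<Longrightarrow> x ^ 2 mod 4 = (1 :: int)"
proof -
  show "even x \<Longrightarrow> x ^ 2 mod 4 = 0" by (auto elim!: evenE simp: power2_eq_square)
  assume "odd x"
  then obtain j where "x = 2 * j + 1" by (elim oddE)
  then have "x ^ 2 = 4 * (j ^ 2 + j) + 1" by (simp add: power2_eq_square algebra_simps)
  then show "x ^ 2 mod 4 = 1" by presburger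
qed

locale trivial_3_torsion = imag_quadratic +
  assumes tors: "torsion_dim 3 (class_group K) = 0" and A_mod3: "A mod 3 = 1"
begin

lemma A_odd: "odd A" using A_mod4 by presburger
lemma A_not3: "\<not> 3 dvd A" using A_mod3 by presburger

text \<open>Reflection in the style of Hilbert 94 and Scholz: if the element u + 3 w sqrt (3 A), of norm t^3, were
  not a cube, its cube roots would generate an unramified cyclic cubic extension of K.\<close>
lemma mirror_cube:
  assumes eq: "u ^ 2 = t ^ 3 + 27 * A * w ^ 2" and cop: "coprime (3 * t) (2 * u)" and w0: "w \<noteq> 0"
  obtains m n where "u = m * (m ^ 2 + 9 * A * n ^ 2)" "w = n * (m ^ 2 + A * n ^ 2)" "t = m ^ 2 - 3 * A * n ^ 2"
proof -
  interpret C: cubic_unramified A t u w by unfold_locales (fact eq cop w0 tors)+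
  obtain r where r: "r ^ 3 - 3 * t * r - 2 * u = 0" using C.cubic_has_integer_root by blast
  \<comment> \<open>The quadratic cofactor of the cubic at the root r has discriminant - 3 X and
    takes the value 3 Y at r, so the discriminant of the cubic is - 27 X Y^2.\<close>
  define X Y where "X = r ^ 2 - 4 * t" and "Y = r ^ 2 - t"
  have XY: "Y ^ 2 * X = (3 * A) * (6 * w) ^ 2"
    using r eq unfolding X_def Y_def by (Groebner_Basis.algebra)
  have Y0: "Y \<noteq> 0" using XY w0 A_pos by auto
  have B: "squarefree (3 * A)"
  proof -
    have "coprime 3 A" using A_not3 by (simp add: prime_imp_coprime)
    then show ?thesis using A_sqf by (simp add: squarefree_mult_coprime squarefree_prime)
  qed
  have "(of_int (3 * A) :: rat) * (of_int (6 * w) / of_int Y) ^ 2 = of_int X"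
  proof -
    have "(of_int (Y ^ 2 * X) :: rat) = of_int ((3 * A) * (6 * w) ^ 2)" by (simp only: XY)
    then show ?thesis using Y0 by (simp add: power_divide field_simps)
  qed
  then have "(of_int (6 * w) / of_int Y :: rat) \<in> \<int>"
    using rat_square_int_imp_int[OF B] A_pos by (metis Ints_of_int less_irrefl mult_eq_0_iff zero_neq_numeral)
  then obtain q where "(of_int (6 * w) / of_int Y :: rat) = of_int q" by (auto elim: Ints_cases)
  then have "(of_int (6 * w) :: rat) = of_int (q * Y)" using Y0 by (simp add: field_simps)
  then have q: "6 * w = q * Y" by (simp only: of_int_eq_iff)
  have "Y ^ 2 * X = Y ^ 2 * (3 * A * q ^ 2)" unfolding XY q by (simp add: power2_eq_square)
  then have X: "X = 3 * A * q ^ 2" using Y0 by simp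
  \<comment> \<open>Otherwise X = 1 mod 4, whereas 3 A q^2 is 0 or 3 mod 4. The halves m and n of r
    and q become the coordinates of the cube root m + n sqrt(3 A).\<close>
  have "even r"
  proof (rule ccontr)
    assume "odd r"
    then have 1: "X mod 4 = 1" using int_sq_mod4(2)[of r] unfolding X_def by presburger
    have "A = 4 * (A div 4) + 1" using A_mod4 by presburger
    then have "3 * A * q ^ 2 = 4 * (3 * (A div 4) * q ^ 2) + 3 * q ^ 2" by (Groebner_Basis.algebra)
    moreover have "q ^ 2 mod 4 = 0 \<or> q ^ 2 mod 4 = 1" using int_sq_mod4[of q] by blast
    ultimately show False using 1 X by presburger
  qed
  then obtain m where m: "r = 2 * m" by (elim evenE)
  have "even q"
  proof (rule ccontr)
    assume "odd q"
    then have "odd X" using X A_odd by simp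
    then show False unfolding X_def m by simp
  qed
  then obtain n where n: "q = 2 * n" by (elim evenE)
  have t: "t = m ^ 2 - 3 * A * n ^ 2" using X unfolding X_def m n by (simp add: power_mult_distrib)
  have u: "u = m * (m ^ 2 + 9 * A * n ^ 2)"
    using r t unfolding m by (simp add: power3_eq_cube power2_eq_square algebra_simps)
  have "27 * A * w ^ 2 = 27 * A * (n * (m ^ 2 + A * n ^ 2)) ^ 2"
    using eq t u by (Groebner_Basis.algebra)
  then have "w ^ 2 = (n * (m ^ 2 + A * n ^ 2)) ^ 2" using A_pos by simp
  then have "w = n * (m ^ 2 + A * n ^ 2) \<or> w = - (n * (m ^ 2 + A * n ^ 2))" by (simp only: power2_eq_iff)
  then show ?thesis
  proof
    assume "w = n * (m ^ 2 + A * n ^ 2)"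
    then show ?thesis using that[of m n] t u by simp
  next
    assume "w = - (n * (m ^ 2 + A * n ^ 2))"
    then show ?thesis using that[of m "- n"] t u by simp
  qed
qed

text \<open>The ideal (\<alpha>, a) has cube (\<alpha>), because \<alpha> \<alpha>' = a^3 with
  \<alpha> and \<alpha>' comaximal. It is therefore principal, and the remaining unit is a
  cube.\<close>

lemma quadratic_cube:
  assumes eq: "b ^ 2 + A * e ^ 2 = a ^ 3" and cop: "coprime (2 * b) a"
  obtains u v where "b = u ^ 3 - 3 * A * u * v ^ 2" "e = v * (3 * u ^ 2 - A * v ^ 2)"
proof -
  define \<alpha> where "\<alpha> = of_int b + of_int e * rt"
  define \<alpha>' where "\<alpha>' = of_int b - of_int e * rt"
  have OK: "\<alpha> \<in> OK" "\<alpha>' \<in> OK" unfolding \<alpha>_def \<alpha>'_def by (auto intro!: OK_add OK_diff OK_mult)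
  have aa: "\<alpha> * \<alpha>' = of_int (a ^ 3)"
  proof -
    have "\<alpha> * \<alpha>' = of_int b ^ 2 - of_int e ^ 2 * (rt * rt)" by (simp add: \<alpha>_def \<alpha>'_def power2_eq_square algebra_simps)
    also have "\<dots> = of_int (b ^ 2 + A * e ^ 2)" unfolding rt_sq by simp
    finally show ?thesis by (simp only: eq)
  qed
  have a0: "a \<noteq> 0"
  proof
    assume "a = 0"
    then have "is_unit (2 * b)" using cop by simp
    then show False by (metis dvd_mult_left dvd_triv_left odd_one)
  qed
  then have \<alpha>0: "\<alpha> \<noteq> 0" using aa by auto
  define I where "I = {x * \<alpha> + y * of_int a | x y. x \<in> OK \<and> y \<in> OK}"
  have memI: "x * \<alpha> + y * of_int a \<in> I" if "x \<in> OK" "y \<in> OK" for x y using that by (auto simp: I_def)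
  have IOK: "x \<in> OK" if "x \<in> I" for x using that OK by (auto simp: I_def intro!: OK_add OK_mult)
  have \<alpha>I: "\<alpha> \<in> I" using memI[of 1 0] by simp
  have aI: "of_int a \<in> I" using memI[of 0 1] by simp
  have I: "fi I"
  proof (rule fi_I[where d = 1])
    show "I \<subseteq> K" using IOK OK_K by auto
    show "0 \<in> I" using memI[of 0 0] by simp
    show "\<exists>x\<in>I. x \<noteq> 0" using \<alpha>I \<alpha>0 by blast
    show "x + y \<in> I" if xy: "x \<in> I" "y \<in> I" for x y
    proof -
      obtain p q r s where "x = p * \<alpha> + q * of_int a" "y = r * \<alpha> + s * of_int a" "p \<in> OK" "q \<in> OK" "r \<in> OK" "s \<in> OK"
        using xy by (auto simp: I_def)
      then show ?thesis using memI[of "p + r" "q + s"] by (auto simp: algebra_simps)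
    qed
    show "r * x \<in> I" if "r \<in> OK" "x \<in> I" for r x
    proof -
      from that(2) obtain p q where "x = p * \<alpha> + q * of_int a" "p \<in> OK" "q \<in> OK" by (auto simp: I_def)
      then show ?thesis using memI[of "r * p" "r * q"] that(1) by (auto simp: algebra_simps)
    qed
  qed (auto simp: IOK)
  have cube: "x * y * z / \<alpha> \<in> OK" if xyz: "x \<in> I" "y \<in> I" "z \<in> I" for x y z
  proof -
    obtain x1 x2 y1 y2 z1 z2 where g: "x = x1 * \<alpha> + x2 * of_int a" "y = y1 * \<alpha> + y2 * of_int a" "z = z1 * \<alpha> + z2 * of_int a"
      "x1 \<in> OK" "x2 \<in> OK" "y1 \<in> OK" "y2 \<in> OK" "z1 \<in> OK" "z2 \<in> OK"
      using xyz by (auto simp: I_def)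
    define c where "c = x1 * y1 * z1 * \<alpha> * \<alpha> + (x1 * y1 * z2 + x1 * y2 * z1 + x2 * y1 * z1) * \<alpha> * of_int a
      + (x1 * y2 * z2 + x2 * y1 * z2 + x2 * y2 * z1) * of_int a * of_int a + x2 * y2 * z2 * \<alpha>'"
    have "c \<in> OK" unfolding c_def using g OK by (intro OK_add OK_mult) auto
    moreover have "x * y * z = \<alpha> * c"
    proof -
      have "x * y * z = \<alpha> * (c - x2 * y2 * z2 * \<alpha>') + x2 * y2 * z2 * of_int (a ^ 3)"
        by (simp add: g c_def power3_eq_cube algebra_simps)
      also have "\<dots> = \<alpha> * c" unfolding aa[symmetric] by (simp add: algebra_simps)
      finally show ?thesis .
    qed
    ultimately show ?thesis using \<alpha>0 by simp
  qed
  have inv_cube: "x * y * z * \<alpha> \<in> OK" if xyz: "x \<in> fi_inv I" "y \<in> fi_inv I" "z \<in> fi_inv I" for x y z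
  proof -
    have "coprime (2 * b) (a ^ 3)" using cop by simp
    then obtain p q where pq: "p * (2 * b) + q * a ^ 3 = 1" by (metis coprime_iff_gcd_eq_1 bezout_int)
    \<comment> \<open>\<alpha> + \<alpha>' = 2 b and \<alpha> \<alpha>' = a^3 are coprime integers;
      their Bezout relation becomes r \<alpha> + s \<alpha>' = 1.\<close>
    define r s where "r = of_int p + of_int q * \<alpha>'" and "s = complex_of_int p"
    have rs: "r \<in> OK" "s \<in> OK" unfolding r_def s_def by (intro OK_add OK_mult OK OK_of_int)+
    have "r * \<alpha> + s * \<alpha>' = of_int p * (\<alpha> + \<alpha>') + of_int q * (\<alpha> * \<alpha>')" by (simp add: r_def s_def algebra_simps)
    also have "\<dots> = of_int (p * (2 * b) + q * a ^ 3)" unfolding aa by (simp add: \<alpha>_def \<alpha>'_def)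
    finally have one: "r * \<alpha> + s * \<alpha>' = 1" by (simp only: pq of_int_1)
    define k where "k = 2 * r * s * \<alpha> + s * s * \<alpha>'"
    have k: "k \<in> OK" using rs OK OK_of_int[of 2] unfolding k_def by (intro OK_add OK_mult) auto
    \<comment> \<open>Squaring the relation exhibits \<alpha> as a combination of \<alpha>^3 and
      a^3, both in the cube of \<open>I\<close>.\<close>
    have "\<alpha> = \<alpha> * (r * \<alpha> + s * \<alpha>') ^ 2" by (simp only: one) simp
    also have "\<dots> = r * r * (\<alpha> * \<alpha> * \<alpha>) + k * (\<alpha> * \<alpha>')" by (simp add: k_def power2_eq_square algebra_simps)
    also have "\<dots> = r * r * (\<alpha> * \<alpha> * \<alpha>) + k * (of_int a * of_int a * of_int a)" unfolding aa by (simp add: power3_eq_cube)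
    finally have "x * y * z * \<alpha> = x * y * z * (r * r * (\<alpha> * \<alpha> * \<alpha>) + k * (of_int a * of_int a * of_int a))" by simp
    also have "\<dots> = r * r * ((x * \<alpha>) * (y * \<alpha>) * (z * \<alpha>)) + k * ((x * of_int a) * (y * of_int a) * (z * of_int a))"
      by (simp add: algebra_simps)
    also have "\<dots> \<in> OK"
    proof -
      have "x * \<alpha> \<in> OK" "y * \<alpha> \<in> OK" "z * \<alpha> \<in> OK" "x * of_int a \<in> OK" "y * of_int a \<in> OK" "z * of_int a \<in> OK"
        using xyz \<alpha>I aI by (auto simp: fi_inv_def)
      then show ?thesis using rs k by (intro OK_add OK_mult[OF OK_mult[OF rs(1) rs(1)]] OK_mult[OF k] OK_mult[OF OK_mult])
    qed
    finally show ?thesis .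
  qed
  obtain \<beta> where \<beta>: "\<beta> \<in> K" "\<beta> \<noteq> 0" "I = pr \<beta>"
    using principal_criterion[OF tors I OK_K[OF OK(1)] \<alpha>0 cube inv_cube] by blast
  have \<beta>I: "\<beta> \<in> I" unfolding \<beta>(3) by (auto simp: pr_def intro!: image_eqI[of _ _ 1])
  have \<beta>i: "inverse \<beta> \<in> fi_inv I" using \<beta> unfolding \<beta>(3) by (auto simp: fi_inv_def pr_def mult.assoc[symmetric])
  define z where "z = \<alpha> / \<beta> ^ 3"
  have z1: "z \<in> OK" using inv_cube[OF \<beta>i \<beta>i \<beta>i] by (simp add: z_def divide_inverse power3_eq_cube mult_ac)
  have z2: "inverse z \<in> OK" using cube[OF \<beta>I \<beta>I \<beta>I] by (simp add: z_def power3_eq_cube)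
  have "z \<noteq> 0" using \<alpha>0 \<beta> by (simp add: z_def)
  from OK_unit_power4[OF z1 z2 this] have z4: "z ^ 4 = 1" .
  \<comment> \<open>\<alpha> = z \<beta>^3 with z^4 = 1, so the unit z = (z^3)^3 is absorbed into
    the cube.\<close>
  define \<gamma> where "\<gamma> = z ^ 3 * \<beta>"
  have "\<gamma> \<in> OK" unfolding \<gamma>_def using z1 IOK[OF \<beta>I] by (intro OK_mult OK_power)
  then obtain u v where \<gamma>: "\<gamma> = of_int u + of_int v * rt" by (auto simp: OK_explicit)
  have "\<gamma> ^ 3 = (z ^ 4) ^ 2 * z * \<beta> ^ 3" by (simp add: \<gamma>_def power_mult_distrib flip: power_mult power_Suc2)
  then have "\<gamma> ^ 3 = \<alpha>" unfolding z4 using \<beta> by (simp add: z_def)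
  moreover have "\<gamma> ^ 3 = of_int (u ^ 3 - 3 * A * u * v ^ 2) + of_int (v * (3 * u ^ 2 - A * v ^ 2)) * rt"
  proof -
    have "\<gamma> ^ 3 = of_int u ^ 3 + 3 * of_int u * of_int v ^ 2 * (rt * rt) + (3 * of_int u ^ 2 * of_int v + of_int v ^ 3 * (rt * rt)) * rt"
      by (simp add: \<gamma> power3_eq_cube power2_eq_square algebra_simps)
    then show ?thesis unfolding rt_sq by (simp add: power3_eq_cube power2_eq_square algebra_simps)
  qed
  ultimately have "of_int b + of_int e * rt = of_int (u ^ 3 - 3 * A * u * v ^ 2) + of_int (v * (3 * u ^ 2 - A * v ^ 2)) * rt"
    by (simp only: \<alpha>_def)
  then show ?thesis using that[of u v] by (simp only: OK_eq_iff)
qed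

end

lemma int_cube_cancel: "x ^ 3 = y ^ 3 \<Longrightarrow> x = y" for x y :: int
proof -
  assume "x ^ 3 = y ^ 3"
  then have "real_of_int x ^ 3 = real_of_int y ^ 3" by (simp only: of_int_power[symmetric])
  then have "root 3 (real_of_int x ^ 3) = root 3 (real_of_int y ^ 3)" by simp
  then show "x = y" by (simp add: odd_real_root_power_cancel)
qed

text \<open>Modulo 9 the right-hand side 3 U - W is 2 or 5, which are not residues of cubes.\<close>

lemma mod9_contradiction:
  fixes C U W :: int
  assumes "C = 3 * U - W" "W mod 9 = 7" "C mod 9 = 0 \<or> C mod 9 = 1 \<or> C mod 9 = 8" "U mod 3 = 0 \<or> U mod 3 = 1"
  shows False
proof -
  have "C = 3 * (U mod 3) - 7 + 9 * (U div 3 - W div 9)"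
    using assms(1,2) div_mult_mod_eq[of U 3] div_mult_mod_eq[of W 9] by (Groebner_Basis.algebra)
  then have "C mod 9 = (3 * (U mod 3) - 7) mod 9" by (simp only: mod_mult_self2)
  then show False using assms(3,4) by auto
qed

lemma prime_dvd_3: "prime p \<Longrightarrow> p dvd 3 \<Longrightarrow> p = 3" for p :: int
  using primes_dvd_imp_eq[of p 3] by simp

lemma dvd_cube: "p dvd x \<Longrightarrow> p dvd x ^ 3" for p x :: int
  by (rule dvd_trans[OF _ dvd_power]) auto

section \<open>Descent for good twists\<close>

context trivial_3_torsion
begin

text \<open>These primes split in the field of cube roots of unity and are inert in K, hence also inert in
  the mirror field of 3 A.\<close>
definition twist_prime :: "int \<Rightarrow> bool" where
  "twist_prime p \<longleftrightarrow> prime p \<and> p \<noteq> 2 \<and> p \<noteq> 3 \<and> (\<exists>s. p dvd s ^ 2 + 3) \<and> (\<forall>x. \<not> p dvd x ^ 2 + A)"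

lemma twist_prime_inert:
  assumes p: "twist_prime p" and d: "p dvd x ^ 2 + A * y ^ 2"
  shows "p dvd x \<and> p dvd y"
proof (cases "p dvd y")
  case True
  then have "p dvd A * y ^ 2" by (simp add: power2_eq_square)
  then have "p dvd x ^ 2" using d by (simp add: dvd_add_left_iff)
  then show ?thesis using True p by (auto simp: twist_prime_def prime_dvd_power_iff)
next
  case False
  then have "coprime y p" using p by (metis twist_prime_def coprime_commute prime_imp_coprime)
  then obtain z where "[y * z = 1] (mod p)" using cong_solve_coprime_int by blast
  then have z: "p dvd y * z - 1" by (simp add: cong_iff_dvd_diff)
  have "p dvd (x ^ 2 + A * y ^ 2) * z ^ 2 - A * ((y * z - 1) * (y * z + 1))" using d z by auto
  also have "(x ^ 2 + A * y ^ 2) * z ^ 2 - A * ((y * z - 1) * (y * z + 1)) = (x * z) ^ 2 + A"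
    by (simp add: power2_eq_square algebra_simps)
  finally show ?thesis using p by (auto simp: twist_prime_def)
qed

text \<open>As - 3 = s^2 modulo p, both forms turn, up to sign, into the form of
  \<open>twist_prime_inert\<close>.\<close>

lemma twist_prime_inert_mirror:
  assumes p: "twist_prime p"
  shows "p dvd 3 * x ^ 2 - A * y ^ 2 \<Longrightarrow> p dvd x \<and> p dvd y"
    and "p dvd x ^ 2 - 27 * A * y ^ 2 \<Longrightarrow> p dvd x \<and> p dvd y"
proof -
  obtain s where s: "p dvd s ^ 2 + 3" using p by (auto simp: twist_prime_def)
  have pp: "prime p" using p by (simp add: twist_prime_def)
  have n3: "\<not> p dvd 3"
    using prime_dvd_3[OF pp] p by (auto simp: twist_prime_def)
  have ns: "\<not> p dvd s"
  proof
    assume "p dvd s"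
    then have "p dvd s ^ 2" by (simp add: power2_eq_square)
    then show False using s n3 by (simp add: dvd_add_right_iff)
  qed
  show "p dvd x \<and> p dvd y" if d: "p dvd 3 * x ^ 2 - A * y ^ 2"
  proof -
    have "p dvd (s ^ 2 + 3) * x ^ 2 - (3 * x ^ 2 - A * y ^ 2)" using d s by auto
    also have "\<dots> = (s * x) ^ 2 + A * y ^ 2" by (simp add: power2_eq_square algebra_simps)
    finally have "p dvd s * x \<and> p dvd y" by (rule twist_prime_inert[OF p])
    then show ?thesis using ns pp by (auto simp: prime_dvd_mult_iff)
  qed
  show "p dvd x \<and> p dvd y" if d: "p dvd x ^ 2 - 27 * A * y ^ 2"
  proof -
    have "p dvd (s ^ 2 + 3) * (9 * A * y ^ 2) + (x ^ 2 - 27 * A * y ^ 2)" using d s by auto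
    also have "\<dots> = x ^ 2 + A * (3 * (s * y)) ^ 2" by (simp add: power2_eq_square algebra_simps)
    finally have "p dvd x \<and> p dvd 3 * (s * y)" by (rule twist_prime_inert[OF p])
    then show ?thesis using ns n3 pp by (auto simp: prime_dvd_mult_iff)
  qed
qed

text \<open>The alternative D = 4 D0 serves A = 1 mod 9, since 16 = 7 mod 9; the exact valuation 2
  at the prime 2 is one that the descent can handle.\<close>

definition good_twist :: "int \<Rightarrow> bool" where
  "good_twist D \<longleftrightarrow> D > 0 \<and> cubefree D \<and> A * D ^ 2 mod 9 = 7 \<and> (odd D \<or> (\<exists>D0. D = 4 * D0 \<and> odd D0))
     \<and> (\<forall>p. prime p \<longrightarrow> p dvd D \<longrightarrow> p = 2 \<or> twist_prime p)"

text \<open>For the prime 2: a number that is 2 mod 4 has valuation 1, which neither a cube nor D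
  c^3 can have.\<close>

lemma square_sum_mod4:
  assumes "odd x" "odd y"
  shows "(x ^ 2 + A * y ^ 2) mod 4 = 2" "(3 * x ^ 2 - A * y ^ 2) mod 4 = 2"
proof -
  have A: "A = 4 * (A div 4) + 1" using A_mod4 by presburger
  have 1: "x ^ 2 + A * y ^ 2 = 4 * ((A div 4) * y ^ 2) + (x ^ 2 + y ^ 2)"
    and 2: "3 * x ^ 2 - A * y ^ 2 = 4 * (- ((A div 4) * y ^ 2)) + (3 * x ^ 2 - y ^ 2)"
    using A by (Groebner_Basis.algebra)+
  have "x ^ 2 mod 4 = 1" "y ^ 2 mod 4 = 1" using assms int_sq_mod4 by auto
  then show "(x ^ 2 + A * y ^ 2) mod 4 = 2" "(3 * x ^ 2 - A * y ^ 2) mod 4 = 2"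
    unfolding 1 2 by presburger+
qed

lemma cube_mod9: "x ^ 3 mod 9 = (if 3 dvd x then 0 else if x mod 3 = 1 then 1 else 8)" for x :: int
proof -
  obtain q r where x: "x = 3 * q + r" "r \<in> {0, 1, 2}" by (rule that[of "x div 3" "x mod 3"]) auto
  have "x ^ 3 = r ^ 3 + 9 * (3 * q ^ 3 + 3 * q ^ 2 * r + q * r ^ 2)"
    by (simp add: x power3_eq_cube power2_eq_square algebra_simps)
  then have "x ^ 3 mod 9 = r ^ 3 mod 9" by (simp only: mod_mult_self2)
  moreover have "x mod 3 = r" "3 dvd x \<longleftrightarrow> r = 0" using x by auto presburger+
  ultimately show ?thesis using x(2) by auto
qed

context
  fixes D :: int
  assumes D: "good_twist D"
begin

text \<open>At 2, the equation is halved until a sum that is 2 mod 4 must be divisible by 4. A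
  common prime p of b and a that does not divide D gives p^2 | A; for p | D, inertness extracts
  further factors p until p^3 | D.\<close>

lemma twist_coprime_base:
  assumes eq: "b ^ 2 + A * D ^ 2 * c ^ 6 = a ^ 3" and cop: "coprime b c"
  shows "odd a" "coprime (2 * b) a"
proof -
  have e1: "b ^ 2 + A * (D * c ^ 3) ^ 2 = a ^ 3"
    using eq by (simp add: power_mult_distrib flip: power_mult)
  show oa: "odd a"
  proof
    assume "even a"
    then obtain a1 where a1: "a = 2 * a1" by (elim evenE)
    have oc: "odd c"
    proof
      assume "even c"
      then have "even (b ^ 2)" using eq \<open>even a\<close> by (metis even_add even_mult_iff even_power zero_less_numeral)
      then have "even b" by simp
      then have "is_unit (2 :: int)" using \<open>even c\<close> cop coprime_common_divisor by blast
      then show False by simp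
    qed
    show False
    proof (cases "odd D")
      case True
      then have o: "odd (D * c ^ 3)" using oc by simp
      then have "odd (A * (D * c ^ 3) ^ 2)" using A_odd by simp
      then have "odd b" using e1 \<open>even a\<close> by (metis even_add even_power zero_less_numeral)
      from square_sum_mod4(1)[OF this o] have "a ^ 3 mod 4 = 2" by (simp only: e1)
      moreover have "a ^ 3 = 4 * (2 * a1 ^ 3)" by (simp add: a1 power3_eq_cube)
      ultimately show False by presburger
    next
      case False
      then obtain D0 where D0: "D = 4 * D0" "odd D0" using D by (auto simp: good_twist_def)
      define e where "e = D0 * c ^ 3"
      have oe: "odd e" using D0 oc by (simp add: e_def)
      have e2: "b ^ 2 + 16 * (A * e ^ 2) = 8 * a1 ^ 3"
        using e1 unfolding a1 D0 e_def by (simp add: power_mult_distrib power2_eq_square power3_eq_cube algebra_simps)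
      then have "b ^ 2 = 2 * (4 * a1 ^ 3 - 8 * (A * e ^ 2))" by simp
      then have "even (b ^ 2)" by (metis dvd_triv_left)
      then obtain b1 where b1: "b = 2 * b1" by auto
      have e3: "b1 ^ 2 + 4 * (A * e ^ 2) = 2 * a1 ^ 3" using e2 by (simp add: b1 power_mult_distrib)
      then have "b1 ^ 2 = 2 * (a1 ^ 3 - 2 * (A * e ^ 2))" by simp
      then have "even (b1 ^ 2)" by (metis dvd_triv_left)
      then obtain b2 where b2: "b1 = 2 * b2" by auto
      have e4: "2 * (b2 ^ 2 + A * e ^ 2) = a1 ^ 3" using e3 by (simp add: b2 power_mult_distrib)
      then have "even (a1 ^ 3)" by (metis dvd_triv_left)
      then obtain a2 where a2: "a1 = 2 * a2" by auto
      have e5: "b2 ^ 2 + A * e ^ 2 = 4 * a2 ^ 3" using e4 by (simp add: a2 power_mult_distrib)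
      then have "even (b2 ^ 2 + A * e ^ 2)" by presburger
      moreover have "odd (A * e ^ 2)" using A_odd oe by simp
      ultimately have "odd b2" by simp
      from square_sum_mod4(1)[OF this oe] e5 show False by presburger
    qed
  qed
  have "coprime b a"
  proof (rule int_coprime_primeI)
    show "b \<noteq> 0 \<or> a \<noteq> 0" using oa by auto
    fix p :: int assume p: "prime p" "p dvd b" "p dvd a"
    then have npc: "\<not> p dvd c" using cop by (metis coprime_common_divisor not_prime_unit)
    obtain b1 a1 where b1: "b = p * b1" and a1: "a = p * a1" using p by (auto elim!: dvdE)
    have p0: "p \<noteq> 0" using p by auto
    show False
    proof (cases "p dvd D")
      case False
      have "A * D ^ 2 * c ^ 6 = p ^ 2 * (p * a1 ^ 3 - b1 ^ 2)"
        using eq unfolding a1 b1 by (simp add: power2_eq_square power3_eq_cube algebra_simps)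
      then have "p ^ 2 dvd A * (D ^ 2 * c ^ 6)" by (metis dvd_triv_left mult.assoc)
      moreover have "coprime (p ^ 2) (D ^ 2 * c ^ 6)" using p(1) False npc
        by (auto intro!: prime_imp_coprime)
      ultimately have "p ^ 2 dvd A" by (simp add: coprime_dvd_mult_left_iff)
      then have "is_unit p" using A_sqf by (auto simp: squarefree_def)
      then show False using p(1) by (simp add: not_prime_unit)
    next
      case True
      have "p \<noteq> 2" using p oa by auto
      then have tp: "twist_prime p" using D p(1) True by (auto simp: good_twist_def)
      obtain D1 where D1: "D = p * D1" using True by (auto elim: dvdE)
      have "p ^ 2 * (b1 ^ 2 + A * (D1 * c ^ 3) ^ 2) = p ^ 2 * (p * a1 ^ 3)"
        using e1 unfolding a1 b1 D1 by (simp add: power2_eq_square power3_eq_cube algebra_simps)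
      then have e2: "b1 ^ 2 + A * (D1 * c ^ 3) ^ 2 = p * a1 ^ 3" using p0 by simp
      then have "p dvd b1 \<and> p dvd D1 * c ^ 3" by (intro twist_prime_inert[OF tp]) simp
      then have "p dvd b1" "p dvd D1" using npc p(1) by (auto simp: prime_dvd_mult_iff prime_dvd_power_iff)
      then obtain b2 D2 where b2: "b1 = p * b2" and D2: "D1 = p * D2" by (auto elim!: dvdE)
      have "p * (p * (b2 ^ 2 + A * (D2 * c ^ 3) ^ 2)) = p * a1 ^ 3"
        using e2 unfolding b2 D2 by (simp add: power2_eq_square power3_eq_cube algebra_simps)
      then have e3: "p * (b2 ^ 2 + A * (D2 * c ^ 3) ^ 2) = a1 ^ 3" using p0 by simp
      then have "p dvd a1" using p(1) by (metis dvd_triv_left prime_dvd_power)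
      then obtain a2 where a2: "a1 = p * a2" by (auto elim: dvdE)
      have "p * (b2 ^ 2 + A * (D2 * c ^ 3) ^ 2) = p * (p * (p * a2 ^ 3))"
        using e3 unfolding a2 by (simp add: power3_eq_cube algebra_simps)
      then have "b2 ^ 2 + A * (D2 * c ^ 3) ^ 2 = p * (p * a2 ^ 3)" using p0 by simp
      then have "p dvd b2 \<and> p dvd D2 * c ^ 3" by (intro twist_prime_inert[OF tp]) simp
      then have "p dvd D2" using npc p(1) by (auto simp: prime_dvd_mult_iff prime_dvd_power_iff)
      then have "p ^ 3 dvd D" unfolding D1 D2 by (auto simp: power3_eq_cube elim!: dvdE)
      then have "is_unit p" using D unfolding good_twist_def cubefree_def by blast
      then show False using p(1) by (simp add: not_prime_unit)
    qed
  qed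
  then show "coprime (2 * b) a" using oa by simp
qed

lemma twist_coprime_odd:
  assumes "odd T" "\<And>p. twist_prime p \<Longrightarrow> p dvd T \<Longrightarrow> False"
  shows "coprime D T"
  by (rule int_coprime_primeI) (use assms D in \<open>auto simp: good_twist_def\<close>)

lemma twist_not_3_dvd: "\<not> 3 dvd D"
proof
  assume "3 dvd D"
  then obtain k where "D = 3 * k" by (elim dvdE)
  then have "A * D ^ 2 = 9 * (A * k ^ 2)" by (simp add: power2_eq_square)
  then have "A * D ^ 2 mod 9 = 0" by (simp only: mod_mult_self1_is_0)
  then show False using D unfolding good_twist_def by presburger
qed

text \<open>Descent on c: writing b + D c^3 sqrt (- A) as a cube gives D c^3 = v (3 u^2 - A v^2). If 3 does not
  divide v, this fails modulo 9; if 3 divides v, the second factor gives a point on the 3-isogenous curve,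
  which reflection pulls back to a smaller point of the original one.\<close>
lemma no_integral_point:
  "c \<noteq> 0 \<Longrightarrow> coprime b c \<Longrightarrow> b ^ 2 + A * D ^ 2 * c ^ 6 \<noteq> a ^ 3"
proof (induction "nat \<bar>c\<bar>" arbitrary: a b c rule: less_induct)
  case less
  show ?case
  proof
    assume eq: "b ^ 2 + A * D ^ 2 * c ^ 6 = a ^ 3"
    have D0: "D \<noteq> 0" using D by (auto simp: good_twist_def)
    note cop = twist_coprime_base[OF eq less.prems(2)]
    have eq': "b ^ 2 + A * (D * c ^ 3) ^ 2 = a ^ 3"
      using eq by (simp add: power_mult_distrib flip: power_mult)
    obtain u v where b: "b = u ^ 3 - 3 * A * u * v ^ 2" and Dc: "D * c ^ 3 = v * (3 * u ^ 2 - A * v ^ 2)"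
      using quadratic_cube[OF eq' cop(2)] by metis
    \<comment> \<open>Norms of both sides of the cube relation for u + v sqrt(- A).\<close>
    have a3: "a ^ 3 = (u ^ 2 + A * v ^ 2) ^ 3" using eq' unfolding b Dc by (Groebner_Basis.algebra)
    have v0: "v \<noteq> 0" using Dc D0 less.prems(1) by auto
    have uv: "coprime u v"
    proof (rule int_coprime_primeI)
      fix p assume p: "prime p" "p dvd u" "p dvd v"
      have "p dvd u ^ 2 + A * v ^ 2" using p by (auto simp: power2_eq_square)
      then have "p dvd a ^ 3" unfolding a3 by (rule dvd_cube)
      then have "p dvd a" using p(1) prime_dvd_power by blast
      moreover have "p dvd 2 * b" unfolding b using p by (auto simp: power3_eq_cube power2_eq_square)
      ultimately have "is_unit p" using cop(2) by (metis coprime_common_divisor)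
      then show False using p(1) by (simp add: not_prime_unit)
    qed (use v0 in simp)
    define T where "T = 3 * u ^ 2 - A * v ^ 2"
    have Dc: "D * c ^ 3 = v * T" using Dc by (simp add: T_def)
    have oT: "odd T"
    proof
      assume "even T"
      then have "even u \<longleftrightarrow> even v" using A_odd by (simp add: T_def)
      moreover have "\<not> (even u \<and> even v)" using uv by (metis coprime_common_divisor odd_one)
      ultimately have o: "odd u" "odd v" by auto
      have "T mod 4 = 2" unfolding T_def by (rule square_sum_mod4(2)[OF o])
      then obtain k where k: "T = 4 * k + 2" by (metis add.commute mod_eqE mult.commute div_mult_mod_eq)
      \<comment> \<open>D c^3 would be twice an odd number, but its valuation at 2 is 0 or 2 modulo
        3.\<close>
      have e: "D * c ^ 3 = 2 * (v * (2 * k + 1))" using Dc by (simp add: k algebra_simps)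
      have o': "odd (v * (2 * k + 1))" using o by simp
      show False
      proof (cases "odd D")
        case True
        then have "even c" using e by (metis dvd_triv_left even_mult_iff even_power)
        then obtain c1 where "c = 2 * c1" by (elim evenE)
        then have "2 * (2 * (2 * (D * c1 ^ 3))) = 2 * (v * (2 * k + 1))" using e by (simp add: power3_eq_cube algebra_simps)
        then have "even (v * (2 * k + 1))" by (metis dvd_triv_left mult_left_cancel zero_neq_numeral)
        then show False using o' by simp
      next
        case False
        then obtain D0 where "D = 4 * D0" using D by (auto simp: good_twist_def)
        then have "2 * (2 * (D0 * c ^ 3)) = 2 * (v * (2 * k + 1))" using e by simp
        then have "even (v * (2 * k + 1))" by (metis dvd_triv_left mult_left_cancel zero_neq_numeral)
        then show False using o' by simp
      qed
    qed
    have np: "False" if "prime p" "p dvd u" "p dvd v" for p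
      using that uv by (metis coprime_common_divisor not_prime_unit)
    have DT: "coprime D T"
    proof (rule twist_coprime_odd[OF oT])
      fix p assume p: "twist_prime p" "p dvd T"
      have "p dvd u \<and> p dvd v" using p(2) unfolding T_def by (rule twist_prime_inert_mirror(1)[OF p(1)])
      then show False using np p(1) by (auto simp: twist_prime_def)
    qed
    show False
    proof (cases "3 dvd v")
      case False
      have "coprime v T"
      proof (rule int_coprime_primeI)
        fix p assume p: "prime p" "p dvd v" "p dvd T"
        have "T + A * v * v = 3 * (u * u)" by (simp add: T_def power2_eq_square)
        then have "p dvd 3 * (u * u)" using p by (metis dvd_add dvd_mult)
        moreover have "\<not> p dvd 3"
        proof
          assume "p dvd 3"
          moreover have "prime (3 :: int)" by simp
          ultimately have "p = 3" using p(1) primes_dvd_imp_eq by blast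
          then show False using p(2) False by simp
        qed
        ultimately have "p dvd u" using p(1) by (auto simp: prime_dvd_mult_iff)
        then show False using np p by blast
      qed (use v0 in simp)
      \<comment> \<open>D is prime to T and goes entirely into v; the remaining cofactors are
        coprime with product c^3, hence cubes.\<close>
      have "D dvd v" using Dc DT by (metis coprime_dvd_mult_left_iff dvd_triv_left)
      then obtain v' where v': "v = D * v'" by (elim dvdE)
      have "v' * T = c ^ 3" using Dc D0 unfolding v' by simp
      moreover have "coprime v' T" using \<open>coprime v T\<close> unfolding v' by simp
      ultimately obtain s t where st: "v' = s ^ 3" "T = t ^ 3" using coprime_cube_factors by metis
      have "\<not> 3 dvd s" using False dvd_cube[of 3 s] unfolding v' st by auto
      then have "s ^ 3 mod 9 = 1 \<or> s ^ 3 mod 9 = 8" using cube_mod9[of s] by auto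
      moreover have "(s ^ 3) ^ 2 mod 9 = (s ^ 3 mod 9) ^ 2 mod 9" by (simp only: power_mod)
      ultimately have s9: "(s ^ 3) ^ 2 mod 9 = 1" by auto
      have "(A * D ^ 2 * (s ^ 3) ^ 2) mod 9 = ((A * D ^ 2 mod 9) * ((s ^ 3) ^ 2 mod 9)) mod 9" by (simp add: mod_mult_eq)
      then have w9: "(A * D ^ 2 * (s ^ 3) ^ 2) mod 9 = 7" using D s9 by (simp add: good_twist_def)
      define W where "W = A * D ^ 2 * (s ^ 3) ^ 2"
      have "t ^ 3 = 3 * u ^ 2 - W" using st(2) unfolding T_def v' st(1) W_def by (simp add: power_mult_distrib)
      moreover have "W mod 9 = 7" using w9 by (simp only: W_def)
      moreover have "t ^ 3 mod 9 = 0 \<or> t ^ 3 mod 9 = 1 \<or> t ^ 3 mod 9 = 8" using cube_mod9[of t] by auto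
      moreover have "u ^ 2 mod 3 = 0 \<or> u ^ 2 mod 3 = 1"
      proof -
        have "u mod 3 = 0 \<or> u mod 3 = 1 \<or> u mod 3 = 2" by presburger
        moreover have "u ^ 2 mod 3 = (u mod 3) ^ 2 mod 3" by (simp add: power_mod)
        ultimately show ?thesis by auto
      qed
      ultimately show False by (rule mod9_contradiction)
    next
      case True
      then obtain v1 where v1: "v = 3 * v1" by (elim dvdE)
      have nu: "\<not> 3 dvd u" using np[of 3] True by auto
      have nu2: "\<not> 3 dvd u ^ 2" using nu by (simp add: prime_dvd_power_iff)
      have T1: "T = 3 * (u ^ 2 - 3 * A * v1 ^ 2)" by (simp add: T_def v1 power_mult_distrib)
      have "3 dvd D * c ^ 3" unfolding Dc v1 by simp
      then have "3 dvd c" using twist_not_3_dvd by (auto simp: prime_dvd_mult_iff prime_dvd_power_iff)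
      then obtain c1 where c1: "c = 3 * c1" by (elim dvdE)
      have e1: "3 * (D * c1 ^ 3) = v1 * (u ^ 2 - 3 * A * v1 ^ 2)"
      proof -
        have "9 * (3 * (D * c1 ^ 3)) = 9 * (v1 * (u ^ 2 - 3 * A * v1 ^ 2))"
          using Dc v1 T1 c1 by (Groebner_Basis.algebra)
        then show ?thesis by (metis mult_left_cancel zero_neq_numeral)
      qed
      have "\<not> 3 dvd u ^ 2 - 3 * A * v1 ^ 2" 
      proof
        assume "3 dvd u ^ 2 - 3 * A * v1 ^ 2"
        then have "3 dvd (u ^ 2 - 3 * A * v1 ^ 2) + 3 * (A * v1 ^ 2)" by (intro dvd_add) auto
        then show False using nu2 by simp
      qed
      then have "3 dvd v1" using e1 prime_dvd_mult_iff[of 3 v1 "u ^ 2 - 3 * A * v1 ^ 2"] dvd_triv_left[of 3 "D * c1 ^ 3"] by auto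
      then obtain v2 where v2: "v1 = 3 * v2" by (elim dvdE)
      \<comment> \<open>The norm of u + 3 v2 sqrt(3 A). Once S is seen to be a cube t^3, this is the
        input of \<open>mirror_cube\<close>.\<close>
      define S where "S = u ^ 2 - 27 * A * v2 ^ 2"
      have T3: "T = 3 * S" by (simp add: T1 S_def v2 power_mult_distrib)
      have e2: "D * c1 ^ 3 = v2 * S" using e1 unfolding S_def v2 by (simp add: power_mult_distrib)
      have oS: "odd S" using oT T3 by simp
      have DS: "coprime D S" using DT T3 by simp
      have v2v: "p dvd v2 \<Longrightarrow> p dvd v" for p by (simp add: v1 v2)
      have v20: "v2 \<noteq> 0" using v0 v1 v2 by simp
      have "coprime v2 S"
      proof (rule int_coprime_primeI)
        fix p assume p: "prime p" "p dvd v2" "p dvd S"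
        have "S + 27 * A * v2 * v2 = u * u" by (simp add: S_def power2_eq_square)
        then have "p dvd u * u" using p by (metis dvd_add dvd_mult)
        then show False using np[of p] v2v[OF p(2)] p(1) by (auto simp: prime_dvd_mult_iff)
      qed (use v20 in simp)
      have "D dvd v2" using e2 DS by (metis coprime_dvd_mult_left_iff dvd_triv_left)
      then obtain v3 where v3: "v2 = D * v3" by (elim dvdE)
      have c1S: "v3 * S = c1 ^ 3" using e2 D0 unfolding v3 by simp
      have "coprime v3 S" using \<open>coprime v2 S\<close> unfolding v3 by simp
      from coprime_cube_factors[OF this c1S] obtain s t where st: "v3 = s ^ 3" "S = t ^ 3" by metis
      have ot: "odd t" using oS st by simp
      define w where "w = D * s ^ 3"
      have v2w: "v2 = w" by (simp add: w_def v3 st)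
      have eqw: "u ^ 2 = t ^ 3 + 27 * A * w ^ 2" using st(2) by (simp add: S_def v2w)
      have tu: "False" if p: "prime p" "p dvd t" "p dvd u" for p
      proof -
        have p3: "\<not> p dvd 3"
        proof
          assume "p dvd 3"
          moreover have "prime (3 :: int)" by simp
          ultimately have "p = 3" using p(1) primes_dvd_imp_eq by blast
          then show False using p(3) nu by simp
        qed
        have pw: "\<not> p dvd w" using np[OF p(1,3)] v2v v2w by auto
        obtain t1 u1 where tu1: "t = p * t1" "u = p * u1" using p by (auto elim!: dvdE)
        have "27 * A * w ^ 2 = p ^ 2 * (u1 ^ 2 - p * t1 ^ 3)"
          using eqw unfolding tu1 by (simp add: power2_eq_square power3_eq_cube algebra_simps)
        then have "p ^ 2 dvd A * (27 * w ^ 2)" by (metis dvd_triv_left mult.assoc mult.commute)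
        moreover have "\<not> p dvd 3 ^ 3" using p3 p(1) prime_dvd_power by blast
        then have "coprime p 27" "coprime p w" using p(1) pw by (auto intro!: prime_imp_coprime)
        then have "coprime (p ^ 2) (27 * w ^ 2)" by simp
        ultimately have "p ^ 2 dvd A" by (simp add: coprime_dvd_mult_left_iff)
        then have "is_unit p" using A_sqf by (auto simp: squarefree_def)
        then show False using p(1) by (simp add: not_prime_unit)
      qed
      have "coprime t u" by (rule int_coprime_primeI) (use tu ot in auto)
      moreover have "coprime 3 u" using nu by (simp add: prime_imp_coprime)
      ultimately have "coprime (3 * t) (2 * u)" using ot by simp
      moreover have w0: "w \<noteq> 0" using v20 v2w by simp
      ultimately obtain m n where mn: "u = m * (m ^ 2 + 9 * A * n ^ 2)" "w = n * (m ^ 2 + A * n ^ 2)" "t = m ^ 2 - 3 * A * n ^ 2"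
        using mirror_cube[OF eqw] by metis
      have npmn: "False" if "prime p" "p dvd m" "p dvd n" for p
        by (rule tu[of p]) (use that in \<open>auto simp: mn power2_eq_square\<close>)
      define V where "V = m ^ 2 + A * n ^ 2"
      have oV: "odd V" using ot A_odd unfolding V_def mn by simp
      have DV: "coprime D V"
      proof (rule twist_coprime_odd[OF oV])
        fix p assume p: "twist_prime p" "p dvd V"
        have "p dvd m \<and> p dvd n" using p(2) unfolding V_def by (rule twist_prime_inert[OF p(1)])
        then show False using npmn p(1) by (auto simp: twist_prime_def)
      qed
      have n0: "n \<noteq> 0" using w0 mn by auto
      have "coprime n V"
      proof (rule int_coprime_primeI)
        fix p assume p: "prime p" "p dvd n" "p dvd V"
        have "V - A * n * n = m * m" by (simp add: V_def power2_eq_square)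
        then have "p dvd m * m" using p by (metis dvd_diff dvd_mult)
        then show False using npmn p by (auto simp: prime_dvd_mult_iff)
      qed (use n0 in simp)
      \<comment> \<open>The second isogeny step: the same distribution of D and of cubes, now
        between n and V.\<close>
      have ws: "D * s ^ 3 = n * V" using mn(2) by (simp add: w_def V_def)
      have "D dvd n" using ws DV by (metis coprime_dvd_mult_left_iff dvd_triv_left)
      then obtain n' where n': "n = D * n'" by (elim dvdE)
      have "n' * V = s ^ 3" using ws D0 unfolding n' by simp
      moreover have "coprime n' V" using \<open>coprime n V\<close> unfolding n' by simp
      ultimately obtain s1 t1 where s1: "n' = s1 ^ 3" "V = t1 ^ 3" using coprime_cube_factors by metis
      have "s ^ 3 = (s1 * t1) ^ 3" using \<open>n' * V = s ^ 3\<close> s1 by (simp add: power_mult_distrib)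
      then have s: "s = s1 * t1" by (rule int_cube_cancel)
      have "c1 ^ 3 = (s * t) ^ 3" using c1S st by (simp add: power_mult_distrib)
      then have c1': "c1 = s * t" by (rule int_cube_cancel)
      have cc: "c = s1 * (3 * (t1 * t))" by (simp add: c1 c1' s)
      have s10: "s1 \<noteq> 0" and tt0: "t1 * t \<noteq> 0" using less.prems(1) cc by auto
      have "\<bar>s1\<bar> * 1 < \<bar>s1\<bar> * \<bar>3 * (t1 * t)\<bar>" using s10 tt0 by (intro mult_strict_left_mono) linarith+
      then have "nat \<bar>s1\<bar> < nat \<bar>c\<bar>" by (simp add: cc abs_mult)
      moreover have "coprime m s1"
      proof (rule int_coprime_primeI)
        fix p assume p: "prime p" "p dvd m" "p dvd s1"
        then have "p dvd n" unfolding n' s1 by (intro dvd_mult dvd_cube)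
        then show False using npmn p by blast
      qed (use s10 in simp)
      \<comment> \<open>The original equation again, with c replaced by its proper divisor s1; the
        factor 3 in c guarantees the decrease.\<close>
      moreover have "m ^ 2 + A * D ^ 2 * s1 ^ 6 = t1 ^ 3"
        unfolding s1(2)[symmetric] V_def n' s1(1) by (simp add: power_mult_distrib flip: power_mult)
      ultimately show False using less.hyps s10 by blast
    qed
  qed
qed

end

end

section \<open>Rational points and the rank\<close>

lemma rational_point_integral:
  fixes x y :: rat and m :: int
  assumes "y ^ 2 = x ^ 3 - of_int m"
  obtains a b c :: int where "c \<noteq> 0" "coprime b c" "b ^ 2 + m * c ^ 6 = a ^ 3"
proof -
  obtain p q where pq: "quotient_of x = (p, q)" by (cases "quotient_of x")
  obtain r s where rs: "quotient_of y = (r, s)" by (cases "quotient_of y")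
  have q: "q > 0" "coprime p q" "x = of_int p / of_int q"
    using quotient_of_denom_pos[OF pq] quotient_of_coprime[OF pq] quotient_of_div[OF pq] by auto
  have s: "s > 0" "coprime r s" "y = of_int r / of_int s"
    using quotient_of_denom_pos[OF rs] quotient_of_coprime[OF rs] quotient_of_div[OF rs] by auto
  have "(of_int (r ^ 2 * q ^ 3) :: rat) = of_int (s ^ 2 * (p ^ 3 - m * q ^ 3))"
    using assms q(1) s(1) unfolding q(3) s(3) by (simp add: power_divide field_simps)
  then have e: "r ^ 2 * q ^ 3 = s ^ 2 * (p ^ 3 - m * q ^ 3)" by (simp only: of_int_eq_iff)
  have "s ^ 2 dvd r ^ 2 * q ^ 3" unfolding e by simp
  then have 1: "s ^ 2 dvd q ^ 3" using s(2) by (simp add: coprime_dvd_mult_right_iff coprime_commute)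
  have "coprime (p ^ 3 - m * q ^ 3) (q ^ 3)"
  proof (rule int_coprime_primeI)
    fix l assume l: "prime l" "l dvd p ^ 3 - m * q ^ 3" "l dvd q ^ 3"
    then have "l dvd (p ^ 3 - m * q ^ 3) + m * q ^ 3" by (intro dvd_add dvd_mult)
    then have "l dvd p ^ 3" by simp
    then have "l dvd p" by (rule prime_dvd_power[OF l(1)])
    moreover have "l dvd q" by (rule prime_dvd_power[OF l(1) l(3)])
    ultimately have "is_unit l" using q(2) coprime_common_divisor by blast
    then show False using l(1) by (simp add: not_prime_unit)
  qed (use q(1) in simp)
  moreover have "q ^ 3 dvd s ^ 2 * (p ^ 3 - m * q ^ 3)" unfolding e[symmetric] by simp
  ultimately have 2: "q ^ 3 dvd s ^ 2" by (simp add: coprime_dvd_mult_left_iff coprime_commute)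
  \<comment> \<open>For the reduced denominators q of x and s of y this forces q = c^2 and s =
    c^3.\<close>
  have sq: "s ^ 2 = q ^ 3" using 1 2 q(1) s(1) zdvd_antisym_nonneg[of "s ^ 2" "q ^ 3"] by simp
  have sq1: "(of_int 1 :: rat) * (of_int s / of_int q) ^ 2 = of_int q"
  proof -
    have "(of_int (s ^ 2) :: rat) = of_int (q ^ 3)" by (simp only: sq)
    then show ?thesis using q(1) by (simp add: power_divide power3_eq_cube power2_eq_square)
  qed
  have "(of_int s / of_int q :: rat) \<in> \<int>"
    by (rule rat_square_int_imp_int[of 1]) (simp_all only: sq1, simp_all)
  then obtain c where "(of_int s / of_int q :: rat) = of_int c" by (auto elim: Ints_cases)
  then have "(of_int s :: rat) = of_int (c * q)" using q(1) by (simp add: field_simps)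
  then have c: "s = c * q" by (simp only: of_int_eq_iff)
  have "q ^ 2 * c ^ 2 = q ^ 2 * q" using sq unfolding c by (simp add: power_mult_distrib power3_eq_cube power2_eq_square mult_ac)
  then have q2: "q = c ^ 2" using q(1) by simp
  have "s ^ 2 * r ^ 2 = s ^ 2 * (p ^ 3 - m * q ^ 3)" using e sq by (simp add: mult.commute)
  then have "r ^ 2 = p ^ 3 - m * q ^ 3" using s(1) by simp
  then have "r ^ 2 + m * c ^ 6 = p ^ 3" unfolding q2 by (simp flip: power_mult)
  moreover have "c \<noteq> 0" using q(1) q2 by auto
  moreover have "coprime r c" using s(2) unfolding c by simp
  ultimately show ?thesis using that by blast
qed

text \<open>A one-point carrier is a commutative group for trivial reasons, so associativity of
  \<open>ec_add\<close> on general points never comes up. The set of the identity alone is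
  dependent, with exponent 1, and only the empty set counts.\<close>

lemma abelian_rank_trivial:
  fixes G (structure)
  assumes "carrier G = {\<one>\<^bsub>G\<^esub>}" "\<one>\<^bsub>G\<^esub> \<otimes>\<^bsub>G\<^esub> \<one>\<^bsub>G\<^esub> = \<one>\<^bsub>G\<^esub>"
  shows "abelian_rank G = 0"
proof -
  interpret comm_group G by (rule comm_groupI) (use assms in auto)
  have "S = {}" if "S \<subseteq> carrier G" "Z_independent G S" for S
  proof (rule ccontr)
    assume "S \<noteq> {}"
    then have S: "S = {\<one>}" using that(1) assms(1) by (metis subset_singletonD)
    have "(\<Otimes>x\<in>S. x [^] (1::int)) = \<one>" unfolding S by simp
    then have "\<forall>x\<in>S. (1::int) = 0" using that(2)[unfolded Z_independent_def, rule_format, of "\<lambda>_. 1"] by auto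
    then show False using S by simp
  qed
  then have "abelian_rank G \<le> 0" unfolding abelian_rank_def by (intro SUP_least) (auto simp: zero_enat_def)
  then show ?thesis by simp
qed

context trivial_3_torsion
begin

theorem good_twist_rank_0:
  assumes D: "good_twist D"
  shows "abelian_rank (cubic_twist_group A D) = 0"
proof (rule abelian_rank_trivial)
  have "\<not> (y ^ 2 = x ^ 3 - of_int (A * D ^ 2))" for x y :: rat
    using rational_point_integral[of y x "A * D ^ 2"] no_integral_point[OF D] by metis
  then show "carrier (cubic_twist_group A D) = {\<one>\<^bsub>cubic_twist_group A D\<^esub>}"
    by (auto simp: cubic_twist_group_def ec_group_def ec_points_def)
qed (simp add: cubic_twist_group_def ec_group_def)

end

section \<open>Real characters\<close>

text \<open>Summation by parts with the total variation of \<open>a\<close>; the form without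
  monotonicity is the one needed for the oscillating \<open>phi\<close> in
  \<open>rdiv_sum_upper\<close>.\<close>

lemma abel_bound:
  fixes c a :: "nat \<Rightarrow> real"
  assumes "M < N" and T: "\<And>n. \<bar>\<Sum>k\<in>{M<..n}. c k\<bar> \<le> B"
  shows "\<bar>\<Sum>k\<in>{M<..N}. c k * a k\<bar> \<le> B * (\<bar>a N\<bar> + (\<Sum>k\<in>{M<..<N}. \<bar>a k - a (Suc k)\<bar>))"
proof -
  define T where "T = (\<lambda>n. \<Sum>k\<in>{M<..n}. c k)"
  have step: "{M<..Suc n} = insert (Suc n) {M<..n}" if "M \<le> n" for n using that by auto
  have "M < N \<Longrightarrow> (\<Sum>k\<in>{M<..N}. c k * a k) = T N * a N + (\<Sum>k\<in>{M<..<N}. T k * (a k - a (Suc k)))" for N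
  proof (induction N)
    case (Suc N)
    show ?case
    proof (cases "M = N")
      case True
      have "{N<..Suc N} = {Suc N}" "{N<..<Suc N} = {}" by auto
      then show ?thesis using True by (simp add: T_def)
    next
      case False
      then have "M < N" using Suc.prems by simp
      have "{M<..<Suc N} = insert N {M<..<N}" using \<open>M < N\<close> by auto
      moreover have "T (Suc N) = T N + c (Suc N)" using \<open>M < N\<close> by (simp add: T_def step)
      ultimately show ?thesis using Suc.IH[OF \<open>M < N\<close>] \<open>M < N\<close> by (simp add: step algebra_simps)
    qed
  qed simp
  from this[OF assms(1)] have "\<bar>\<Sum>k\<in>{M<..N}. c k * a k\<bar> \<le> \<bar>T N * a N\<bar> + (\<Sum>k\<in>{M<..<N}. \<bar>T k * (a k - a (Suc k))\<bar>)"
    using abs_triangle_ineq[of "T N * a N" "\<Sum>k\<in>{M<..<N}. T k * (a k - a (Suc k))"]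
      sum_abs[of "\<lambda>k. T k * (a k - a (Suc k))" "{M<..<N}"] by linarith
  also have "\<dots> \<le> B * \<bar>a N\<bar> + (\<Sum>k\<in>{M<..<N}. B * \<bar>a k - a (Suc k)\<bar>)"
    unfolding abs_mult by (intro add_mono sum_mono mult_right_mono) (use T in \<open>auto simp: T_def\<close>)
  finally show ?thesis by (simp add: sum_distrib_left distrib_left)
qed

lemma abel_bound_antimono:
  fixes c a :: "nat \<Rightarrow> real"
  assumes T: "\<And>n. \<bar>\<Sum>k\<in>{M<..n}. c k\<bar> \<le> B"
    and a: "\<And>k. M < k \<Longrightarrow> a k \<ge> 0" "\<And>k. M < k \<Longrightarrow> a (Suc k) \<le> a k"
  shows "\<bar>\<Sum>k\<in>{M<..N}. c k * a k\<bar> \<le> B * a (Suc M)"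
proof (cases "M < N")
  case True
  have B: "B \<ge> 0" using T[of 0] by linarith
  have "M < N \<Longrightarrow> (\<Sum>k\<in>{M<..<N}. \<bar>a k - a (Suc k)\<bar>) = a (Suc M) - a N" for N
  proof (induction N)
    case (Suc N)
    show ?case
    proof (cases "M = N")
      case True
      have "{N<..<Suc N} = {}" by auto
      then show ?thesis using True by simp
    next
      case False
      then have "M < N" using Suc.prems by simp
      moreover have "{M<..<Suc N} = insert N {M<..<N}" using \<open>M < N\<close> by auto
      ultimately show ?thesis using Suc.IH a(2)[of N] by simp
    qed
  qed simp
  from this[OF True] have "(\<Sum>k\<in>{M<..<N}. \<bar>a k - a (Suc k)\<bar>) = a (Suc M) - a N" .
  then show ?thesis using abel_bound[OF True T, of a] a(1)[OF True] by simp
next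
  case False
  have "B \<ge> 0" using T[of 0] by linarith
  then show ?thesis using False a(1)[of "Suc M"] by simp
qed

lemma sum_divisors_swap:
  fixes g :: "nat \<Rightarrow> nat \<Rightarrow> real"
  shows "(\<Sum>n\<in>{1..N}. \<Sum>d | d dvd n. g d (n div d)) = (\<Sum>d\<in>{1..N}. \<Sum>m\<in>{1..N div d}. g d m)"
proof -
  have "(\<Sum>n\<in>{1..N}. \<Sum>d | d dvd n. g d (n div d)) = (\<Sum>(n,d)\<in>(SIGMA n:{1..N}. {d. d dvd n}). g d (n div d))"
    by (rule sum.Sigma) auto
  also have "\<dots> = (\<Sum>(d,m)\<in>(SIGMA d:{1..N}. {1..N div d}). g d m)"
  proof (rule sum.reindex_bij_witness[of _ "\<lambda>(d,m). (d * m, d)" "\<lambda>(n,d). (d, n div d)"])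
    fix x assume "x \<in> (SIGMA n:{1..N}. {d. d dvd n})"
    then obtain n d where x: "x = (n, d)" "n \<ge> 1" "n \<le> N" "d dvd n" by auto
    then have "d \<ge> 1" "n div d \<ge> 1" "d \<le> N"
      using dvd_imp_le[of d n] by (auto simp: Suc_le_eq dvd_pos_nat div_greater_zero_iff)
    then show "(case x of (n, d) \<Rightarrow> (d, n div d)) \<in> (SIGMA d:{1..N}. {1..N div d})"
      using x by (auto intro: div_le_mono)
    show "(case case x of (n, d) \<Rightarrow> (d, n div d) of (d, m) \<Rightarrow> (d * m, d)) = x" using x by simp
    show "(case case x of (n, d) \<Rightarrow> (d, n div d) of (d, m) \<Rightarrow> g d m) = (case x of (n, d) \<Rightarrow> g d (n div d))" using x by simp
  next
    fix y assume "y \<in> (SIGMA d:{1..N}. {1..N div d})"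
    then obtain d m where y: "y = (d, m)" "d \<ge> 1" "d \<le> N" "m \<ge> 1" "m \<le> N div d" by auto
    then have "d * m \<le> N" by (metis div_times_less_eq_dividend mult.commute mult_le_mono1 order_trans)
    then show "(case y of (d, m) \<Rightarrow> (d * m, d)) \<in> (SIGMA n:{1..N}. {d. d dvd n})" using y by auto
    show "(case case y of (d, m) \<Rightarrow> (d * m, d) of (n, d) \<Rightarrow> (d, n div d)) = y" using y by simp
  qed
  also have "\<dots> = (\<Sum>d\<in>{1..N}. \<Sum>m\<in>{1..N div d}. g d m)" by (rule sum.Sigma[symmetric]) auto
  finally show ?thesis .
qed

lemma coprime_divisors_bij:
  fixes m n :: nat
  assumes "coprime m n" "m > 0" "n > 0"
  shows "bij_betw (\<lambda>(a, b). a * b) ({a. a dvd m} \<times> {b. b dvd n}) {d. d dvd m * n}"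
proof (rule bij_betwI')
  fix x y assume "x \<in> {a. a dvd m} \<times> {b. b dvd n}" "y \<in> {a. a dvd m} \<times> {b. b dvd n}"
  then obtain a b a' b' where x: "x = (a, b)" "a dvd m" "b dvd n" and y: "y = (a', b')" "a' dvd m" "b' dvd n" by auto
  have c: "coprime a b'" "coprime a' b" using assms(1) x y by (meson coprime_divisors)+
  show "((case x of (a, b) \<Rightarrow> a * b) = (case y of (a, b) \<Rightarrow> a * b)) = (x = y)"
  proof
    assume "(case x of (a, b) \<Rightarrow> a * b) = (case y of (a, b) \<Rightarrow> a * b)"
    then have e: "a * b = a' * b'" by (simp add: x y)
    then have "a dvd a'" "a' dvd a" using c by (metis coprime_dvd_mult_left_iff dvd_triv_left)+
    then have "a = a'" by (rule dvd_antisym)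
    moreover have "a > 0" using x assms(2) by (metis dvd_pos_nat)
    ultimately show "x = y" using e x y by simp
  qed auto
next
  fix x assume "x \<in> {a. a dvd m} \<times> {b. b dvd n}"
  then show "(case x of (a, b) \<Rightarrow> a * b) \<in> {d. d dvd m * n}" by (auto intro: mult_dvd_mono)
next
  fix d assume "d \<in> {d. d dvd m * n}"
  then obtain a b where "d = a * b" "a dvd m" "b dvd n" using division_decomp[of d m n] by auto
  then show "\<exists>x\<in>{a. a dvd m} \<times> {b. b dvd n}. d = (case x of (a, b) \<Rightarrow> a * b)" by auto
qed

text \<open>A non-principal real Dirichlet character; the vanishing sum over a period is the form of
  non-principality that partial summation uses.\<close>

locale real_char =
  fixes chi :: "nat \<Rightarrow> real" and q :: nat
  assumes q_pos: "q > 0" and chi_period: "chi (n + q) = chi n"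
    and chi_mult: "chi (m * n) = chi m * chi n"
    and chi_values: "chi n \<in> {-1, 0, 1}" and chi_1: "chi 1 = 1"
    and chi_sum: "(\<Sum>n<q. chi n) = 0"
begin

lemma chi_abs: "\<bar>chi n\<bar> \<le> 1" using chi_values[of n] by auto

lemma chi_0: "chi 0 = 0"
proof (rule ccontr)
  assume 0: "chi 0 \<noteq> 0"
  have "chi n = 1" for n using chi_mult[of 0 n] 0 by simp
  then have "(\<Sum>n<q. chi n) = of_nat q" by simp
  then show False using chi_sum q_pos by simp
qed

lemma chi_partial: "\<bar>\<Sum>k<n. chi k\<bar> \<le> of_nat q"
proof (induction n rule: less_induct)
  case (less n)
  have per: "(\<Sum>k<m + q. chi k) = (\<Sum>k<m. chi k)" for m
    by (induction m) (simp_all add: chi_sum chi_period)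
  show ?case
  proof (cases "n < q")
    case True
    have "\<bar>\<Sum>k<n. chi k\<bar> \<le> (\<Sum>k<n. \<bar>chi k\<bar>)" by (rule sum_abs)
    also have "\<dots> \<le> (\<Sum>k<n. 1)" by (intro sum_mono chi_abs)
    finally show ?thesis using True by simp
  next
    case False
    then show ?thesis using per[of "n - q"] less[of "n - q"] q_pos by simp
  qed
qed

lemma chi_interval: "\<bar>\<Sum>k\<in>{M<..n}. chi k\<bar> \<le> 2 * of_nat q"
proof (cases "M \<le> n")
  case True
  have "{..<Suc n} = {..<Suc M} \<union> {M<..n}" "{..<Suc M} \<inter> {M<..n} = {}" using True by auto
  then have "(\<Sum>k<Suc n. chi k) = (\<Sum>k<Suc M. chi k) + (\<Sum>k\<in>{M<..n}. chi k)" by (simp only: sum.union_disjoint finite_lessThan finite_greaterThanAtMost)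
  then show ?thesis using chi_partial[of "Suc n"] chi_partial[of "Suc M"] by linarith
qed simp

section \<open>The value L(1, chi) and its nonvanishing\<close>

definition Lsum :: "nat \<Rightarrow> real" where "Lsum N = (\<Sum>k\<in>{1..N}. chi k / of_nat k)"
definition L1 :: real where "L1 = lim Lsum"

lemma Lsum_diff:
  assumes "M \<le> N"
  shows "\<bar>Lsum N - Lsum M\<bar> \<le> 2 * of_nat q / of_nat (Suc M)"
proof -
  have "{1..N} = {1..M} \<union> {M<..N}" "{1..M} \<inter> {M<..N} = {}" using assms by auto
  then have "Lsum N = Lsum M + (\<Sum>k\<in>{M<..N}. chi k / of_nat k)" unfolding Lsum_def
    by (simp only: sum.union_disjoint finite_atLeastAtMost finite_greaterThanAtMost)
  moreover have "\<bar>\<Sum>k\<in>{M<..N}. chi k * (1 / of_nat k)\<bar> \<le> 2 * of_nat q * (1 / of_nat (Suc M))"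
    by (rule abel_bound_antimono[OF chi_interval]) (auto simp: frac_le)
  ultimately show ?thesis by simp
qed

lemma L1_tail: "\<bar>Lsum M - L1\<bar> \<le> 2 * of_nat q / of_nat (Suc M)"
proof -
  have "Cauchy Lsum"
  proof (rule metric_CauchyI)
    fix e :: real assume e: "e > 0"
    obtain M :: nat where M: "of_nat M > 2 * of_nat q / e" using reals_Archimedean2 by blast
    have small: "2 * of_nat q / of_nat (Suc n) < e" if "n \<ge> M" for n
    proof -
      have "2 * of_nat q / e < of_nat (Suc n)" using M that by simp
      then show ?thesis using e by (simp add: field_simps)
    qed
    show "\<exists>M. \<forall>m\<ge>M. \<forall>n\<ge>M. dist (Lsum m) (Lsum n) < e"
    proof (intro exI allI impI)
      fix m n assume "M \<le> m" "M \<le> n"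
      then show "dist (Lsum m) (Lsum n) < e"
        using Lsum_diff[of m n] Lsum_diff[of n m] small[of m] small[of n]
        by (cases "m \<le> n") (auto simp: dist_real_def)
    qed
  qed
  then have "Lsum \<longlonglongrightarrow> L1" unfolding L1_def by (simp add: Cauchy_convergent_iff convergent_LIMSEQ_iff)
  then have "(\<lambda>N. \<bar>Lsum M - Lsum N\<bar>) \<longlonglongrightarrow> \<bar>Lsum M - L1\<bar>" by (intro tendsto_intros)
  moreover have "\<forall>\<^sub>F N in sequentially. \<bar>Lsum M - Lsum N\<bar> \<le> 2 * of_nat q / of_nat (Suc M)"
    using eventually_ge_at_top[of M] by eventually_elim (metis Lsum_diff abs_minus_commute)
  ultimately show ?thesis by (intro tendsto_upperbound) auto
qed

text \<open>The Dirichlet convolution of 1 with \<open>chi\<close>, that is, the coefficients of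
  zeta(s) L(s, chi).\<close>

definition rdiv :: "nat \<Rightarrow> real" where "rdiv n = (\<Sum>d | d dvd n. chi d)"

lemma rdiv_mult: "coprime m n \<Longrightarrow> m > 0 \<Longrightarrow> n > 0 \<Longrightarrow> rdiv (m * n) = rdiv m * rdiv n"
  unfolding rdiv_def sum_product
  by (subst sum.reindex_bij_betw[OF coprime_divisors_bij, symmetric])
     (auto simp: sum.cartesian_product chi_mult intro!: sum.cong)

lemma chi_power: "chi (p ^ i) = chi p ^ i"
  by (induction i) (use chi_1 in \<open>auto simp: chi_mult\<close>)

text \<open>The value at p^k is the sum of chi(p)^i over i <= k, which for chi(p) = -1 alternates
  between 1 and 0.\<close>

lemma rdiv_prime_power:
  assumes "prime p"
  shows "rdiv (p ^ k) \<ge> 0" "even k \<Longrightarrow> rdiv (p ^ k) \<ge> 1"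
proof -
  have "{d. d dvd p ^ k} = (\<lambda>i. p ^ i) ` {..k}" using assms by (auto simp: divides_primepow_nat)
  moreover have "inj_on (\<lambda>i. p ^ i) {..k}" using assms prime_gt_1_nat by (auto intro!: inj_onI)
  ultimately have r: "rdiv (p ^ k) = (\<Sum>i\<le>k. chi p ^ i)" by (simp add: rdiv_def sum.reindex chi_power)
  have neg: "(\<Sum>i\<le>k. (- 1 :: real) ^ i) = (if even k then 1 else 0)" by (induction k) auto
  have zero: "(\<Sum>i\<le>k. (0 :: real) ^ i) = 1" by (simp add: power_0_left)
  show "rdiv (p ^ k) \<ge> 0" "even k \<Longrightarrow> rdiv (p ^ k) \<ge> 1"
    using chi_values[of p] neg zero by (auto simp: r)
qed

lemma rdiv_nonneg_and_square: "n > 0 \<Longrightarrow> rdiv n \<ge> 0 \<and> rdiv (n ^ 2) \<ge> 1"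
proof (induction n rule: less_induct)
  case (less n)
  show ?case
  proof (cases "n = 1")
    case True
    then show ?thesis by (simp add: rdiv_def chi_1[simplified])
  next
    case False
    then obtain p where p: "prime p" "p dvd n" using prime_factor_nat by blast
    define k where "k = multiplicity p n"
    have "\<not> is_unit p" "n \<noteq> 0" using p(1) not_prime_unit less.prems by auto
    then obtain m where m: "n = p ^ k * m" "\<not> p dvd m"
      using multiplicity_decompose'[of n p] unfolding k_def by metis
    have m0: "m > 0" using less.prems m by (cases m) auto
    have "k > 0" using p less.prems by (simp add: k_def prime_multiplicity_gt_zero_iff)
    then have "p ^ k > 1" by (intro one_less_power prime_gt_1_nat[OF p(1)])
    then have "m < n" using m m0 by simp
    then have IH: "rdiv m \<ge> 0" "rdiv (m ^ 2) \<ge> 1" using less.IH m0 by auto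
    have c: "coprime (p ^ k) m" using p m by (simp add: prime_imp_coprime)
    have pk: "p ^ k > 0" using p by (simp add: prime_gt_0_nat)
    have "rdiv n = rdiv (p ^ k) * rdiv m" unfolding m(1) using c m0 pk by (intro rdiv_mult)
    then have 1: "rdiv n \<ge> 0" using IH rdiv_prime_power(1)[OF p(1)] by simp
    have "n ^ 2 = p ^ (k * 2) * m ^ 2" by (simp add: m(1) power_mult_distrib power_mult)
    moreover have "coprime (p ^ (k * 2)) (m ^ 2)" using p m by (simp add: prime_imp_coprime)
    moreover have "p ^ (k * 2) > 0" using p by (simp add: prime_gt_0_nat)
    ultimately have "rdiv (n ^ 2) = rdiv (p ^ (k * 2)) * rdiv (m ^ 2)" using m0 by (simp add: rdiv_mult)
    moreover have "rdiv (p ^ (k * 2)) \<ge> 1" using rdiv_prime_power(2)[OF p(1), of "k * 2"] by simp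
    ultimately have "rdiv (n ^ 2) \<ge> 1 * 1" using IH mult_mono[of 1 "rdiv (p ^ (k * 2))" 1 "rdiv (m ^ 2)"] by simp
    then show ?thesis using 1 by simp
  qed
qed

text \<open>The sum of N - n over the multiples n of d up to N is N^2 / (2 d) - N / 2 + d * osc (N / d).\<close>
definition osc :: "real \<Rightarrow> real" where "osc y = frac y * (1 - frac y) / 2"

lemma osc_bounds: "0 \<le> osc y" "osc y \<le> 1 / 8" "osc y \<le> frac y / 2" "osc y \<le> (1 - frac y) / 2"
proof -
  have f: "0 \<le> frac y" "frac y < 1" by (auto simp: frac_lt_1)
  show "0 \<le> osc y" using f by (simp add: osc_def)
  have "frac y * (1 - frac y) = 1 / 4 - (frac y - 1 / 2) ^ 2" by (simp add: power2_eq_square algebra_simps)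
  then show "osc y \<le> 1 / 8" by (simp add: osc_def)
  show "osc y \<le> frac y / 2" using f by (simp add: osc_def mult_left_le)
  show "osc y \<le> (1 - frac y) / 2" using f by (simp add: osc_def mult_left_le_one_le)
qed

text \<open>Unlike \<open>frac\<close>, the function \<open>osc\<close> tends to 0 on both sides of
  an integer and has no jumps; this is what the weight N - n buys.\<close>

lemma osc_lipschitz:
  assumes "y' \<le> y"
  shows "\<bar>osc y - osc y'\<bar> \<le> (y - y') / 2"
proof (cases "\<lfloor>y\<rfloor> = \<lfloor>y'\<rfloor>")
  case True
  then have d: "frac y - frac y' = y - y'" by (simp add: frac_def)
  have "frac y * (1 - frac y) - frac y' * (1 - frac y') = (frac y - frac y') * (1 - frac y - frac y')"
    by (simp add: algebra_simps)
  then have "osc y - osc y' = ((y - y') * (1 - frac y - frac y')) / 2"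
    unfolding osc_def diff_divide_distrib[symmetric] d by simp
  then have "\<bar>osc y - osc y'\<bar> = \<bar>((y - y') * (1 - frac y - frac y')) / 2\<bar>" by (simp only:)
  also have "\<dots> = (y - y') * \<bar>1 - frac y - frac y'\<bar> / 2" using assms by (simp add: abs_mult)
  also have "\<dots> \<le> (y - y') * 1 / 2"
    using assms frac_lt_1[of y] frac_lt_1[of y'] frac_ge_0[of y] frac_ge_0[of y']
    by (intro divide_right_mono mult_left_mono) linarith+
  finally show ?thesis by simp
next
  case False
  then have "\<lfloor>y'\<rfloor> + 1 \<le> \<lfloor>y\<rfloor>" using floor_mono[OF assms] by linarith
  then have "real_of_int \<lfloor>y'\<rfloor> + 1 \<le> real_of_int \<lfloor>y\<rfloor>" by linarith
  moreover have "frac y = y - \<lfloor>y\<rfloor>" "frac y' = y' - \<lfloor>y'\<rfloor>" by (auto simp: frac_def)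
  ultimately have "frac y \<le> y - y'" "1 - frac y' \<le> y - y'"
    using floor_correct[of y] floor_correct[of y'] by linarith+
  then have "frac y / 2 \<le> (y - y') / 2" "(1 - frac y') / 2 \<le> (y - y') / 2"
    by (simp_all add: divide_right_mono)
  then have "osc y \<le> (y - y') / 2" "osc y' \<le> (y - y') / 2"
    using order_trans[OF osc_bounds(3)] order_trans[OF osc_bounds(4)] by blast+
  moreover have "\<bar>a - b\<bar> \<le> c" if "0 \<le> a" "0 \<le> b" "a \<le> c" "b \<le> c" for a b c :: real using that by auto
  ultimately show ?thesis using osc_bounds(1) by blast
qed

text \<open>Exchanging the sums leaves N^2 / 2 times \<open>Lsum N\<close>, small since L1 = 0, a
  partial sum of \<open>chi\<close>, and the oscillation \<open>phi\<close>, treated by Abel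
  summation. Unweighted, the squares would contribute only order sqrt N, the size of the error in
  the hyperbola method.\<close>

lemma rdiv_sum_upper:
  assumes L: "L1 = 0" and N: "N \<ge> 1"
  shows "(\<Sum>n\<in>{1..N}. rdiv n * (real N - real n)) \<le> real N * (real q * (4 + ln (real N)))"
proof -
  define phi where "phi = (\<lambda>d. real d * osc (real N / real d))"
  have tri: "(\<Sum>m\<in>{1..M}. real m) = real M * (real M + 1) / 2" for M
    by (induction M) (auto simp: algebra_simps add_divide_distrib)
  have "(\<Sum>n\<in>{1..N}. rdiv n * (real N - real n)) = (\<Sum>n\<in>{1..N}. \<Sum>d | d dvd n. chi d * (real N - real d * real (n div d)))"
  proof (intro sum.cong refl)
    fix n assume "n \<in> {1..N}"
    show "rdiv n * (real N - real n) = (\<Sum>d | d dvd n. chi d * (real N - real d * real (n div d)))"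
      unfolding rdiv_def sum_distrib_right
      by (intro sum.cong refl) (auto simp flip: of_nat_mult)
  qed
  also have "\<dots> = (\<Sum>d\<in>{1..N}. \<Sum>m\<in>{1..N div d}. chi d * (real N - real d * real m))"
    by (rule sum_divisors_swap)
  also have "\<dots> = (\<Sum>d\<in>{1..N}. (real N ^ 2 / 2) * (chi d / real d) - (real N / 2) * chi d + chi d * phi d)"
  proof (intro sum.cong refl)
    fix d assume d: "d \<in> {1..N}"
    define M where "M = real (N div d)"
    define y where "y = real N / real d"
    have Ny: "real N = real d * y" using d by (simp add: y_def)
    have fr: "frac y = y - M" by (simp add: frac_def y_def M_def floor_divide_of_nat_eq)
    have "(\<Sum>m\<in>{1..N div d}. chi d * (real N - real d * real m)) = chi d * (M * real N - real d * (M * (M + 1) / 2))"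
    proof -
      have "(\<Sum>m\<in>{1..N div d}. real N - real d * real m) = real (N div d) * real N - real d * (\<Sum>m\<in>{1..N div d}. real m)"
        by (simp add: sum_subtractf sum_distrib_left)
      then show ?thesis by (simp only: sum_distrib_left[symmetric] tri M_def)
    qed
    also have "\<dots> = (real N ^ 2 / 2) * (chi d / real d) - (real N / 2) * chi d + chi d * phi d"
    proof -
      have 1: "phi d = real d * ((y - M) * (1 - (y - M)) / 2)" by (simp add: phi_def osc_def y_def[symmetric] fr)
      have 2: "(real N ^ 2 / 2) * (chi d / real d) = chi d * real d * (y * y) / 2"
        using d by (simp add: y_def power2_eq_square mult_ac)
      show ?thesis unfolding 1 2 unfolding Ny by (simp add: field_simps)
    qed
    finally show "(\<Sum>m\<in>{1..N div d}. chi d * (real N - real d * real m)) =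
       (real N ^ 2 / 2) * (chi d / real d) - (real N / 2) * chi d + chi d * phi d" .
  qed
  also have "\<dots> = (real N ^ 2 / 2) * Lsum N - (real N / 2) * (\<Sum>d\<in>{1..N}. chi d) + (\<Sum>d\<in>{1..N}. chi d * phi d)"
    by (simp only: sum.distrib sum_subtractf sum_distrib_left Lsum_def)
  also have "\<dots> \<le> real N * real q + real N / 2 * real q + real q * (real N * (2 + ln (real N)))"
  proof -
    have S: "{0<..n} = {1..n}" for n :: nat by auto
    have C: "\<bar>\<Sum>d\<in>{1..n}. chi d\<bar> \<le> real q" for n
    proof -
      have "{..<Suc n} = insert 0 {1..n}" by auto
      then show ?thesis using chi_partial[of "Suc n"] by (simp add: chi_0)
    qed
    have "\<bar>Lsum N\<bar> \<le> 2 * real q / real (Suc N)" using L1_tail[of N] L by simp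
    also have "\<dots> \<le> 2 * real q / real N" using N by (intro divide_left_mono) auto
    finally have "(real N ^ 2 / 2) * Lsum N \<le> (real N ^ 2 / 2) * (2 * real q / real N)"
      by (intro mult_left_mono) auto
    then have 1: "(real N ^ 2 / 2) * Lsum N \<le> real N * real q" using N by (simp add: power2_eq_square)
    have "- (real N / 2) * (\<Sum>d\<in>{1..N}. chi d) \<le> \<bar>- (real N / 2) * (\<Sum>d\<in>{1..N}. chi d)\<bar>" by (rule abs_ge_self)
    also have "\<dots> \<le> real N / 2 * real q" unfolding abs_mult using C[of N] by (intro mult_mono) auto
    finally have 2: "- (real N / 2) * (\<Sum>d\<in>{1..N}. chi d) \<le> real N / 2 * real q" .
    \<comment> \<open>Consecutive arguments of \<open>osc\<close> differ by N / (d (d + 1)), so the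
      Lipschitz bound leads to a harmonic sum, the source of the logarithm.\<close>
    have dphi: "\<bar>phi d - phi (Suc d)\<bar> \<le> real N / 2 * (1 / real (Suc d)) + 1 / 8" if d: "d \<ge> 1" for d
    proof -
      define y y' where "y = real N / real d" and "y' = real N / real (Suc d)"
      have yy: "y' \<le> y" unfolding y_def y'_def using d by (intro divide_left_mono) auto
      have "phi d - phi (Suc d) = real d * (osc y - osc y') - osc y'" by (simp add: phi_def y_def y'_def algebra_simps)
      then have "\<bar>phi d - phi (Suc d)\<bar> \<le> real d * \<bar>osc y - osc y'\<bar> + osc y'"
        using osc_bounds(1)[of y'] abs_triangle_ineq4[of "real d * (osc y - osc y')" "osc y'"] by (simp add: abs_mult)
      also have "\<dots> \<le> real d * ((y - y') / 2) + 1 / 8"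
        using osc_lipschitz[OF yy] osc_bounds(2)[of y'] by (intro add_mono mult_left_mono) auto
      also have "real d * ((y - y') / 2) = real N / 2 * (1 / real (Suc d))"
      proof -
        have "y - y' = real N / (real d * real (Suc d))" using d by (simp add: y_def y'_def divide_simps) (simp add: algebra_simps)
        then show ?thesis using d by simp
      qed
      finally show ?thesis .
    qed
    have "\<bar>\<Sum>d\<in>{0<..N}. chi d * phi d\<bar> \<le> real q * (\<bar>phi N\<bar> + (\<Sum>d\<in>{0<..<N}. \<bar>phi d - phi (Suc d)\<bar>))"
    proof (rule abel_bound)
      show "\<bar>\<Sum>k\<in>{0<..n}. chi k\<bar> \<le> real q" for n unfolding S by (rule C)
    qed (use N in simp)
    also have "\<dots> \<le> real q * (real N / 8 + (\<Sum>d\<in>{0<..<N}. real N / 2 * (1 / real (Suc d)) + 1 / 8))"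
      using dphi osc_bounds[of "real N / real N"]
      by (intro mult_left_mono add_mono sum_mono) (auto simp: phi_def abs_mult)
    also have "(\<Sum>d\<in>{0<..<N}. real N / 2 * (1 / real (Suc d)) + 1 / 8) \<le> real N / 2 * ln (real N) + real N / 8"
    proof -
      have h: "(\<Sum>d\<in>{0<..<n}. 1 / real (Suc d)) \<le> ln (real n)" if "n \<ge> 1" for n
        using that
      proof (induction n rule: dec_induct)
        case base
        then show ?case by simp
      next
        case (step n)
        have "{0<..<Suc n} = insert n {0<..<n}" using step by auto
        moreover have "1 / real (Suc n) \<le> ln (real (Suc n)) - ln (real n)"
        proof -
          have "ln (real n / real (Suc n)) \<le> real n / real (Suc n) - 1" using step by (intro ln_le_minus_one) auto
          moreover have "real n / real (Suc n) - 1 = - 1 / real (Suc n)" by (simp add: field_simps)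
          ultimately show ?thesis using step by (simp add: ln_div)
        qed
        ultimately show ?case using step by simp
      qed
      have "(\<Sum>d\<in>{0<..<N}. real N / 2 * (1 / real (Suc d)) + 1 / 8)
         = real N / 2 * (\<Sum>d\<in>{0<..<N}. 1 / real (Suc d)) + real (N - 1) / 8"
        by (simp only: sum.distrib sum_distrib_left[symmetric]) simp
      also have "\<dots> \<le> real N / 2 * ln (real N) + real N / 8" using h[OF N] by (intro add_mono mult_left_mono) auto
      finally show ?thesis .
    qed
    also have "real N / 8 + (real N / 2 * ln (real N) + real N / 8) \<le> real N * (2 + ln (real N))"
    proof -
      have "0 \<le> real N * ln (real N)" using N by simp
      then show ?thesis by (simp add: algebra_simps)
    qed
    finally have "\<bar>\<Sum>d\<in>{0<..N}. chi d * phi d\<bar> \<le> real q * (real N * (2 + ln (real N)))"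
      by (simp add: mult_left_mono)
    then have 3: "(\<Sum>d\<in>{1..N}. chi d * phi d) \<le> real q * (real N * (2 + ln (real N)))" unfolding S by linarith
    show ?thesis using 1 2 3 by linarith
  qed
  also have "\<dots> \<le> real N * (real q * (4 + ln (real N)))" by (simp add: algebra_simps)
  finally show ?thesis .
qed

text \<open>The weighted sum of the nonnegative function rdiv grows at least like N to the power 3/2 because of
  the squares, whereas it would be of order N log N if the L-value vanished.\<close>
theorem L1_nonzero: "L1 \<noteq> 0"
proof
  assume L: "L1 = 0"
  have bnd: "real M \<le> 2 * (real q * (4 + ln (2 * real M ^ 2)))" if M: "M \<ge> 1" for M :: nat
  proof -
    \<comment> \<open>The factor 2 leaves each square up to M^2 a weight of at least M^2, so the
      squares contribute M^3 in total.\<close>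
    define N where "N = 2 * M ^ 2"
    have N: "N \<ge> 1" using M by (simp add: N_def)
    have inj: "inj_on (\<lambda>m. m ^ 2) {1..M}" by (auto intro!: inj_onI)
    have sub: "(\<lambda>m. m ^ 2) ` {1..M} \<subseteq> {1..N}"
    proof
      fix x assume "x \<in> (\<lambda>m. m ^ 2) ` {1..M}"
      then obtain m where m: "x = m ^ 2" "1 \<le> m" "m \<le> M" by auto
      then have "m ^ 2 \<le> M ^ 2" by (intro power_mono) auto
      then have "x \<le> N" unfolding N_def m(1) by linarith
      then show "x \<in> {1..N}" using m by simp
    qed
    have "real M * real M ^ 2 = (\<Sum>m\<in>{1..M}. 1 * real M ^ 2)" by simp
    also have "\<dots> \<le> (\<Sum>m\<in>{1..M}. rdiv (m ^ 2) * (real N - real (m ^ 2)))"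
    proof (intro sum_mono mult_mono)
      fix m assume m: "m \<in> {1..M}"
      then show "1 \<le> rdiv (m ^ 2)" using rdiv_nonneg_and_square[of m] by simp
      have "real m ^ 2 \<le> real M ^ 2" using m by (intro power_mono) auto
      then show "real M ^ 2 \<le> real N - real (m ^ 2)" by (simp add: N_def)
    qed (use rdiv_nonneg_and_square in \<open>auto intro: order_trans[of 0 1]\<close>)
    also have "\<dots> = (\<Sum>n\<in>(\<lambda>m. m ^ 2) ` {1..M}. rdiv n * (real N - real n))"
      by (subst sum.reindex[OF inj]) simp
    also have "\<dots> \<le> (\<Sum>n\<in>{1..N}. rdiv n * (real N - real n))"
      using sub rdiv_nonneg_and_square by (intro sum_mono2) auto
    also have "\<dots> \<le> real N * (real q * (4 + ln (real N)))" by (rule rdiv_sum_upper[OF L N])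
    also have "\<dots> = real M ^ 2 * (2 * (real q * (4 + ln (2 * real M ^ 2))))" by (simp add: N_def)
    finally have "real M ^ 2 * real M \<le> real M ^ 2 * (2 * (real q * (4 + ln (2 * real M ^ 2))))" by (simp add: mult.commute)
    then show ?thesis using M by simp
  qed
  have "filterlim (\<lambda>M. real M - 2 * (real q * (4 + ln (2 * real M ^ 2)))) at_top sequentially"
    by real_asymp
  from this[unfolded filterlim_at_top_dense, rule_format, of 0]
  have "\<forall>\<^sub>F M in sequentially. False"
    using eventually_ge_at_top[of 1]
    by eventually_elim (use bnd in \<open>fastforce dest: leD\<close>)
  then show False by simp
qed

end

section \<open>Mertens-type estimates\<close>

abbreviation Lam :: "nat \<Rightarrow> real" where "Lam \<equiv> mangoldt"

definition psi :: "nat \<Rightarrow> real" where "psi N = (\<Sum>n\<in>{1..N}. Lam n)"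

lemma Lam_floor_sum: "(\<Sum>d\<in>{1..N}. Lam d * real (N div d)) = ln (fact N)"
proof -
  have "(\<Sum>d\<in>{1..N}. Lam d * real (N div d)) = (\<Sum>d\<in>{1..N}. \<Sum>m\<in>{1..N div d}. Lam d)" by (simp add: mult.commute)
  also have "\<dots> = (\<Sum>n\<in>{1..N}. \<Sum>d | d dvd n. Lam d)" by (rule sum_divisors_swap[symmetric])
  also have "\<dots> = (\<Sum>n\<in>{1..N}. ln (real n))" by (intro sum.cong refl) (subst mangoldt_sum, auto)
  also have "\<dots> = ln (fact N)"
    by (induction N) (auto simp: ln_mult simp del: of_nat_Suc)
  finally show ?thesis .
qed

text \<open>Chebyshev: floor(2 M / d) - 2 floor(M / d) is nonnegative, and at least 1 for M < d <= 2
  M, so the difference is at most the logarithm of the central binomial coefficient.\<close>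

lemma psi_double: "psi (2 * M) - psi M \<le> 2 * real M * ln 2"
proof -
  have "psi (2 * M) - psi M = (\<Sum>d\<in>{1..2 * M}. Lam d * (if d > M then 1 else 0))"
  proof -
    have "{1..2 * M} = {1..M} \<union> {M<..2 * M}" "{1..M} \<inter> {M<..2 * M} = {}" by auto
    then have "psi (2 * M) = psi M + (\<Sum>d\<in>{M<..2 * M}. Lam d)" unfolding psi_def
      by (simp only: sum.union_disjoint finite_atLeastAtMost finite_greaterThanAtMost)
    also have "(\<Sum>d\<in>{M<..2 * M}. Lam d) = (\<Sum>d\<in>{1..2 * M}. Lam d * (if d > M then 1 else 0))"
      by (rule sum.mono_neutral_cong_left) auto
    finally show ?thesis by simp
  qed
  also have "\<dots> \<le> (\<Sum>d\<in>{1..2 * M}. Lam d * (real (2 * M div d) - 2 * real (M div d)))"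
  proof (intro sum_mono mult_left_mono mangoldt_nonneg)
    fix d assume d: "d \<in> {1..2 * M}"
    have "2 * (M div d) * d \<le> 2 * M" by simp
    then have "2 * (M div d) \<le> 2 * M div d" using d by (subst less_eq_div_iff_mult_less_eq) auto
    then have 1: "2 * real (M div d) \<le> real (2 * M div d)" by (metis of_nat_le_iff of_nat_mult of_nat_numeral)
    show "(if d > M then 1 else 0) \<le> real (2 * M div d) - 2 * real (M div d)"
    proof (cases "d > M")
      case True
      have "2 * M div d > 0" using d by (simp add: div_greater_zero_iff)
      then have "real (2 * M div d) \<ge> 1" by linarith
      then show ?thesis using True by simp
    next
      case False
      then show ?thesis using 1 by simp
    qed
  qed
  also have "\<dots> = (\<Sum>d\<in>{1..2 * M}. Lam d * real (2 * M div d)) - 2 * (\<Sum>d\<in>{1..2 * M}. Lam d * real (M div d))"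
    by (simp add: algebra_simps sum_subtractf sum_distrib_left)
  also have "(\<Sum>d\<in>{1..2 * M}. Lam d * real (M div d)) = (\<Sum>d\<in>{1..M}. Lam d * real (M div d))"
    by (rule sum.mono_neutral_right) auto
  also have "(\<Sum>d\<in>{1..2 * M}. Lam d * real (2 * M div d)) - 2 * (\<Sum>d\<in>{1..M}. Lam d * real (M div d)) = ln (fact (2 * M)) - 2 * ln (fact M)"
    by (simp only: Lam_floor_sum)
  also have "\<dots> = ln (real ((2 * M) choose M))"
  proof -
    have e: "2 * M - M = M" by simp
    have "real ((2 * M) choose M) = fact (2 * M) / (fact M * fact M)"
      using binomial_fact[of M "2 * M", where 'a = real] by (simp only: e)
    also have "ln \<dots> = ln (fact (2 * M)) - ln (fact M * fact M)" by (simp add: ln_div)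
    also have "ln (fact M * fact M :: real) = ln (fact M) + ln (fact M)" by (simp add: ln_mult)
    finally show ?thesis by simp
  qed
  also have "\<dots> \<le> ln (2 ^ (2 * M))"
  proof -
    have "(2 * M) choose M \<le> 2 ^ (2 * M)"
      using member_le_sum[of M "{..2 * M}" "\<lambda>k. (2 * M) choose k"] choose_row_sum[of "2 * M"] by simp
    then have "real ((2 * M) choose M) \<le> 2 ^ (2 * M)" by (metis of_nat_le_iff of_nat_numeral of_nat_power)
    then show ?thesis by simp
  qed
  also have "\<dots> = 2 * real M * ln 2" by (simp add: ln_realpow)
  finally show ?thesis .
qed

lemma psi_mono: "M \<le> N \<Longrightarrow> psi M \<le> psi N"
  unfolding psi_def by (intro sum_mono2) (auto simp: mangoldt_nonneg)

text \<open>Induction by halving: psi(2 M) <= 6 M + 2 M = 8 M, and 2 M <= N + 1 with N >= 2 gives 4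
  (N + 1) <= 6 N.\<close>

lemma psi_upper: "psi N \<le> 6 * real N"
proof (induction N rule: less_induct)
  case (less N)
  show ?case
  proof (cases "N \<le> 1")
    case True
    then have "N = 0 \<or> N = 1" by auto
    then show ?thesis by (auto simp: psi_def)
  next
    case False
    define M where "M = (N + 1) div 2"
    have M: "M < N" "N \<le> 2 * M" "2 * M \<le> N + 1" using False by (auto simp: M_def)
    have "psi (2 * M) - psi M \<le> 2 * real M * ln 2" by (rule psi_double)
    also have "\<dots> \<le> 2 * real M * 1" using ln_2_less_1 by (intro mult_left_mono) auto
    finally have "psi (2 * M) \<le> 8 * real M" using less.IH[OF M(1)] by simp
    moreover have "2 * real M \<le> real N + 1" "real N \<ge> 2" using M(3) False by linarith+
    ultimately show ?thesis using psi_mono[OF M(2)] by linarith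
  qed
qed

lemma ln_fact_bounds:
  assumes "N \<ge> 1"
  shows "real N * ln (real N) - real N \<le> ln (fact N)" "ln (fact N) \<le> real N * ln (real N)"
proof -
  show "ln (fact N) \<le> real N * ln (real N)"
  proof -
    have "(fact N :: real) \<le> real N ^ N" by (metis fact_le_power of_nat_fact of_nat_mono of_nat_power le_refl)
    then have "ln (fact N) \<le> ln (real N ^ N)" by (subst ln_le_cancel_iff) (use assms in auto)
    then show ?thesis using assms by (simp add: ln_realpow)
  qed
  have "n \<ge> 1 \<Longrightarrow> real n * ln (real n) - real n \<le> ln (fact n)" for n
  proof (induction n rule: dec_induct)
    case (step n)
    have "ln (real (Suc n) / real n) \<le> real (Suc n) / real n - 1" using step by (intro ln_le_minus_one) auto
    then have "ln (real (Suc n)) - ln (real n) \<le> 1 / real n" using step by (simp add: ln_div field_simps)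
    then have "real n * (ln (real (Suc n)) - ln (real n)) \<le> real n * (1 / real n)" by (intro mult_left_mono) auto
    then have 1: "real n * ln (real (Suc n)) - real n * ln (real n) \<le> 1" using step by (simp add: algebra_simps)
    have "real (Suc n) * ln (real (Suc n)) = real n * ln (real (Suc n)) + ln (real (Suc n))" by (simp add: algebra_simps)
    moreover have "ln (fact (Suc n) :: real) = ln (real (Suc n)) + ln (fact n)" by (simp add: ln_mult del: of_nat_Suc)
    ultimately show ?case using 1 step.IH by (simp del: of_nat_Suc fact_Suc)
  qed simp
  then show "real N * ln (real N) - real N \<le> ln (fact N)" using assms by simp
qed

text \<open>Comparison with log N! through \<open>Lam_floor_sum\<close>. Dropping the floors costs
  at most \<open>psi N\<close> <= 6 N, whence the constant 6.\<close>

lemma mertens_mangoldt: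
  assumes N: "N \<ge> 1"
  shows "\<bar>(\<Sum>d\<in>{1..N}. Lam d / real d) - ln (real N)\<bar> \<le> 6"
proof -
  have fl: "real N / real d - 1 \<le> real (N div d)" "real (N div d) \<le> real N / real d" if "d \<in> {1..N}" for d
  proof -
    have "real (N div d) = of_int \<lfloor>real N / real d\<rfloor>" by (simp add: floor_divide_of_nat_eq)
    then show "real N / real d - 1 \<le> real (N div d)" "real (N div d) \<le> real N / real d" by linarith+
  qed
  have e: "real N * (\<Sum>d\<in>{1..N}. Lam d / real d) = (\<Sum>d\<in>{1..N}. Lam d * (real N / real d))"
    by (simp add: sum_distrib_left mult_ac)
  have "(\<Sum>d\<in>{1..N}. Lam d * (real N / real d)) - psi N = (\<Sum>d\<in>{1..N}. Lam d * (real N / real d - 1))"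
    by (simp add: psi_def sum_subtractf algebra_simps)
  also have "\<dots> \<le> (\<Sum>d\<in>{1..N}. Lam d * real (N div d))" by (intro sum_mono mult_left_mono mangoldt_nonneg fl)
  also have "\<dots> \<le> real N * ln (real N)" unfolding Lam_floor_sum by (rule ln_fact_bounds[OF N])
  finally have 1: "real N * (\<Sum>d\<in>{1..N}. Lam d / real d) \<le> real N * (ln (real N) + 6)"
    using psi_upper[of N] unfolding e by (simp add: algebra_simps)
  have "real N * ln (real N) - real N \<le> (\<Sum>d\<in>{1..N}. Lam d * real (N div d))"
    unfolding Lam_floor_sum by (rule ln_fact_bounds[OF N])
  also have "\<dots> \<le> (\<Sum>d\<in>{1..N}. Lam d * (real N / real d))" by (intro sum_mono mult_left_mono mangoldt_nonneg fl)
  finally have 2: "real N * (ln (real N) - 1) \<le> real N * (\<Sum>d\<in>{1..N}. Lam d / real d)" unfolding e by (simp add: algebra_simps)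
  show ?thesis using 1 2 N by (simp add: abs_le_iff)
qed

text \<open>Writing log as a divisor sum of \<open>Lam\<close> turns the bounded sum
  \<open>W\<close> into \<open>S\<close> with weights \<open>Lsum (N div d)\<close>. These equal L1
  up to O(d / N), so W = L1 S + O(1) by the Chebyshev bound, and \<open>L1_nonzero\<close> permits
  division by L1.\<close>

lemma (in real_char) mertens_char:
  obtains C where "\<And>N. \<bar>\<Sum>d\<in>{1..N}. chi d * Lam d / real d\<bar> \<le> C"
proof -
  define S where "S = (\<lambda>N. \<Sum>d\<in>{1..N}. chi d * Lam d / real d)"
  define W where "W = (\<lambda>N. \<Sum>n\<in>{1..N}. chi n * (ln (real n) / real n))"
  have W: "W N = (\<Sum>d\<in>{1..N}. chi d * Lam d / real d * Lsum (N div d))" for N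
  proof -
    have "W N = (\<Sum>n\<in>{1..N}. \<Sum>d | d dvd n. chi d * Lam d / real d * (chi (n div d) / real (n div d)))"
      unfolding W_def
    proof (intro sum.cong refl)
      fix n assume n: "n \<in> {1..N}"
      have "chi n * (ln (real n) / real n) = (\<Sum>d | d dvd n. chi n / real n * Lam d)"
        using n by (subst sum_distrib_left[symmetric], subst mangoldt_sum) auto
      also have "\<dots> = (\<Sum>d | d dvd n. chi d * Lam d / real d * (chi (n div d) / real (n div d)))"
      proof (intro sum.cong refl)
        fix d assume "d \<in> {d. d dvd n}"
        then have d: "n = d * (n div d)" by simp
        have "chi n = chi d * chi (n div d)" "real n = real d * real (n div d)"
          by (subst d, rule chi_mult) (subst d, simp only: of_nat_mult)
        then show "chi n / real n * Lam d = chi d * Lam d / real d * (chi (n div d) / real (n div d))" by simp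
      qed
      finally show "chi n * (ln (real n) / real n) = (\<Sum>d | d dvd n. chi d * Lam d / real d * (chi (n div d) / real (n div d)))" .
    qed
    also have "\<dots> = (\<Sum>d\<in>{1..N}. \<Sum>m\<in>{1..N div d}. chi d * Lam d / real d * (chi m / real m))"
      by (rule sum_divisors_swap)
    finally show ?thesis by (simp only: sum_distrib_left[symmetric] Lsum_def)
  qed
  have W_bound: "\<bar>W N\<bar> \<le> 3 + 2 * real q" for N
  proof -
    \<comment> \<open>log x / x decreases only beyond e, hence the split after 2.\<close>
    have a3: "ln (real (Suc k)) / real (Suc k) \<le> ln (real k) / real k" if "2 < k" for k
    proof -
      have "exp 1 \<le> (3 :: real)" by (rule exp_le)
      then show ?thesis using that by (intro ln_x_over_x_mono) auto
    qed
    have tail: "\<bar>\<Sum>k\<in>{2<..N}. chi k * (ln (real k) / real k)\<bar> \<le> 2 * real q * (ln (real (Suc 2)) / real (Suc 2))"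
      by (rule abel_bound_antimono[OF chi_interval]) (use a3 in auto)
    have "ln (3 :: real) / 3 \<le> 1" using ln_le_minus_one[of 3] by simp
    then have "2 * real q * (ln (real (Suc 2)) / real (Suc 2)) \<le> 2 * real q * 1" by (intro mult_left_mono) auto
    then have tail': "\<bar>\<Sum>k\<in>{2<..N}. chi k * (ln (real k) / real k)\<bar> \<le> 2 * real q" using tail by simp
    show ?thesis
    proof (cases "N \<ge> 2")
      case True
      have "{1..N} = {1, 2} \<union> {2<..N}" using True by auto
      moreover have "{1, 2} \<inter> {2<..N} = {}" by auto
      ultimately have "W N = chi 2 * (ln 2 / 2) + (\<Sum>k\<in>{2<..N}. chi k * (ln (real k) / real k))"
        unfolding W_def by (simp add: sum.union_disjoint)
      moreover have "\<bar>chi 2 * (ln 2 / 2)\<bar> \<le> 1 * 1" unfolding abs_mult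
        using chi_abs[of 2] ln_2_less_1 by (intro mult_mono) auto
      ultimately show ?thesis using tail' by linarith
    next
      case False
      then have "N = 0 \<or> N = 1" by auto
      then show ?thesis by (auto simp: W_def)
    qed
  qed
  have diff: "\<bar>W N - L1 * S N\<bar> \<le> 12 * real q" for N
  proof (cases "N = 0")
    case False
    have "W N - L1 * S N = (\<Sum>d\<in>{1..N}. chi d * Lam d / real d * (Lsum (N div d) - L1))"
      unfolding W S_def sum_distrib_left sum_subtractf[symmetric] by (intro sum.cong refl) (simp add: right_diff_distrib)
    also have "\<bar>\<dots>\<bar> \<le> (\<Sum>d\<in>{1..N}. \<bar>chi d * Lam d / real d * (Lsum (N div d) - L1)\<bar>)" by (rule sum_abs)
    also have "\<dots> \<le> (\<Sum>d\<in>{1..N}. Lam d * (2 * real q / real N))"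
    proof (intro sum_mono)
      fix d assume d: "d \<in> {1..N}"
      have "N < d * Suc (N div d)" using d by (metis atLeastAtMost_iff dividend_less_times_div less_eq_Suc_le One_nat_def mult_Suc_right)
      then have le: "real N \<le> real d * real (Suc (N div d))" by (metis of_nat_mult of_nat_le_iff less_imp_le)
      have "\<bar>Lsum (N div d) - L1\<bar> \<le> 2 * real q / real (Suc (N div d))" by (rule L1_tail)
      then have "\<bar>chi d\<bar> * (Lam d / real d) * \<bar>Lsum (N div d) - L1\<bar> \<le> 1 * (Lam d / real d) * (2 * real q / real (Suc (N div d)))"
        using chi_abs[of d] mangoldt_nonneg[of d] by (intro mult_mono) auto
      also have "\<dots> = Lam d * (2 * real q / (real d * real (Suc (N div d))))" by simp
      also have "\<dots> \<le> Lam d * (2 * real q / real N)"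
        using le False by (intro mult_left_mono divide_left_mono mangoldt_nonneg) auto
      finally show "\<bar>chi d * Lam d / real d * (Lsum (N div d) - L1)\<bar> \<le> Lam d * (2 * real q / real N)"
        by (simp add: abs_mult)
    qed
    also have "\<dots> = psi N * (2 * real q / real N)" by (simp only: psi_def sum_distrib_right)
    also have "\<dots> \<le> 6 * real N * (2 * real q / real N)" by (intro mult_right_mono psi_upper) auto
    also have "\<dots> = 12 * real q" using False by simp
    finally show ?thesis .
  qed (simp add: W_def S_def)
  have "\<bar>S N\<bar> \<le> (3 + 14 * real q) / \<bar>L1\<bar>" for N
  proof -
    have "\<bar>L1\<bar> * \<bar>S N\<bar> \<le> 3 + 14 * real q" unfolding abs_mult[symmetric] using W_bound[of N] diff[of N] by linarith
    then show ?thesis using L1_nonzero by (simp add: field_simps)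
  qed
  then show ?thesis using that unfolding S_def by blast
qed

text \<open>For a = sqrt n and b = sqrt (n - 1) this dominates n^(-3/2) by a telescoping
  difference.\<close>

lemma inverse_sqrt_diff:
  fixes a b :: real
  assumes "0 < b" "b \<le> a" "(a - b) * (a + b) = 1"
  shows "1 / (2 * a ^ 3) \<le> 1 / b - 1 / a"
proof -
  have "1 / b - 1 / a = (a - b) / (a * b)" using assms by (simp add: field_simps)
  also have "\<dots> = ((a - b) * (a + b)) / ((a + b) * (a * b))" using assms(1,2) by simp
  also have "\<dots> = 1 / ((a + b) * (a * b))" by (simp only: assms(3))
  also have "\<dots> \<ge> 1 / ((2 * a) * (a * a))"
    using assms by (intro divide_left_mono mult_mono) auto
  finally show ?thesis by (simp add: power3_eq_cube mult_ac)
qed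

text \<open>The exponents k >= 2 contribute, even over all n >= 2 in place of primes, at most the
  sum of 2 ln n / n^2 <= 4 n^(-3/2), which telescopes.\<close>

lemma prime_power_tail_bound:
  assumes f: "\<And>n. \<bar>f n\<bar> \<le> (1 :: real)"
  shows "\<bar>(\<Sum>d\<in>{1..N}. f d * Lam d / real d) - (\<Sum>p | prime p \<and> p \<le> N. f p * ln (real p) / real p)\<bar> \<le> 16"
proof -
  define P where "P = {p. prime p \<and> p \<le> N}"
  have finP: "finite P" by (auto simp: P_def)
  define T where "T = {1..N} - P"
  have sub: "P \<subseteq> {1..N}" by (auto simp: P_def prime_gt_0_nat Suc_le_eq)
  have "(\<Sum>d\<in>{1..N}. f d * Lam d / real d) = (\<Sum>d\<in>T. f d * Lam d / real d) + (\<Sum>d\<in>P. f d * Lam d / real d)"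
    unfolding T_def using sub by (simp add: sum.subset_diff)
  moreover have "(\<Sum>d\<in>P. f d * Lam d / real d) = (\<Sum>p | prime p \<and> p \<le> N. f p * ln (real p) / real p)"
    unfolding P_def by (intro sum.cong) auto
  moreover have "\<bar>\<Sum>d\<in>T. f d * Lam d / real d\<bar> \<le> 16"
  proof -
    have "\<bar>\<Sum>d\<in>T. f d * Lam d / real d\<bar> \<le> (\<Sum>d\<in>T. \<bar>f d * Lam d / real d\<bar>)" by (rule sum_abs)
    also have "\<dots> \<le> (\<Sum>d\<in>T. Lam d / real d)"
    proof (intro sum_mono)
      fix d
      have "\<bar>f d\<bar> * (Lam d / real d) \<le> 1 * (Lam d / real d)" using f mangoldt_nonneg by (intro mult_right_mono) auto
      then show "\<bar>f d * Lam d / real d\<bar> \<le> Lam d / real d" by (simp add: abs_mult)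
    qed
    also have "\<dots> \<le> (\<Sum>(n, k)\<in>{2..N} \<times> {2..N}. ln (real n) / real n ^ k)"
    proof -
      define T' where "T' = {d \<in> T. primepow d}"
      have "(\<Sum>d\<in>T. Lam d / real d) = (\<Sum>d\<in>T'. Lam d / real d)"
        by (rule sum.mono_neutral_right) (auto simp: T'_def T_def mangoldt_def)
      also have "\<dots> \<le> (\<Sum>(n, k)\<in>{2..N} \<times> {2..N}. ln (real n) / real n ^ k)"
      proof (rule sum_le_included[where i = "\<lambda>(n, k). n ^ k"])
        show "\<forall>y\<in>{2..N} \<times> {2..N}. 0 \<le> (case y of (n, k) \<Rightarrow> ln (real n) / real n ^ k)" by auto
        show "\<forall>x\<in>T'. \<exists>y\<in>{2..N} \<times> {2..N}. (case y of (n, k) \<Rightarrow> n ^ k) = x \<and> Lam x / real x \<le> (case y of (n, k) \<Rightarrow> ln (real n) / real n ^ k)"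
        proof
          fix x assume x: "x \<in> T'"
          then obtain p k where pk: "prime p" "k > 0" "x = p ^ k" by (auto simp: T'_def primepow_def)
          have "k \<noteq> 1" using x pk by (auto simp: T'_def T_def P_def)
          then have k: "k \<ge> 2" using pk by simp
          have p: "p \<ge> 2" using pk prime_ge_2_nat by blast
          have "x \<le> N" using x by (auto simp: T'_def T_def)
          moreover have "p \<le> p ^ k" using pk p by (intro self_le_power) auto
          moreover have "k < p ^ k" using p by (metis less_exp order_less_le_trans power_mono zero_le)
          ultimately have "(p, k) \<in> {2..N} \<times> {2..N}" using p k pk(3) by auto
          moreover have "Lam x / real x = ln (real p) / real p ^ k" using pk by (simp add: mangoldt_primepow)
          ultimately show "\<exists>y\<in>{2..N} \<times> {2..N}. (case y of (n, k) \<Rightarrow> n ^ k) = x \<and> Lam x / real x \<le> (case y of (n, k) \<Rightarrow> ln (real n) / real n ^ k)"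
            using pk(3) by (intro bexI[of _ "(p, k)"]) auto
        qed
      qed (auto simp: T'_def T_def)
      finally show ?thesis .
    qed
    also have "\<dots> = (\<Sum>n\<in>{2..N}. \<Sum>k\<in>{2..N}. ln (real n) / real n ^ k)" by (rule sum.cartesian_product[symmetric])
    also have "\<dots> \<le> (\<Sum>n\<in>{2..N}. 8 * (1 / sqrt (real (n - 1)) - 1 / sqrt (real n)))"
    proof (intro sum_mono)
      fix n assume n: "n \<in> {2..N}"
      define x where "x = 1 / real n"
      have x: "0 < x" "x \<le> 1 / 2" using n by (auto simp: x_def field_simps)
      have g: "(\<Sum>k\<in>{2..m}. x ^ k) \<le> 2 * x ^ 2 - 2 * x ^ Suc m" if "m \<ge> 1" for m
        using that
      proof (induction m rule: dec_induct)
        case base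
        show ?case by (simp add: power2_eq_square)
      next
        case (step m)
        have "x ^ Suc m * (2 * x) \<le> x ^ Suc m * 1" using x by (intro mult_left_mono) auto
        then have "2 * x ^ Suc (Suc m) \<le> x ^ Suc m" by (simp add: mult_ac)
        moreover have "{2..Suc m} = insert (Suc m) {2..m}" using step by auto
        ultimately show ?case using step.IH by simp
      qed
      have "(\<Sum>k\<in>{2..N}. ln (real n) / real n ^ k) = ln (real n) * (\<Sum>k\<in>{2..N}. x ^ k)"
        by (simp add: sum_distrib_left x_def power_one_over)
      also have "\<dots> \<le> ln (real n) * (2 * x ^ 2)"
      proof -
        have "N \<ge> 1" using n by simp
        from g[OF this] x(1) have "(\<Sum>k\<in>{2..N}. x ^ k) \<le> 2 * x ^ 2" by (smt (verit) zero_less_power)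
        then show ?thesis using n by (intro mult_left_mono) auto
      qed
      also have "\<dots> \<le> (2 * sqrt (real n)) * (2 * x ^ 2)"
      proof -
        have "ln (sqrt (real n)) \<le> sqrt (real n) - 1" using n by (intro ln_le_minus_one) auto
        then have "ln (real n) \<le> 2 * sqrt (real n)" using n by (simp add: ln_sqrt)
        then show ?thesis by (intro mult_right_mono) auto
      qed
      also have "\<dots> \<le> 8 * (1 / sqrt (real (n - 1)) - 1 / sqrt (real n))"
      proof -
        define a b where "a = sqrt (real n)" and "b = sqrt (real (n - 1))"
        have aa: "a ^ 2 = real n" "b ^ 2 = real n - 1" and ab: "b > 0" "b \<le> a" using n
          by (auto simp: a_def b_def of_nat_diff)
        have "(a - b) * (a + b) = a ^ 2 - b ^ 2" by (simp add: power2_eq_square algebra_simps)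
        then have 1: "1 / (2 * a ^ 3) \<le> 1 / b - 1 / a" using ab aa by (intro inverse_sqrt_diff) auto
        have "x ^ 2 = 1 / a ^ 4" unfolding x_def aa(1)[symmetric] by (simp add: power_divide flip: power_mult)
        then have "(2 * a) * (2 * x ^ 2) = 8 * (1 / (2 * a ^ 3))" using ab by (simp add: field_simps eval_nat_numeral)
        also have "\<dots> \<le> 8 * (1 / b - 1 / a)" using 1 by (intro mult_left_mono) auto
        finally show ?thesis by (simp only: a_def b_def)
      qed
      finally show "(\<Sum>k\<in>{2..N}. ln (real n) / real n ^ k) \<le> 8 * (1 / sqrt (real (n - 1)) - 1 / sqrt (real n))" .
    qed
    also have "\<dots> \<le> 8 * 1"
    proof -
      have "m \<ge> 1 \<Longrightarrow> (\<Sum>n\<in>{2..m}. 1 / sqrt (real (n - 1)) - 1 / sqrt (real n)) = 1 - 1 / sqrt (real m)" for m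
      proof (induction m rule: dec_induct)
        case (step m)
        have "{2..Suc m} = insert (Suc m) {2..m}" using step by auto
        then show ?case using step.IH by simp
      qed simp
      then have "(\<Sum>n\<in>{2..N}. 1 / sqrt (real (n - 1)) - 1 / sqrt (real n)) \<le> 1"
        by (cases "N \<ge> 1") auto
      then show ?thesis unfolding sum_distrib_left[symmetric] by (rule mult_left_mono) simp
    qed
    finally show ?thesis by simp
  qed
  ultimately show ?thesis by simp
qed

section \<open>Counting products of primes from a set of positive density\<close>

locale dense_primes =
  fixes Q :: "nat set" and C :: real
  assumes Q_prime: "p \<in> Q \<Longrightarrow> prime p"
    and mertens_Q: "y \<ge> 1 \<Longrightarrow> \<bar>(\<Sum>p | p \<in> Q \<and> real p \<le> y. ln (real p) / real p) - ln y / 4\<bar> \<le> C"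
begin

definition products :: "nat set" where
  "products = {n. n > 0 \<and> squarefree n \<and> (\<forall>p. prime p \<longrightarrow> p dvd n \<longrightarrow> p \<in> Q)}"

definition recip_sum :: "real \<Rightarrow> real" where
  "recip_sum z = (\<Sum>m | m \<in> products \<and> real m \<le> z. 1 / real m)"

lemma C_nonneg: "C \<ge> 0" using mertens_Q[of 1] by linarith

lemma finite_real_le: "finite {n :: nat. P n \<and> real n \<le> z}"
proof (rule finite_subset)
  show "{n :: nat. P n \<and> real n \<le> z} \<subseteq> {..nat \<lfloor>z\<rfloor>}" by (auto simp: le_nat_floor)
qed simp

lemma products_mult:
  assumes m: "m \<in> products" and p: "p \<in> Q" "m < p"
  shows "m * p \<in> products"
proof -
  have pp: "prime p" by (rule Q_prime[OF p(1)])
  have m0: "m > 0" using m by (simp add: products_def)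
  have "\<not> p dvd m" using p(2) m0 by (auto dest: dvd_imp_le)
  then have "coprime m p" using pp by (metis coprime_commute prime_imp_coprime)
  then have "squarefree (m * p)" using m pp by (intro squarefree_mult_coprime) (auto simp: products_def squarefree_prime)
  moreover have "l \<in> Q" if "prime l" "l dvd m * p" for l
  proof (cases "l dvd m")
    case False
    then have "l dvd p" using that by (simp add: prime_dvd_mult_iff)
    then have "l = p" using that(1) pp primes_dvd_imp_eq by blast
    then show ?thesis using p by simp
  qed (use that m in \<open>auto simp: products_def\<close>)
  ultimately show ?thesis using m0 pp by (auto simp: products_def prime_gt_0_nat)
qed

text \<open>Each prime exceeds both cofactors, so p cannot divide m' and must equal p'.\<close>

lemma product_inj:
  assumes "m > 0" "m < p" "m' > 0" "m' < p'" "m < p'" "m' < p" "prime p" "prime p'" "m * p = m' * (p' :: nat)"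
  shows "p = p' \<and> m = m'"
proof -
  have "p dvd m' * p'" using assms(9) by (metis dvd_triv_right)
  moreover have "\<not> p dvd m'" using assms by (auto dest: dvd_imp_le)
  ultimately have "p dvd p'" using assms by (simp add: prime_dvd_mult_iff)
  then have "p = p'" using assms primes_dvd_imp_eq by blast
  then show ?thesis using assms by auto
qed

lemma mertens_interval:
  assumes "1 \<le> x" "x \<le> y"
  shows "(\<Sum>p | p \<in> Q \<and> x < real p \<and> real p \<le> y. ln (real p) / real p) \<ge> (ln y - ln x) / 4 - 2 * C"
proof -
  have "{p. p \<in> Q \<and> real p \<le> y} = {p. p \<in> Q \<and> real p \<le> x} \<union> {p. p \<in> Q \<and> x < real p \<and> real p \<le> y}"
    using assms by auto
  moreover have "{p. p \<in> Q \<and> real p \<le> x} \<inter> {p. p \<in> Q \<and> x < real p \<and> real p \<le> y} = {}" by auto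
  moreover have "finite {p. p \<in> Q \<and> real p \<le> x}" "finite {p. p \<in> Q \<and> x < real p \<and> real p \<le> y}"
    using finite_real_le[of "\<lambda>p. p \<in> Q" x] finite_real_le[of "\<lambda>p. p \<in> Q \<and> x < real p" y] by (auto simp: conj_assoc)
  ultimately have "(\<Sum>p | p \<in> Q \<and> real p \<le> y. ln (real p) / real p)
     = (\<Sum>p | p \<in> Q \<and> real p \<le> x. ln (real p) / real p) + (\<Sum>p | p \<in> Q \<and> x < real p \<and> real p \<le> y. ln (real p) / real p)"
    by (simp only: sum.union_disjoint)
  then show ?thesis using mertens_Q[of x] mertens_Q[of y] assms unfolding diff_divide_distrib by linarith
qed

text \<open>Besides the m up to z, the sum up to z^6 contains all products m p with z < p \<open>\<le>\<close> z^5.\<close>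
lemma recip_sum_step:
  assumes z: "z > 1" "ln z \<ge> 4 * C"
  shows "recip_sum (z ^ 6) \<ge> 11 / 10 * recip_sum z"
proof -
  define A where "A = {m. m \<in> products \<and> real m \<le> z}"
  define B where "B = {p. p \<in> Q \<and> z < real p \<and> real p \<le> z ^ 5}"
  have finA: "finite A" unfolding A_def by (rule finite_real_le)
  have finB: "finite B" unfolding B_def using finite_real_le[of "\<lambda>p. p \<in> Q \<and> z < real p" "z ^ 5"] by (auto simp: conj_assoc)
  have z5: "z \<le> z ^ 5" "z \<le> z ^ 6" using power_increasing[of 1 5 z] power_increasing[of 1 6 z] z by auto
  have lz: "ln z > 0" using z by simp
  \<comment> \<open>The exponent 5 makes (5 - 1) / 4 = 1. By ln z >= 4 C, at least half of ln z
    remains, and ln p <= 5 ln z turns this into a reciprocal sum of at least 1/10.\<close>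
  have "ln z - 2 * C = (ln (z ^ 5) - ln z) / 4 - 2 * C" using z by (simp add: ln_realpow)
  also have "\<dots> \<le> (\<Sum>p\<in>B. ln (real p) / real p)" unfolding B_def using z z5 by (intro mertens_interval) auto
  also have "\<dots> \<le> (\<Sum>p\<in>B. 5 * ln z * (1 / real p))"
  proof (intro sum_mono)
    fix p assume p: "p \<in> B"
    then have "ln (real p) \<le> ln (z ^ 5)" using z by (subst ln_le_cancel_iff) (auto simp: B_def)
    then have "ln (real p) \<le> 5 * ln z" using z by (simp add: ln_realpow)
    then show "ln (real p) / real p \<le> 5 * ln z * (1 / real p)" by (simp add: divide_right_mono)
  qed
  also have "\<dots> = 5 * ln z * (\<Sum>p\<in>B. 1 / real p)" by (simp only: sum_distrib_left)
  finally have "5 * ln z * (\<Sum>p\<in>B. 1 / real p) \<ge> 5 * ln z * (1 / 10)" using z(2) by simp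
  then have sB: "(\<Sum>p\<in>B. 1 / real p) \<ge> 1 / 10" using lz by simp
  define f where "f = (\<lambda>(m, p). m * p :: nat)"
  have less: "m < p" if "m \<in> A" "p \<in> B" for m p using that by (auto simp: A_def B_def)
  have inj: "inj_on f (A \<times> B)"
  proof (rule inj_onI, clarify)
    fix m p m' p' assume h: "m \<in> A" "p \<in> B" "m' \<in> A" "p' \<in> B" "f (m, p) = f (m', p')"
    show "m = m' \<and> p = p'"
    proof -
      have "m > 0" "m' > 0" using h(1,3) unfolding A_def products_def by blast+
      moreover have "prime p" "prime p'" using h(2,4) Q_prime unfolding B_def by blast+
      moreover have "m < p" "m' < p'" "m < p'" "m' < p" using h less by blast+
      moreover have "m * p = m' * p'" using h(5) by (simp add: f_def)
      ultimately show ?thesis using product_inj[of m p m' p'] by blast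
    qed
  qed
  have img: "f ` (A \<times> B) \<subseteq> {m. m \<in> products \<and> z < real m \<and> real m \<le> z ^ 6}"
  proof (clarify, intro conjI)
    fix m p assume mp: "m \<in> A" "p \<in> B"
    have "m \<in> products" "p \<in> Q" using mp by (auto simp: A_def B_def)
    then have "m * p \<in> products" using products_mult less[OF mp] by blast
    then show "f (m, p) \<in> products" by (simp add: f_def)
    have "m \<ge> 1" using mp by (auto simp: A_def products_def)
    then have "1 * real p \<le> real m * real p" by (intro mult_right_mono) auto
    then show "z < real (f (m, p))" using mp by (simp add: f_def B_def)
    have "real m * real p \<le> z * z ^ 5" using mp z by (intro mult_mono) (auto simp: A_def B_def)
    then show "real (f (m, p)) \<le> z ^ 6" by (simp add: f_def eval_nat_numeral)
  qed
  have "11 / 10 * recip_sum z \<le> recip_sum z + recip_sum z * (\<Sum>p\<in>B. 1 / real p)"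
  proof -
    have "recip_sum z \<ge> 0" unfolding recip_sum_def by (intro sum_nonneg) auto
    then have "recip_sum z * (1 / 10) \<le> recip_sum z * (\<Sum>p\<in>B. 1 / real p)" using sB by (intro mult_left_mono)
    then show ?thesis by simp
  qed
  also have "recip_sum z * (\<Sum>p\<in>B. 1 / real p) = (\<Sum>n\<in>f ` (A \<times> B). 1 / real n)"
    unfolding recip_sum_def A_def[symmetric] sum_product sum.cartesian_product
    by (subst sum.reindex[OF inj]) (auto simp: f_def intro!: sum.cong)
  also have "recip_sum z + (\<Sum>n\<in>f ` (A \<times> B). 1 / real n) = (\<Sum>n\<in>A \<union> f ` (A \<times> B). 1 / real n)"
    unfolding recip_sum_def A_def[symmetric]
  proof (rule sum.union_disjoint[symmetric])
    show "A \<inter> f ` (A \<times> B) = {}"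
    proof (rule ccontr)
      assume "A \<inter> f ` (A \<times> B) \<noteq> {}"
      then obtain x where "x \<in> A" "x \<in> f ` (A \<times> B)" by blast
      then have "real x \<le> z" "z < real x" using img unfolding A_def by blast+
      then show False by simp
    qed
  qed (use finA finB in auto)
  also have "\<dots> \<le> recip_sum (z ^ 6)" unfolding recip_sum_def
    using img z5 by (intro sum_mono2 finite_real_le) (auto simp: A_def)
  finally show ?thesis .
qed

lemma one_in_products: "1 \<in> products"
  by (auto simp: products_def)

lemma recip_sum_mono: "x \<le> y \<Longrightarrow> recip_sum x \<le> recip_sum y"
  unfolding recip_sum_def by (intro sum_mono2 finite_real_le) auto

lemma recip_sum_iterate:
  assumes z: "z > 1" "ln z \<ge> 4 * C"
  shows "recip_sum (z ^ (6 ^ k)) \<ge> (11 / 10) ^ k"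
proof (induction k)
  case 0
  have "(\<Sum>m\<in>{1}. 1 / real m) \<le> recip_sum z" unfolding recip_sum_def
    using one_in_products z by (intro sum_mono2 finite_real_le) auto
  then show ?case by simp
next
  case (Suc k)
  define y where "y = z ^ (6 ^ k)"
  have "z \<le> y" unfolding y_def using z power_increasing[of 1 "6 ^ k" z] by simp
  then have "y > 1" "ln y \<ge> 4 * C" using z order_trans[OF z(2), of "ln y"] by auto
  then have "11 / 10 * recip_sum y \<le> recip_sum (y ^ 6)" by (rule recip_sum_step)
  moreover have "y ^ 6 = z ^ (6 ^ Suc k)" by (simp add: y_def power_mult[symmetric] mult.commute)
  ultimately show ?case using Suc by (simp add: y_def)
qed

text \<open>\<open>recip_sum\<close> gains a factor 11/10 whenever ln z is multiplied by 6, so it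
  grows at least like ln z to the power log_6(11/10).\<close>

definition kappa :: real where "kappa = ln (11 / 10) / ln 6"

lemma kappa: "0 < kappa" "kappa < 1"
  by (auto simp: kappa_def)

lemma recip_sum_lower:
  obtains c z0 where "c > 0" "z0 > 1" "\<And>z. z \<ge> z0 \<Longrightarrow> recip_sum z \<ge> c * ln z powr kappa"
proof -
  define z0 where "z0 = exp (4 * C + 1)"
  have z0: "z0 > 1" "ln z0 \<ge> 4 * C" "ln z0 > 0" using C_nonneg by (auto simp: z0_def)
  \<comment> \<open>The factor 10/11 pays for rounding log_6 t down to the integer k.\<close>
  define c where "c = 10 / 11 * ln z0 powr (- kappa)"
  have "recip_sum z \<ge> c * ln z powr kappa" if z: "z \<ge> z0" for z
  proof -
    define t where "t = ln z / ln z0"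
    have "ln z \<ge> ln z0" using z z0 by simp
    then have t: "t \<ge> 1" using z0 by (simp add: t_def field_simps)
    define k where "k = nat \<lfloor>log 6 t\<rfloor>"
    have lt: "log 6 t \<ge> 0" using t by simp
    have k: "real k \<le> log 6 t" "log 6 t - 1 \<le> real k" using lt by (auto simp: k_def)
    have "(6::real) powr real k \<le> 6 powr log 6 t" using k by (intro powr_mono) auto
    then have "6 ^ k \<le> t" using t by (simp add: powr_realpow)
    then have "6 ^ k * ln z0 \<le> ln z" using z0 by (simp add: t_def field_simps)
    then have "ln (z0 ^ (6 ^ k)) \<le> ln z" using z0 by (simp add: ln_realpow)
    then have "z0 ^ (6 ^ k) \<le> z" using z0 z by (subst (asm) ln_le_cancel_iff) auto
    then have "(11 / 10) ^ k \<le> recip_sum z"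
      using recip_sum_iterate[OF z0(1,2), of k] recip_sum_mono by (meson order_trans)
    moreover have "c * ln z powr kappa \<le> (11 / 10) ^ k"
    proof -
      have "c * ln z powr kappa = 10 / 11 * t powr kappa"
        using z0 \<open>ln z \<ge> ln z0\<close> by (simp add: c_def t_def powr_divide powr_minus field_simps)
      also have "t powr kappa = (11 / 10) powr log 6 t"
        using t by (simp add: powr_def kappa_def log_def)
      also have "10 / 11 * (11 / 10 :: real) powr log 6 t = (11 / 10) powr (log 6 t - 1)" by (simp add: powr_diff)
      also have "\<dots> \<le> (11 / 10) powr real k" using k by (intro powr_mono) auto
      also have "\<dots> = (11 / 10) ^ k" by (simp add: powr_realpow)
      finally show ?thesis .
    qed
    ultimately show ?thesis by linarith
  qed
  moreover have "c > 0" using z0 by (simp add: c_def)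
  ultimately show ?thesis using that z0(1) by blast
qed

text \<open>Only the products m p with m \<open>\<le>\<close> sqrt X / B and X / (m B) < p \<open>\<le>\<close> X / m are counted.\<close>
lemma count_lower:
  defines "B \<equiv> exp (8 * C + 4)"
  assumes X: "X \<ge> B ^ 2"
  shows "real (card {n \<in> products. real n \<le> X}) \<ge> X / (B * ln X) * recip_sum (sqrt X / B)"
proof -
  have B: "B > 1" "ln B = 8 * C + 4" using C_nonneg by (auto simp: B_def)
  have "B ^ 2 > 1 ^ 2" using B by (intro power_strict_mono) auto
  then have X1: "X > 1" using X by simp
  define z where "z = sqrt X / B"
  have sq: "sqrt X * sqrt X = X" "sqrt X \<ge> B" "sqrt X > 0" using X X1 B real_le_rsqrt[OF X] by auto
  have z: "z \<le> sqrt X" "z > 0" using sq B by (auto simp: z_def field_simps)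
  define I where "I = (\<lambda>m. {p. p \<in> Q \<and> X / (real m * B) < real p \<and> real p \<le> X / real m})"
  define A where "A = {m. m \<in> products \<and> real m \<le> z}"
  have finA: "finite A" unfolding A_def by (rule finite_real_le)
  have finI: "finite (I m)" for m unfolding I_def using finite_real_le[of "\<lambda>p. p \<in> Q \<and> X / (real m * B) < real p" "X / real m"] by (auto simp: conj_assoc)
  have m0: "m > 0" "sqrt X \<le> X / (real m * B)" "real m < real p" if "m \<in> A" "p \<in> I m" for m p
  proof -
    show m: "m > 0" using that by (auto simp: A_def products_def)
    have "real m * B \<le> sqrt X" using that B by (simp add: A_def z_def field_simps)
    then have "sqrt X * (real m * B) \<le> X" using sq by (metis mult_left_mono less_imp_le)
    then show 1: "sqrt X \<le> X / (real m * B)" using m B by (simp add: field_simps)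
    have "real m \<le> sqrt X" using that z by (auto simp: A_def)
    then show "real m < real p" using 1 that by (auto simp: I_def)
  qed
  have cardI: "real (card (I m)) \<ge> X / (B * ln X) * (1 / real m)" if m: "m \<in> A" for m
  proof -
    have mp: "m > 0" using m by (auto simp: A_def products_def)
    have "real m * B \<le> sqrt X" using m B by (simp add: A_def z_def field_simps)
    then have "sqrt X * (real m * B) \<le> X" using sq by (metis mult_left_mono less_imp_le)
    then have "sqrt X \<le> X / (real m * B)" using mp B by (simp add: field_simps)
    then have y1: "1 \<le> X / (real m * B)" using sq B by linarith
    define y where "y = X / real m"
    have yB: "X / (real m * B) = y / B" by (simp add: y_def)
    have y: "y \<ge> 1" "y / B \<ge> 1" "y / B \<le> y" using y1 B unfolding yB by (auto simp: field_simps)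
    \<comment> \<open>B has ln B = 4 (2 C + 1), so on the interval from y / B to y the main term ln
      B / 4 exceeds the error 2 C by exactly 1.\<close>
    have "1 \<le> (ln y - ln (y / B)) / 4 - 2 * C" using y B by (simp add: ln_div add_divide_distrib)
    also have "\<dots> \<le> (\<Sum>p\<in>I m. ln (real p) / real p)"
      unfolding I_def yB y_def[symmetric] using y by (intro mertens_interval) auto
    also have "\<dots> \<le> (\<Sum>p\<in>I m. ln X * (B * real m) / X)"
    proof (intro sum_mono)
      fix p assume p: "p \<in> I m"
      have p1: "y / B < real p" "real p \<le> y" using p unfolding I_def yB y_def[symmetric] by auto
      have "y \<le> X" using mp X1 by (simp add: y_def field_simps)
      then have "0 < real p" "real p \<le> X" using p1 y by linarith+
      then have "ln (real p) \<le> ln X" using X1 by simp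
      then have "ln (real p) / real p \<le> ln X / real p" by (intro divide_right_mono) auto
      also have "\<dots> \<le> ln X / (y / B)" using p1 y X1 by (intro divide_left_mono mult_pos_pos) auto
      also have "\<dots> = ln X * (B * real m) / X" using mp by (simp add: y_def)
      finally show "ln (real p) / real p \<le> ln X * (B * real m) / X" .
    qed
    also have "\<dots> = real (card (I m)) * (ln X * (B * real m) / X)" by simp
    finally have "1 \<le> real (card (I m)) * (ln X * (B * real m) / X)" .
    then show ?thesis using mp B X1 by (simp add: field_simps)
  qed
  define f where "f = (\<lambda>(m, p). m * p :: nat)"
  have inj: "inj_on f (SIGMA m:A. I m)"
  proof (rule inj_onI, clarify)
    fix m p m' p' assume h: "m \<in> A" "p \<in> I m" "m' \<in> A" "p' \<in> I m'" "f (m, p) = f (m', p')"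
    have "m < p'" "m' < p"
    proof -
      have "real m \<le> sqrt X" "real m' \<le> sqrt X" using h z by (auto simp: A_def)
      moreover have "sqrt X < real p" "sqrt X < real p'" using m0(2)[OF h(1,2)] m0(2)[OF h(3,4)] h by (auto simp: I_def)
      ultimately show "m < p'" "m' < p" by linarith+
    qed
    moreover have "m > 0" "m' > 0" "m < p" "m' < p'" using m0[OF h(1,2)] m0[OF h(3,4)] by simp_all
    moreover have "prime p" "prime p'" using h Q_prime by (auto simp: I_def)
    moreover have "m * p = m' * p'" using h(5) by (simp add: f_def)
    ultimately show "m = m' \<and> p = p'" using product_inj[of m p m' p'] by blast
  qed
  have img: "f ` (SIGMA m:A. I m) \<subseteq> {n \<in> products. real n \<le> X}"
  proof (clarify, intro conjI)
    fix m p assume mp: "m \<in> A" "p \<in> I m"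
    have "m \<in> products" "p \<in> Q" "m < p" using mp m0(3)[OF mp] by (auto simp: A_def I_def)
    then have "m * p \<in> products" using products_mult by blast
    then show "f (m, p) \<in> products" by (simp add: f_def)
    have "real p \<le> X / real m" using mp by (simp add: I_def)
    then show "real (f (m, p)) \<le> X" using m0(1)[OF mp] by (simp add: f_def field_simps)
  qed
  have "X / (B * ln X) * recip_sum (sqrt X / B) = (\<Sum>m\<in>A. X / (B * ln X) * (1 / real m))"
    unfolding recip_sum_def sum_distrib_left A_def z_def ..
  also have "\<dots> \<le> (\<Sum>m\<in>A. real (card (I m)))" by (intro sum_mono cardI)
  also have "\<dots> = real (card (SIGMA m:A. I m))" using finA finI by (simp add: card_SigmaI)
  also have "\<dots> = real (card (f ` (SIGMA m:A. I m)))" using card_image[OF inj] by simp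
  also have "\<dots> \<le> real (card {n \<in> products. real n \<le> X})"
    using finite_real_le[of "\<lambda>n. n \<in> products" X] img by (intro of_nat_mono card_mono) auto
  finally show ?thesis .
qed

theorem count_products:
  obtains c where "c > 0"
    "\<forall>\<^sub>F X in at_top. real (card {n \<in> products. real n \<le> X}) \<ge> c * (X / ln X powr (1 - kappa))"
proof -
  obtain c z0 where c: "c > 0" "z0 > 1" "\<And>z. z \<ge> z0 \<Longrightarrow> recip_sum z \<ge> c * ln z powr kappa"
    using recip_sum_lower by metis
  define B where "B = exp (8 * C + 4)"
  have B: "B > 0" "ln B = 8 * C + 4" by (auto simp: B_def)
  have Bk: "4 powr (- kappa) > (0 :: real)" by simp
  have "\<forall>\<^sub>F X in at_top. X \<ge> B ^ 2" by (rule eventually_ge_at_top)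
  moreover have "\<forall>\<^sub>F X in at_top. sqrt X / B \<ge> z0"
    using eventually_ge_at_top[of "(z0 * B) ^ 2"]
  proof eventually_elim
    case (elim X)
    then have "z0 * B \<le> sqrt X" by (rule real_le_rsqrt)
    then show ?case using B by (simp add: field_simps)
  qed
  moreover have "\<forall>\<^sub>F X in at_top. X \<ge> exp (4 * ln B) \<and> X > 1 \<and> X \<ge> exp 1"
    using eventually_ge_at_top[of "exp (4 * ln B)"] eventually_gt_at_top[of 1] eventually_ge_at_top[of "exp 1 :: real"]
    by eventually_elim auto
  ultimately have "\<forall>\<^sub>F X in at_top. real (card {n \<in> products. real n \<le> X}) \<ge> (c * 4 powr (- kappa) / B) * (X / ln X powr (1 - kappa))"
  proof eventually_elim
    case (elim X)
    have X: "X > 1" "X \<ge> exp (4 * ln B)" "X \<ge> exp 1" using elim by auto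
    have lX: "ln X \<ge> 4 * ln B" "ln X > 0" using X by (auto simp: ln_ge_iff)
    \<comment> \<open>X >= B^4 makes sqrt X / B at least the fourth root of X, so only a constant is
      lost in the power of ln X.\<close>
    have lnz: "ln (sqrt X / B) \<ge> ln X / 4" using X B lX(1) by (simp add: ln_div ln_sqrt)
    have "4 powr (- kappa) * ln X powr kappa = (ln X / 4) powr kappa"
      using lX by (simp add: powr_divide powr_minus field_simps)
    also have "\<dots> \<le> ln (sqrt X / B) powr kappa" using lnz lX kappa by (intro powr_mono2) auto
    finally have "c * (4 powr (- kappa) * ln X powr kappa) \<le> c * ln (sqrt X / B) powr kappa" using c by simp
    also have "\<dots> \<le> recip_sum (sqrt X / B)" by (rule c(3)[OF elim(2)])
    finally have "X / (B * ln X) * (c * (4 powr (- kappa) * ln X powr kappa)) \<le> X / (B * ln X) * recip_sum (sqrt X / B)"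
      using X B lX by (intro mult_left_mono) auto
    also have "\<dots> \<le> real (card {n \<in> products. real n \<le> X})" unfolding B_def by (rule count_lower) (use elim in \<open>simp add: B_def\<close>)
    finally show ?case using lX B by (simp add: powr_diff field_simps)
  qed
  then show ?thesis using c(1) B Bk by (intro that[of "c * 4 powr (- kappa) / B"]) auto
qed

end

section \<open>The characters attached to the twisting primes\<close>

lemma Legendre_cong: "[a = b] (mod int p) \<Longrightarrow> Legendre a p = Legendre b p"
  unfolding Legendre_def QuadRes_def by (auto dest: cong_trans cong_sym)

lemma Legendre_values: "Legendre a p \<in> {-1, 0, 1}"
  by (simp add: Legendre_def)

lemma small_multiple_zero: "int p dvd x \<Longrightarrow> \<bar>x\<bar> \<le> 2 \<Longrightarrow> 2 < p \<Longrightarrow> x = 0"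
  using dvd_imp_le_int[of x "int p"] by (cases "x = 0") auto

text \<open>Euler's criterion gives the congruence modulo p, and two numbers from {-1, 0, 1} that
  are congruent modulo p > 2 coincide.\<close>

lemma Legendre_mult:
  fixes p :: nat
  assumes p: "prime p" "2 < p"
  shows "Legendre (a * b) p = Legendre a p * Legendre b p"
proof -
  have "[Legendre (a * b) p = (a * b) ^ ((p - 1) div 2)] (mod p)" by (rule euler_criterion[OF p])
  also have "(a * b) ^ ((p - 1) div 2) = a ^ ((p - 1) div 2) * b ^ ((p - 1) div 2)" by (rule power_mult_distrib)
  also have "[a ^ ((p - 1) div 2) * b ^ ((p - 1) div 2) = Legendre a p * Legendre b p] (mod p)"
    using euler_criterion[OF p, of a] euler_criterion[OF p, of b] by (intro cong_mult) (auto simp: cong_sym_eq)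
  finally have "int p dvd Legendre (a * b) p - Legendre a p * Legendre b p" by (simp add: cong_iff_dvd_diff)
  moreover have "\<bar>Legendre (a * b) p - Legendre a p * Legendre b p\<bar> \<le> 2"
    using Legendre_values[of "a * b" p] Legendre_values[of a p] Legendre_values[of b p] by auto
  ultimately have "Legendre (a * b) p - Legendre a p * Legendre b p = 0"
    using p(2) by (rule small_multiple_zero)
  then show ?thesis by simp
qed

lemma Legendre_one: "Legendre 1 (int p) = 1" if "prime p" for p :: nat
proof -
  have "int p > 1" using prime_gt_1_nat[OF that] by simp
  then have "\<not> [1 = 0] (mod int p)" by (simp add: Cong.cong_def)
  moreover have "QuadRes (int p) 1" unfolding QuadRes_def by (rule exI[of _ 1]) simp
  ultimately show ?thesis by (simp add: Legendre_def)
qed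

definition chi3 :: "nat \<Rightarrow> int" where
  "chi3 n = (if n mod 3 = 0 then 0 else if n mod 3 = 1 then 1 else -1)"

definition chi4 :: "nat \<Rightarrow> int" where
  "chi4 n = (if even n then 0 else if n mod 4 = 1 then 1 else -1)"

lemma chi3_mult: "chi3 (m * n) = chi3 m * chi3 n"
proof -
  have "m mod 3 = 0 \<or> m mod 3 = 1 \<or> m mod 3 = 2" "n mod 3 = 0 \<or> n mod 3 = 1 \<or> n mod 3 = 2" by auto
  then show ?thesis unfolding chi3_def mod_mult_eq[of m 3 n, symmetric] by (elim disjE) simp_all
qed

lemma chi4_mult: "chi4 (m * n) = chi4 m * chi4 n"
proof -
  have *: "chi4 n = (if n mod 4 = 1 then 1 else if n mod 4 = 3 then -1 else 0)" for n
    unfolding chi4_def by presburger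
  have "m mod 4 = 0 \<or> m mod 4 = 1 \<or> m mod 4 = 2 \<or> m mod 4 = 3" "n mod 4 = 0 \<or> n mod 4 = 1 \<or> n mod 4 = 2 \<or> n mod 4 = 3" by auto
  then show ?thesis unfolding * mod_mult_eq[of m 4 n, symmetric] by (elim disjE) simp_all
qed

lemma chi4_odd: "odd n \<Longrightarrow> chi4 n = (-1) ^ ((n - 1) div 2)"
proof -
  assume "odd n"
  then obtain k where k: "n = 2 * k + 1" by (elim oddE)
  have "even k \<longleftrightarrow> n mod 4 = 1" unfolding k by presburger
  then show ?thesis by (auto simp: chi4_def k)
qed

lemma Legendre_minus_1:
  fixes p :: nat
  assumes p: "prime p" "2 < p"
  shows "Legendre (-1) p = chi4 p"
proof -
  have "odd p" using p prime_odd_nat by blast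
  have "[Legendre (-1) p = chi4 p] (mod p)" using euler_criterion[OF p, of "-1"] chi4_odd[OF \<open>odd p\<close>] by simp
  then have "int p dvd Legendre (-1) p - chi4 p" by (simp add: cong_iff_dvd_diff)
  moreover have "\<bar>Legendre (-1) p - chi4 p\<bar> \<le> 2" using Legendre_values[of "-1" p] by (auto simp: chi4_def)
  ultimately have "Legendre (-1) p - chi4 p = 0"
    using p(2) by (rule small_multiple_zero)
  then show ?thesis by simp
qed

lemma Legendre_reciprocity:
  fixes p q :: nat
  assumes "prime p" "2 < p" "prime q" "2 < q" "p \<noteq> q"
  shows "Legendre q p = chi4 q ^ ((p - 1) div 2) * Legendre p q"
proof -
  have "odd q" using assms prime_odd_nat by blast
  have 1: "Legendre q p * Legendre p q = (-1) ^ ((q - 1) div 2 * ((p - 1) div 2))"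
    using Quadratic_Reciprocity[of q p] assms by auto
  then have e: "Legendre q p * Legendre p q = chi4 q ^ ((p - 1) div 2)"
    by (simp add: chi4_odd[OF \<open>odd q\<close>] power_mult)
  have "Legendre q p * Legendre p q \<noteq> 0" unfolding 1 by simp
  then have "Legendre p q * Legendre p q = 1" using Legendre_values[of p q] by auto
  then show ?thesis using e by (metis mult.assoc mult.right_neutral)
qed

text \<open>Multiplication by \<open>a\<close> permutes the residues modulo q and changes the sign
  of the sum.\<close>

lemma sum_char_zero:
  fixes f :: "nat \<Rightarrow> real"
  assumes q: "q > 0" and per: "\<And>n. f (n + q) = f n" and mult: "\<And>m n. f (m * n) = f m * f n"
    and a: "coprime a q" "f a = -1"
  shows "(\<Sum>n<q. f n) = 0"
proof -
  have pm: "f (n + k * q) = f n" for n k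
  proof (induction k)
    case (Suc k)
    have "n + Suc k * q = (n + k * q) + q" by simp
    then show ?case by (simp only: per Suc)
  qed simp
  have md: "f (n mod q) = f n" for n using pm[of "n mod q" "n div q"] by simp
  have "inj_on (\<lambda>n. a * n mod q) {..<q}"
  proof (rule inj_onI)
    fix x y assume xy: "x \<in> {..<q}" "y \<in> {..<q}" "a * x mod q = a * y mod q"
    then have "[a * x = a * y] (mod q)" by (simp add: Cong.cong_def)
    then have "[x = y] (mod q)" using a(1) by (simp add: cong_mult_lcancel_nat)
    then show "x = y" using xy by (simp add: cong_less_modulus_unique_nat)
  qed
  moreover have "(\<lambda>n. a * n mod q) ` {..<q} \<subseteq> {..<q}" using q by auto
  ultimately have "bij_betw (\<lambda>n. a * n mod q) {..<q} {..<q}"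
    unfolding bij_betw_def using endo_inj_surj[of "{..<q}"] by auto
  then have "(\<Sum>n<q. f n) = (\<Sum>n<q. f (a * n mod q))" by (rule sum.reindex_bij_betw[symmetric])
  also have "\<dots> = - (\<Sum>n<q. f n)" by (simp add: md mult a(2) sum_negf)
  finally show ?thesis by simp
qed

section \<open>The quadratic character of K and the density of twisting primes\<close>

context trivial_3_torsion
begin

definition natA :: nat where "natA = nat A"

lemma natA: "natA > 0" "int natA = A" "natA mod 4 = 1" "natA mod 3 = 1"
proof -
  show "natA > 0" "int natA = A" using A_pos by (auto simp: natA_def)
  then show "natA mod 4 = 1" "natA mod 3 = 1" using A_mod4 A_mod3 by (metis of_nat_eq_iff of_nat_1 of_nat_mod of_nat_numeral)+
qed

text \<open>For odd n this is the Jacobi symbol of - A over n, written on the other side of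
  quadratic reciprocity so that periodicity modulo 4 A is visible; A = 1 mod 4 makes the signs
  right.\<close>

definition chiA :: "nat \<Rightarrow> int" where
  "chiA n = chi4 n * (\<Prod>l\<in>prime_factors natA. Legendre (int n) (int l))"

lemma natA_primes: "l \<in> prime_factors natA \<Longrightarrow> prime l \<and> 2 < l \<and> l \<noteq> 3 \<and> l dvd natA"
proof -
  assume "l \<in> prime_factors natA"
  then have l: "prime l" "l dvd natA" by (auto simp: in_prime_factors_iff)
  have "\<not> 2 dvd natA" "\<not> 3 dvd natA" using natA by presburger+
  then have "l \<noteq> 2" "l \<noteq> 3" using l by auto
  moreover have "l \<ge> 2" using l prime_ge_2_nat by blast
  ultimately show ?thesis using l by simp
qed

lemma natA_prod: "\<Prod>(prime_factors natA) = natA"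
proof -
  have sf: "squarefree natA" unfolding squarefree_def
  proof (intro allI impI)
    fix x assume "x\<^sup>2 dvd natA"
    then have "int x ^ 2 dvd A" by (metis natA(2) of_nat_dvd_iff of_nat_power)
    then have "is_unit (int x)" using A_sqf by (auto simp: squarefree_def)
    then show "x dvd 1" by simp
  qed
  have "natA = (\<Prod>p\<in>prime_factors natA. p ^ multiplicity p natA)" using natA(1) by (simp add: prod_prime_factors)
  also have "\<dots> = (\<Prod>p\<in>prime_factors natA. p)"
  proof (intro prod.cong refl)
    fix p assume p: "p \<in> prime_factors natA"
    then have "multiplicity p natA \<ge> 1" by (simp add: prime_factors_multiplicity)
    moreover have "multiplicity p natA \<le> 1" using sf p natA(1)
      squarefree_factorial_semiring''[of natA] in_prime_factors_imp_prime[OF p] by simp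
    ultimately show "p ^ multiplicity p natA = p" by simp
  qed
  finally show ?thesis by simp
qed

lemma chiA_mult: "chiA (m * n) = chiA m * chiA n"
proof -
  have "(\<Prod>l\<in>prime_factors natA. Legendre (int (m * n)) (int l))
      = (\<Prod>l\<in>prime_factors natA. Legendre (int m) (int l) * Legendre (int n) (int l))"
    by (intro prod.cong refl) (use natA_primes Legendre_mult in auto)
  then show ?thesis by (simp add: chiA_def chi4_mult prod.distrib)
qed

lemma chiA_values: "chiA n \<in> {-1, 0, 1}"
proof -
  have "(\<Prod>l\<in>L. Legendre (int n) (int l)) \<in> {-1, 0, 1}" for L
  proof (induction L rule: infinite_finite_induct)
    case (insert x L)
    then show ?case using Legendre_values[of n x] by auto
  qed auto
  from this[of "prime_factors natA"] show ?thesis by (auto simp: chiA_def chi4_def)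
qed

lemma chiA_period: "chiA (n + 4 * natA * k) = chiA n"
proof -
  have "Legendre (int (n + 4 * natA * k)) (int l) = Legendre (int n) (int l)" if "l \<in> prime_factors natA" for l
  proof (rule Legendre_cong)
    have "l dvd natA" using natA_primes[OF that] by simp
    then have "int l dvd int (4 * natA * k)" by (metis dvd_mult dvd_mult2 of_nat_dvd_iff)
    then show "[int (n + 4 * natA * k) = int n] (mod int l)" by (simp add: cong_iff_dvd_diff)
  qed
  moreover have "chi4 (n + 4 * natA * k) = chi4 n"
  proof -
    have "(n + 4 * natA * k) mod 4 = n mod 4" by (simp add: mult.assoc)
    moreover have "even (n + 4 * natA * k) = even n" by simp
    ultimately show ?thesis by (simp only: chi4_def)
  qed
  ultimately show ?thesis by (simp add: chiA_def)
qed

text \<open>One witness for two characters: 6 A + 1 is 1 modulo 3 and modulo every prime divisor of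
  A, but 3 modulo 4 as A is odd. So \<open>chiA\<close> and the product of \<open>chi3\<close> and
  \<open>chiA\<close> both take the value -1 there.\<close>

lemma chiA_minus: "chiA (6 * natA + 1) = -1" and chi3_plus: "chi3 (6 * natA + 1) = 1"
proof -
  have "(6 * natA + 1) mod 4 = 3" using natA(3) by presburger
  then have 4: "chi4 (6 * natA + 1) = -1" by (simp add: chi4_def)
  have "Legendre (int (6 * natA + 1)) (int l) = 1" if "l \<in> prime_factors natA" for l
  proof -
    have "l dvd natA" using natA_primes[OF that] by simp
    then have "int l dvd int (6 * natA)" by (metis dvd_mult of_nat_dvd_iff)
    then have "[int (6 * natA + 1) = 1] (mod int l)" by (simp add: cong_iff_dvd_diff)
    then show ?thesis using Legendre_cong Legendre_one natA_primes[OF that] by metis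
  qed
  then show "chiA (6 * natA + 1) = -1" unfolding chiA_def 4 by simp
  show "chi3 (6 * natA + 1) = 1" unfolding chi3_def by presburger
qed

text \<open>Reciprocity for each prime l of A produces a sign chi4(l)^((p - 1) / 2), and the product
  of these is a power of chi4(A) = 1.\<close>

lemma chiA_prime:
  fixes p :: nat
  assumes p: "prime p" "2 < p" "\<not> p dvd natA"
  shows "chiA p = Legendre (- A) p"
proof -
  have A: "Legendre (\<Prod>l\<in>L. int l) p = (\<Prod>l\<in>L. Legendre (int l) p)" for L
    by (induction L rule: infinite_finite_induct) (use Legendre_one p in \<open>auto simp: Legendre_mult[OF p(1,2)]\<close>)
  have c4: "(\<Prod>l\<in>L. chi4 l) = chi4 (\<Prod>L)" for L
    by (induction L rule: infinite_finite_induct) (auto simp: chi4_mult, auto simp: chi4_def)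
  have "Legendre A p = Legendre (\<Prod>l\<in>prime_factors natA. int l) p"
  proof -
    have "A = int (\<Prod>(prime_factors natA))" using natA_prod natA(2) by simp
    then show ?thesis by simp
  qed
  also have "\<dots> = (\<Prod>l\<in>prime_factors natA. Legendre (int l) p)" by (rule A)
  also have "\<dots> = (\<Prod>l\<in>prime_factors natA. chi4 l ^ ((p - 1) div 2) * Legendre p l)"
    using natA_primes p by (intro prod.cong refl Legendre_reciprocity) auto
  also have "\<dots> = chi4 natA ^ ((p - 1) div 2) * (\<Prod>l\<in>prime_factors natA. Legendre p l)"
    by (simp add: prod.distrib prod_power_distrib[symmetric] c4 natA_prod)
  also have "chi4 natA = 1"
  proof -
    have "odd natA" using natA(3) by presburger
    then show ?thesis using natA(3) by (simp add: chi4_def)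
  qed
  finally have "Legendre A p = (\<Prod>l\<in>prime_factors natA. Legendre p l)" by simp
  moreover have "Legendre (- A) p = Legendre (-1) p * Legendre A p" using Legendre_mult[OF p(1,2), of "-1" A] by simp
  ultimately show ?thesis by (simp add: chiA_def Legendre_minus_1[OF p(1,2)])
qed

definition twist_primes :: "nat set" where "twist_primes = {p. prime p \<and> chi3 p = 1 \<and> chiA p = -1}"

lemma twist_primes_mod3: "p \<in> twist_primes \<Longrightarrow> p mod 3 = 1"
  by (auto simp: twist_primes_def chi3_def split: if_splits)

text \<open>p = 1 mod 3 makes - 3 a square modulo p: the sign in reciprocity for 3 cancels against
  the symbol of - 1. The nonzero value of \<open>chiA\<close> rules out 2 and the primes of A, and
  its being -1 makes - A a nonsquare.\<close>

lemma twist_primes_twist: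
  assumes "p \<in> twist_primes"
  shows "twist_prime (int p)"
proof -
  have p: "prime p" "chi3 p = 1" "chiA p = -1" using assms by (auto simp: twist_primes_def)
  have m3: "p mod 3 = 1" using assms by (rule twist_primes_mod3)
  have "p \<noteq> 2" using p(3) by (auto simp: chiA_def chi4_def)
  moreover have "p \<ge> 2" using p(1) prime_ge_2_nat by blast
  ultimately have p2: "2 < p" by simp
  have p3: "p \<noteq> 3" using m3 by auto
  have nd: "\<not> p dvd natA"
  proof
    assume "p dvd natA"
    then have "p \<in> prime_factors natA" using p natA(1) by (simp add: in_prime_factors_iff)
    moreover have "Legendre (int p) (int p) = 0" by (simp add: Legendre_def Cong.cong_def)
    ultimately have "(\<Prod>l\<in>prime_factors natA. Legendre (int p) (int l)) = 0"
      by (intro prod_zero) auto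
    then have "chiA p = 0" unfolding chiA_def by (simp only: mult_zero_right)
    then show False using p(3) by simp
  qed
  have "Legendre (- A) p = -1" using chiA_prime[OF p(1) p2 nd] p(3) by simp
  then have nq: "\<not> QuadRes p (- A)" by (auto simp: Legendre_def split: if_splits)
  have 1: "\<not> int p dvd x ^ 2 + A" for x
  proof
    assume "int p dvd x ^ 2 + A"
    then have "[x ^ 2 = - A] (mod p)" by (simp add: cong_iff_dvd_diff)
    then show False using nq by (auto simp: QuadRes_def)
  qed
  have "odd p" using p p2 prime_odd_nat by blast
  have "Legendre (int 3) p = chi4 3 ^ ((p - 1) div 2) * Legendre p 3"
    using Legendre_reciprocity[OF p(1) p2, of 3] p3 by simp
  also have "chi4 3 = -1" by (simp add: chi4_def)
  also have "Legendre (int p) 3 = 1"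
  proof -
    have "int p mod int 3 = 1 mod int 3" using m3 by (metis of_nat_1 of_nat_mod mod_less one_less_numeral_iff semiring_norm(77))
    then have "[int p = 1] (mod int 3)" by (simp only: Cong.cong_def)
    then show ?thesis using Legendre_cong[of "int p" 1 3] Legendre_one[of 3] by simp
  qed
  also have "(-1) ^ ((p - 1) div 2) = Legendre (-1) p" using Legendre_minus_1[OF p(1) p2] chi4_odd[OF \<open>odd p\<close>] by simp
  finally have L3: "Legendre 3 p = Legendre (-1) p" by simp
  have "Legendre (-1) p \<noteq> 0" using Legendre_minus_1[OF p(1) p2] \<open>odd p\<close> by (simp add: chi4_def)
  then have "Legendre (-1) p * Legendre (-1) p = 1" using Legendre_values[of "-1" p] by auto
  then have "Legendre (- 3) p = 1" using Legendre_mult[OF p(1) p2, of "-1" 3] L3 by simp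
  then have "QuadRes p (- 3)" by (auto simp: Legendre_def split: if_splits)
  then obtain s where "[s ^ 2 = - 3] (mod p)" by (auto simp: QuadRes_def)
  then have "int p dvd s ^ 2 + 3" by (simp add: cong_iff_dvd_diff)
  then show ?thesis unfolding twist_prime_def using 1 p(1) p2 p3 by auto
qed

lemma real_char_chi3: "real_char (\<lambda>n. of_int (chi3 n)) 3"
proof
  show "of_int (chi3 (n + 3)) = real_of_int (chi3 n)" for n by (simp add: chi3_def)
  show "real_of_int (chi3 n) \<in> {-1, 0, 1}" for n by (simp add: chi3_def)
  show "real_of_int (chi3 (m * n)) = of_int (chi3 m) * of_int (chi3 n)" for m n by (simp add: chi3_mult)
  have "chi3 0 = 0" "chi3 1 = 1" "chi3 2 = -1" unfolding chi3_def by simp_all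
  moreover have "{..<3} = {0, 1, 2 :: nat}" by auto
  ultimately show "(\<Sum>n<3. real_of_int (chi3 n)) = 0" by simp
  show "real_of_int (chi3 1) = 1" by (simp add: chi3_def)
qed simp

lemma coprime_6A: "coprime (6 * natA + 1) (12 * natA)"
proof -
  have "coprime (6 * natA + 1) (6 * natA)" by (metis Suc_eq_plus1 coprime_Suc_left_nat)
  moreover have "coprime (6 * natA + 1) 2" by simp
  ultimately have "coprime (6 * natA + 1) (2 * (6 * natA))" by (simp only: coprime_mult_right_iff)
  then show ?thesis by simp
qed

lemma real_char_chiA: "real_char (\<lambda>n. of_int (chiA n)) (4 * natA)"
proof
  show per: "of_int (chiA (n + 4 * natA)) = real_of_int (chiA n)" for n using chiA_period[of n 1] by simp
  show mult: "of_int (chiA (m * n)) = real_of_int (chiA m) * of_int (chiA n)" for m n by (simp add: chiA_mult)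
  show "real_of_int (chiA n) \<in> {-1, 0, 1}" for n using chiA_values[of n] by auto
  show "real_of_int (chiA 1) = 1" using Legendre_one natA_primes by (simp add: chiA_def chi4_def)
  have "coprime (6 * natA + 1) (4 * natA)" using coprime_6A by (rule coprime_divisors[OF dvd_refl, rotated]) auto
  then show "(\<Sum>n<4 * natA. real_of_int (chiA n)) = 0"
    using natA(1) chiA_minus by (intro sum_char_zero[OF _ per mult]) auto
qed (use natA in auto)

lemma real_char_chi3A: "real_char (\<lambda>n. of_int (chi3 n * chiA n)) (12 * natA)"
proof
  show per: "of_int (chi3 (n + 12 * natA) * chiA (n + 12 * natA)) = real_of_int (chi3 n * chiA n)" for n
  proof -
    have "(n + 12 * natA) mod 3 = n mod 3" by presburger
    then have "chi3 (n + 12 * natA) = chi3 n" by (simp only: chi3_def)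
    then show ?thesis using chiA_period[of n 3] by (simp add: mult.commute mult.left_commute)
  qed
  show mult: "of_int (chi3 (m * n) * chiA (m * n)) = real_of_int (chi3 m * chiA m) * of_int (chi3 n * chiA n)" for m n
    by (simp add: chiA_mult chi3_mult)
  show "real_of_int (chi3 n * chiA n) \<in> {-1, 0, 1}" for n using chiA_values[of n] by (auto simp: chi3_def)
  show "real_of_int (chi3 1 * chiA 1) = 1" using Legendre_one natA_primes by (simp add: chiA_def chi4_def chi3_def)
  show "(\<Sum>n<12 * natA. real_of_int (chi3 n * chiA n)) = 0"
    using natA(1) chiA_minus chi3_plus coprime_6A by (intro sum_char_zero[OF _ per mult]) auto
qed (use natA in auto)

text \<open>At primes not dividing 6 A the indicator of \<open>twist_primes\<close> is (1 + chi3) (1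
  - chiA) / 4. Expanded, it consists of the trivial character, responsible for (ln N) / 4, and three
  real characters with bounded sums; \<open>err\<close> is the defect at the finitely many other
  primes.\<close>

lemma mertens_twist_primes:
  obtains C where "\<And>N. N \<ge> 1 \<Longrightarrow> \<bar>(\<Sum>p | p \<in> twist_primes \<and> p \<le> N. ln (real p) / real p) - ln (real N) / 4\<bar> \<le> C"
proof -
  define S where "S = (\<lambda>f N. \<Sum>p | prime p \<and> p \<le> N. real_of_int (f p) * ln (real p) / real p)"
  have bnd: "\<exists>C. \<forall>N. \<bar>S f N\<bar> \<le> C" if "real_char (\<lambda>n. of_int (f n)) q" for f :: "nat \<Rightarrow> int" and q
  proof -
    interpret R: real_char "\<lambda>n. of_int (f n)" q by (rule that)
    obtain C where C: "\<And>N. \<bar>\<Sum>d\<in>{1..N}. of_int (f d) * Lam d / real d\<bar> \<le> C" using R.mertens_char by metis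
    have "\<bar>S f N\<bar> \<le> C + 16" for N
      using C[of N] prime_power_tail_bound[where f = "\<lambda>n. of_int (f n)" and N = N, OF R.chi_abs] unfolding S_def by linarith
    then show ?thesis by blast
  qed
  obtain C1 where C1: "\<And>N. \<bar>S chi3 N\<bar> \<le> C1" using bnd[OF real_char_chi3] by metis
  obtain C2 where C2: "\<And>N. \<bar>S chiA N\<bar> \<le> C2" using bnd[OF real_char_chiA] by metis
  obtain C3 where C3: "\<And>N. \<bar>S (\<lambda>n. chi3 n * chiA n) N\<bar> \<le> C3" using bnd[OF real_char_chi3A] by metis
  have C0: "\<bar>S (\<lambda>n. 1) N - ln (real N)\<bar> \<le> 22" if "N \<ge> 1" for N
    using mertens_mangoldt[OF that] prime_power_tail_bound[where f = "\<lambda>_. 1" and N = N] unfolding S_def by simp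
  define err where "err = (\<lambda>p. real_of_int ((1 + chi3 p) * (1 - chiA p)) / 4 - (if p \<in> twist_primes then 1 else 0))"
  have err_bound: "\<bar>err p\<bar> \<le> 1" for p
    using chiA_values[of p] by (auto simp: err_def twist_primes_def chi3_def)
  have err0: "err p = 0" if p: "prime p" "\<not> p dvd 6 * natA" for p
  proof -
    have p2: "p \<noteq> 2" "p \<noteq> 3" "\<not> p dvd natA" using p(2) by (auto simp: dvd_mult2)
    have "\<not> 3 dvd p" using p(1) p2(2) primes_dvd_imp_eq[of 3 p] by auto
    then have 3: "chi3 p = 1 \<or> chi3 p = -1" by (simp add: chi3_def mod_eq_0_iff_dvd)
    have "2 < p" using p(1) p2(1) prime_ge_2_nat[of p] by simp
    then have "chiA p = Legendre (- A) p" using p p2 by (intro chiA_prime) auto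
    moreover have "Legendre (- A) p \<noteq> 0"
    proof
      assume "Legendre (- A) p = 0"
      then have "[- A = 0] (mod p)" by (auto simp: Legendre_def split: if_splits)
      then have "int p dvd int natA" by (simp add: cong_iff_dvd_diff natA(2))
      then show False using p2(3) by simp
    qed
    ultimately have "chiA p = 1 \<or> chiA p = -1" using Legendre_values[of "- A" p] by auto
    then show ?thesis using 3 p(1) by (auto simp: err_def twist_primes_def)
  qed
  define E where "E = (\<Sum>p | p dvd 6 * natA. ln (real p) / real p)"
  have fin6: "finite {p. p dvd 6 * natA}" using natA(1) by (intro finite_divisors_nat) simp
  have errS: "\<bar>\<Sum>p | prime p \<and> p \<le> N. err p * ln (real p) / real p\<bar> \<le> E" for N
  proof -
    have "\<bar>\<Sum>p | prime p \<and> p \<le> N. err p * ln (real p) / real p\<bar> \<le> (\<Sum>p | prime p \<and> p \<le> N. \<bar>err p * ln (real p) / real p\<bar>)" by (rule sum_abs)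
    also have "\<dots> = (\<Sum>p | prime p \<and> p \<le> N \<and> p dvd 6 * natA. \<bar>err p * ln (real p) / real p\<bar>)"
      by (rule sum.mono_neutral_right) (use err0 in auto)
    also have "\<dots> \<le> (\<Sum>p | prime p \<and> p \<le> N \<and> p dvd 6 * natA. ln (real p) / real p)"
    proof (intro sum_mono)
      fix p assume "p \<in> {p. prime p \<and> p \<le> N \<and> p dvd 6 * natA}"
      then have "0 \<le> ln (real p) / real p" using prime_ge_1_nat by auto
      then have "\<bar>err p\<bar> * (ln (real p) / real p) \<le> 1 * (ln (real p) / real p)" using err_bound by (intro mult_right_mono) auto
      then show "\<bar>err p * ln (real p) / real p\<bar> \<le> ln (real p) / real p"
        using \<open>0 \<le> ln (real p) / real p\<close>
        by (simp only: times_divide_eq_right[symmetric] abs_mult abs_of_nonneg mult_1_left)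
    qed
    also have "\<dots> \<le> E" unfolding E_def
    proof (rule sum_mono2[OF fin6])
      fix p assume "p \<in> {p. p dvd 6 * natA} - {p. prime p \<and> p \<le> N \<and> p dvd 6 * natA}"
      then have "p > 0" using natA(1) by (auto intro: Nat.gr0I)
      then show "0 \<le> ln (real p) / real p" by simp
    qed auto
    finally show ?thesis .
  qed
  have main: "(\<Sum>p | p \<in> twist_primes \<and> p \<le> N. ln (real p) / real p)
      = (S (\<lambda>n. 1) N + S chi3 N - S chiA N - S (\<lambda>n. chi3 n * chiA n) N) / 4 - (\<Sum>p | prime p \<and> p \<le> N. err p * ln (real p) / real p)" for N
  proof -
    have "(\<Sum>p | p \<in> twist_primes \<and> p \<le> N. ln (real p) / real p) = (\<Sum>p | prime p \<and> p \<le> N. (if p \<in> twist_primes then 1 else 0) * (ln (real p) / real p))"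
      by (rule sum.mono_neutral_cong_left) (auto simp: twist_primes_def)
    also have "\<dots> = (\<Sum>p | prime p \<and> p \<le> N. (1 / 4) * ((of_int 1 * ln (real p) / real p + of_int (chi3 p) * ln (real p) / real p)
       - of_int (chiA p) * ln (real p) / real p - of_int (chi3 p * chiA p) * ln (real p) / real p) - err p * ln (real p) / real p)"
    proof (intro sum.cong refl)
      have gen: "i * (l / P) = 1 / 4 * ((1 * l / P + a * l / P) - b * l / P - (a * b) * l / P) - (((1 + a) * (1 - b)) / 4 - i) * l / P"
        for i l P a b :: real by (cases "P = 0") (simp_all add: field_simps)
      fix p
      show "(if p \<in> twist_primes then 1 else 0) * (ln (real p) / real p) = (1 / 4) * ((of_int 1 * ln (real p) / real p + of_int (chi3 p) * ln (real p) / real p)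
       - of_int (chiA p) * ln (real p) / real p - of_int (chi3 p * chiA p) * ln (real p) / real p) - err p * ln (real p) / real p"
        using gen[of "if p \<in> twist_primes then 1 else 0" "ln (real p)" "real p" "of_int (chi3 p)" "of_int (chiA p)"]
        by (simp only: err_def of_int_mult of_int_add of_int_diff of_int_1)
    qed
    finally show ?thesis unfolding S_def sum_subtractf sum.distrib sum_distrib_left[symmetric] by simp
  qed
  have "\<bar>(\<Sum>p | p \<in> twist_primes \<and> p \<le> N. ln (real p) / real p) - ln (real N) / 4\<bar> \<le> 22 + C1 + C2 + C3 + E" if "N \<ge> 1" for N
  proof -
    have nn: "C1 \<ge> 0" "C2 \<ge> 0" "C3 \<ge> 0" using C1[of 0] C2[of 0] C3[of 0] by linarith+
    define s e where "s = S (\<lambda>n. 1) N + S chi3 N - S chiA N - S (\<lambda>n. chi3 n * chiA n) N"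
      and "e = (\<Sum>p | prime p \<and> p \<le> N. err p * ln (real p) / real p)"
    have "\<bar>s - ln (real N)\<bar> \<le> 22 + C1 + C2 + C3"
      using C0[OF that] C1[of N] C2[of N] C3[of N] unfolding s_def by linarith
    moreover have "\<bar>e\<bar> \<le> E" unfolding e_def by (rule errS)
    moreover have "(\<Sum>p | p \<in> twist_primes \<and> p \<le> N. ln (real p) / real p) = s / 4 - e" unfolding main s_def e_def ..
    ultimately show ?thesis using nn by (simp add: abs_le_iff)
  qed
  then show ?thesis using that by blast
qed

end

section \<open>Many good twists\<close>

lemma mod_eq_1_of_prime_divisors:
  fixes n k :: nat
  assumes "k > 1" "n > 0" "\<And>p. prime p \<Longrightarrow> p dvd n \<Longrightarrow> p mod k = 1"
  shows "n mod k = 1"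
  using assms(2,3)
proof (induction n rule: less_induct)
  case (less n)
  show ?case
  proof (cases "n = 1")
    case True
    then show ?thesis using assms(1) by simp
  next
    case False
    then obtain p where p: "prime p" "p dvd n" using prime_factor_nat by blast
    then obtain m where m: "n = p * m" by (elim dvdE)
    have "p \<ge> 2" using p(1) by (rule prime_ge_2_nat)
    then have "m < n" "m > 0" using m less.prems(1) by auto
    then have "m mod k = 1" using less.IH[of m] less.prems(2) m by (metis dvd_mult)
    moreover have "p mod k = 1" using less.prems(2) p by blast
    moreover have "n mod k = (p mod k) * (m mod k) mod k" unfolding m by (rule mod_mult_eq[symmetric])
    ultimately show ?thesis using assms(1) by simp
  qed
qed

text \<open>The residues 1, 4, 7 form a group of order 3 modulo 9, in which p represents a
  generator.\<close>

lemma exists_power_mod9: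
  fixes n p :: nat
  assumes n: "n mod 3 = 1" and p: "p mod 3 = 1" "p mod 9 \<noteq> 1"
  shows "\<exists>j\<le>2. n * p ^ j mod 9 = 1"
proof -
  have res: "r = 1 \<or> r = 4 \<or> r = 7" if "r < 9" "r mod 3 = 1" for r :: nat
  proof -
    have "r = 3 * (r div 3) + 1" using that(2) div_mult_mod_eq[of r 3] by simp
    moreover have "r div 3 < 3" using that(1) by (simp add: less_mult_imp_div_less)
    then have "r div 3 = 0 \<or> r div 3 = 1 \<or> r div 3 = 2" by arith
    ultimately show ?thesis by auto
  qed
  have n9: "n mod 9 = 1 \<or> n mod 9 = 4 \<or> n mod 9 = 7"
  proof (rule res)
    show "n mod 9 mod 3 = 1" using n mod_mod_cancel[of 3 9 n] by simp
  qed simp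
  have "p mod 9 = 1 \<or> p mod 9 = 4 \<or> p mod 9 = 7"
  proof (rule res)
    show "p mod 9 mod 3 = 1" using p(1) mod_mod_cancel[of 3 9 p] by simp
  qed simp
  then have p9: "p mod 9 = 4 \<or> p mod 9 = 7" using p(2) by blast
  have red: "n * p ^ j mod 9 = (n mod 9) * (p mod 9) ^ j mod 9" for j
  proof -
    have "n * p ^ j mod 9 = (n mod 9) * (p ^ j mod 9) mod 9" by (rule mod_mult_eq[symmetric])
    also have "\<dots> = (n mod 9) * ((p mod 9) ^ j mod 9) mod 9" by (simp only: power_mod)
    also have "\<dots> = (n mod 9) * (p mod 9) ^ j mod 9" by (rule mod_mult_right_eq)
    finally show ?thesis .
  qed
  have "(n mod 9) * (p mod 9) ^ 0 mod 9 = 1 \<or> (n mod 9) * (p mod 9) ^ 1 mod 9 = 1 \<or> (n mod 9) * (p mod 9) ^ 2 mod 9 = 1"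
    using n9 p9 by auto
  then have "n * p ^ 0 mod 9 = 1 \<or> n * p ^ 1 mod 9 = 1 \<or> n * p ^ 2 mod 9 = 1" by (simp only: red)
  moreover have "(0 :: nat) \<le> 2" "(1 :: nat) \<le> 2" "(2 :: nat) \<le> 2" by simp_all
  ultimately show ?thesis by blast
qed

context trivial_3_torsion
begin

lemma twist_primes_facts:
  assumes "p \<in> twist_primes"
  shows "prime p" "p \<noteq> 2" "p > 1"
proof -
  show "prime p" using assms by (simp add: twist_primes_def)
  then show "p > 1" by (rule prime_gt_1_nat)
  show "p \<noteq> 2" using twist_primes_mod3[OF assms] by auto
qed

text \<open>n is squarefree and prime to p0, so an exponent j <= 2 of p0 and the factor 4 = 2^2 keep
  the product cubefree.\<close>

lemma good_twistI:
  fixes n p0 j k :: nat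
  assumes n: "n > 0" "squarefree n" "\<And>p. prime p \<Longrightarrow> p dvd n \<Longrightarrow> p \<in> twist_primes - {p0}"
    and p0: "p0 = 1 \<or> p0 \<in> twist_primes" and j: "j \<le> 2" "n * p0 ^ j mod 9 = 1"
    and k: "k = 1 \<or> k = 4" "A * int k ^ 2 mod 9 = 7"
  shows "good_twist (int (k * (n * p0 ^ j)))"
proof -
  define m where "m = n * p0 ^ j"
  have p0pos: "p0 > 0" using p0 twist_primes_facts(3)[of p0] by auto
  have mpos: "m > 0" using n p0pos by (simp add: m_def)
  have prime_m: "p \<in> twist_primes" if "prime p" "p dvd m" for p
  proof (cases "p dvd n")
    case True
    then show ?thesis using n(3) that by blast
  next
    case False
    then have "p dvd p0 ^ j" using that by (simp add: m_def prime_dvd_mult_iff)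
    then have "p dvd p0" using that(1) prime_dvd_power by blast
    then show ?thesis using p0 that(1) twist_primes_facts(1)[of p0] primes_dvd_imp_eq[of p p0] by auto
  qed
  have oddm: "odd m"
    using prime_m[of 2] twist_primes_facts(2)[of 2] by auto
  have cub: False if q: "prime q" "q ^ 3 dvd k * m" for q :: nat
  proof (cases "q = 2")
    case True
    have "coprime (2 ^ 3) m" using oddm by (subst coprime_power_left_iff) simp
    then have "2 ^ 3 dvd k" using q(2) True coprime_dvd_mult_left_iff by blast
    then show False using k(1) by auto
  next
    case False
    have "\<not> q dvd k"
    proof
      assume "q dvd k"
      then have "q dvd 2 ^ 2" using k(1) q(1) by auto
      then have "q dvd 2" using q(1) prime_dvd_power by blast
      then show False using False q(1) primes_dvd_imp_eq[of q 2] by auto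
    qed
    then have "coprime (q ^ 3) k" using q(1) by (simp add: prime_imp_coprime)
    then have qm: "q ^ 3 dvd n * p0 ^ j" using q(2) coprime_dvd_mult_right_iff unfolding m_def by blast
    show False
    proof (cases "q dvd n")
      case True
      then have "q \<noteq> p0" using n(3) q(1) by blast
      then have "\<not> q dvd p0" using p0 q(1) twist_primes_facts(1)[of p0] primes_dvd_imp_eq[of q p0] by auto
      then have "coprime (q ^ 3) (p0 ^ j)" using q(1) by (simp add: prime_imp_coprime)
      then have "q ^ 3 dvd n" using qm coprime_dvd_mult_left_iff by blast
      then have "q ^ 2 dvd n" using le_imp_power_dvd[of 2 3 q] dvd_trans by fastforce
      then have "q dvd 1" using n(2) by (simp add: squarefree_def)
      then show False using q(1) by auto
    next
      case False
      then have "coprime (q ^ 3) n" using q(1) by (simp add: prime_imp_coprime)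
      then have d: "q ^ 3 dvd p0 ^ j" using qm coprime_dvd_mult_right_iff by blast
      then have "q dvd p0 ^ j" by (rule dvd_trans[rotated]) simp
      then have "q dvd p0" using q(1) prime_dvd_power by blast
      then have "q = p0" using p0 q(1) twist_primes_facts(1)[of p0] primes_dvd_imp_eq[of q p0] by auto
      then have "3 \<le> j" using d q(1) by (intro power_dvd_imp_le[of q]) (use prime_gt_1_nat in auto)
      then show False using j by simp
    qed
  qed
  have "cubefree (int (k * m))"
    unfolding cubefree_def
  proof (intro allI impI)
    fix x :: int
    assume x: "x ^ 3 dvd int (k * m)"
    show "x dvd 1"
    proof (rule ccontr)
      assume "\<not> x dvd 1"
      then have "nat \<bar>x\<bar> \<noteq> 1" by auto
      then obtain q where q: "prime q" "q dvd nat \<bar>x\<bar>" using prime_factor_nat by blast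
      then have "int q dvd x" by (simp add: int_dvd_int_iff[symmetric] del: int_dvd_int_iff)
      then have "int q ^ 3 dvd int (k * m)" using x dvd_power_same dvd_trans by blast
      then have "q ^ 3 dvd k * m" by (metis int_dvd_int_iff of_nat_power)
      then show False using cub q(1) by blast
    qed
  qed
  moreover have "A * int (k * m) ^ 2 mod 9 = 7"
  proof -
    have m9: "int m mod 9 = 1" using j(2) unfolding m_def[symmetric] by (metis of_nat_1 of_nat_mod of_nat_numeral)
    have "A * int (k * m) ^ 2 mod 9 = (A * int k ^ 2) * (int m) ^ 2 mod 9" by (simp add: power_mult_distrib mult.assoc)
    also have "\<dots> = (A * int k ^ 2 mod 9) * ((int m mod 9) ^ 2 mod 9) mod 9" by (simp add: mod_mult_eq power_mod)
    also have "\<dots> = 7" using m9 k(2) by simp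
    finally show ?thesis .
  qed
  moreover have "int (k * m) > 0" using k(1) mpos by auto
  moreover have "odd (int (k * m)) \<or> (\<exists>D0. int (k * m) = 4 * D0 \<and> odd D0)"
    using k(1) oddm by auto
  moreover have "p = 2 \<or> twist_prime p" if p: "prime p" "p dvd int (k * m)" for p :: int
  proof -
    obtain q where q: "p = int q" "prime q" using p(1) by (metis prime_ge_0_int nonneg_int_cases prime_nat_int_transfer)
    have "q dvd k * m" using p(2) q(1) by (simp only: int_dvd_int_iff)
    then consider "q dvd k" | "q dvd m" using q(2) by (auto simp: prime_dvd_mult_iff)
    then show ?thesis
    proof cases
      case 1
      then have "q dvd 2 ^ 2" using k(1) q(2) by auto
      then have "q dvd 2" using q(2) prime_dvd_power by blast
      then show ?thesis using q primes_dvd_imp_eq[of q 2] by auto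
    next
      case 2
      then show ?thesis using prime_m[OF q(2)] twist_primes_twist q(1) by blast
    qed
  qed
  ultimately show ?thesis unfolding good_twist_def m_def by blast
qed

text \<open>Leaving out \<open>p0\<close> costs at most one term, and ln y exceeds the logarithm of
  the integer part of y by at most ln 2.\<close>

lemma mertens_twist_primes_real:
  obtains C where "\<And>y. y \<ge> 1 \<Longrightarrow>
    \<bar>(\<Sum>p | p \<in> twist_primes - {p0} \<and> real p \<le> y. ln (real p) / real p) - ln y / 4\<bar> \<le> C"
proof -
  obtain C where C: "\<And>N. N \<ge> 1 \<Longrightarrow> \<bar>(\<Sum>p | p \<in> twist_primes \<and> p \<le> N. ln (real p) / real p) - ln (real N) / 4\<bar> \<le> C"
    by (rule mertens_twist_primes) (rule that)
  define t where "t = \<bar>ln (real p0) / real p0\<bar>"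
  have "\<bar>(\<Sum>p | p \<in> twist_primes - {p0} \<and> real p \<le> y. ln (real p) / real p) - ln y / 4\<bar> \<le> C + t + ln 2" if y: "y \<ge> 1" for y
  proof -
    define N where "N = nat \<lfloor>y\<rfloor>"
    have N: "N \<ge> 1" "real N \<le> y" "y < real N + 1" using y by (auto simp: N_def le_nat_floor)
    have le: "real p \<le> y \<longleftrightarrow> p \<le> N" for p :: nat using y by (simp add: N_def le_nat_iff le_floor_iff)
    define S where "S = {p. p \<in> twist_primes \<and> p \<le> N}"
    have finS: "finite S" unfolding S_def by simp
    have S: "{p. p \<in> twist_primes - {p0} \<and> real p \<le> y} = S - {p0}" unfolding S_def le by blast
    have "(\<Sum>p\<in>S - {p0}. ln (real p) / real p) = (\<Sum>p\<in>S. ln (real p) / real p) - (if p0 \<in> S then ln (real p0) / real p0 else 0)"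
      using finS by (simp add: sum_diff1)
    then have 1: "\<bar>(\<Sum>p\<in>S - {p0}. ln (real p) / real p) - (\<Sum>p\<in>S. ln (real p) / real p)\<bar> \<le> t" by (simp add: t_def)
    have "real N \<ge> 1" using N(1) by simp
    then have "ln y \<le> ln (2 * real N)" using N(3) y by (subst ln_le_cancel_iff) linarith+
    also have "\<dots> = ln 2 + ln (real N)" using N by (simp add: ln_mult)
    finally have 2: "ln y \<le> ln 2 + ln (real N)" .
    have 3: "ln (real N) \<le> ln y" using N by (subst ln_le_cancel_iff) auto
    have "\<bar>(\<Sum>p\<in>S. ln (real p) / real p) - ln (real N) / 4\<bar> \<le> C" using C[OF N(1)] unfolding S_def .
    moreover have "ln (2 :: real) > 0" by simp
    ultimately show ?thesis using 1 2 3 unfolding S by linarith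
  qed
  then show ?thesis using that by blast
qed

theorem many_good_twists:
  assumes A9: "A mod 9 = 1 \<or> A mod 9 = 7"
  obtains \<epsilon> c :: real where "0 < \<epsilon>" "\<epsilon> < 1" "c > 0"
    "\<forall>\<^sub>F X in at_top. real (card {D \<in> cubefree_upto X. good_twist D}) \<ge> c * (X / ln X powr \<epsilon>)"
proof -
  \<comment> \<open>The remaining factor of D will be 1 modulo 9, so k alone brings A D^2 to 7; for
    A = 1 mod 9 this is 16 = 7 mod 9.\<close>
  define k :: nat where "k = (if A mod 9 = 7 then 1 else 4)"
  have k: "k = 1 \<or> k = 4" "A * int k ^ 2 mod 9 = 7"
  proof -
    show "k = 1 \<or> k = 4" by (simp add: k_def)
    show "A * int k ^ 2 mod 9 = 7"
    proof (cases "A mod 9 = 7")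
      case True
      then show ?thesis by (simp add: k_def)
    next
      case False
      then have "A mod 9 = 1" "int k ^ 2 = 16" using A9 by (simp_all add: k_def)
      then show ?thesis using mod_mult_left_eq[of A 9 16] by simp
    qed
  qed
  \<comment> \<open>Either all twisting primes are 1 modulo 9 and p0 = 1 stands for no correction,
    or p0 is a prime that supplies it. It is removed from \<open>Q\<close> so that n can be
    recovered from the product.\<close>
  obtain p0 where p0: "p0 = 1 \<and> (\<forall>p\<in>twist_primes. p mod 9 = 1) \<or> p0 \<in> twist_primes \<and> p0 mod 9 \<noteq> 1" by blast
  define Q where "Q = twist_primes - {p0}"
  obtain C where C: "\<And>y. y \<ge> 1 \<Longrightarrow> \<bar>(\<Sum>p | p \<in> Q \<and> real p \<le> y. ln (real p) / real p) - ln y / 4\<bar> \<le> C"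
    by (rule mertens_twist_primes_real[of p0, folded Q_def]) (rule that)
  interpret dense_primes Q C
  proof
    show "prime p" if "p \<in> Q" for p using that twist_primes_facts(1) unfolding Q_def by blast
  qed (rule C)
  have prod: "n > 0" "squarefree n" "\<And>p. prime p \<Longrightarrow> p dvd n \<Longrightarrow> p \<in> twist_primes - {p0}" if "n \<in> products" for n
    unfolding Q_def[symmetric] using that unfolding products_def by blast+
  have "\<exists>j\<le>2. n * p0 ^ j mod 9 = 1" if n: "n \<in> products" for n
  proof -
    note pr = prod[OF n]
    show ?thesis
    proof (cases "p0 \<in> twist_primes \<and> p0 mod 9 \<noteq> 1")
      case True
      have "n mod 3 = 1"
      proof (rule mod_eq_1_of_prime_divisors)
        show "p mod 3 = 1" if "prime p" "p dvd n" for p using pr(3)[OF that] twist_primes_mod3 by blast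
      qed (use pr(1) in simp_all)
      then show ?thesis using True twist_primes_mod3 by (intro exists_power_mod9) auto
    next
      case False
      then have all1: "\<forall>p\<in>twist_primes. p mod 9 = 1" using p0 by blast
      have "n mod 9 = 1"
      proof (rule mod_eq_1_of_prime_divisors)
        show "p mod 9 = 1" if "prime p" "p dvd n" for p
          using pr(3)[OF that] all1 by blast
      qed (use pr(1) in simp_all)
      then show ?thesis by (intro exI[of _ 0] conjI) simp_all
    qed
  qed
  then obtain j where j: "\<And>n. n \<in> products \<Longrightarrow> j n \<le> 2" "\<And>n. n \<in> products \<Longrightarrow> n * p0 ^ j n mod 9 = 1"
    by metis
  define d where "d = (\<lambda>n. int (k * (n * p0 ^ j n)))"
  have p0': "p0 = 1 \<or> p0 \<in> twist_primes" using p0 by blast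
  then have p0pos: "p0 > 0" using twist_primes_facts(3)[of p0] by auto
  have good: "good_twist (d n)" if "n \<in> products" for n
    unfolding d_def using prod[OF that] j[OF that] p0' k by (intro good_twistI) auto
  have cop: "coprime n (p0 ^ i)" if n: "n \<in> products" for n i
  proof (cases "p0 = 1")
    case False
    then have "prime p0" using p0' twist_primes_facts(1) by blast
    moreover have "\<not> p0 dvd n" using prod(3)[OF n] calculation by blast
    ultimately have "coprime p0 n" by (rule prime_imp_coprime)
    then show ?thesis by (simp add: coprime_commute)
  qed simp
  have dvd: "n dvd n'" if "n \<in> products" "d n = d n'" for n n'
  proof -
    have "int (k * (n * p0 ^ j n)) = int (k * (n' * p0 ^ j n'))" using that(2) by (simp only: d_def)
    then have "k * (n * p0 ^ j n) = k * (n' * p0 ^ j n')" by (simp only: of_nat_eq_iff)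
    then have "n * p0 ^ j n = n' * p0 ^ j n'" using k(1) by auto
    then have "n dvd n' * p0 ^ j n'" by (metis dvd_triv_left)
    then show ?thesis using cop[OF that(1)] coprime_dvd_mult_left_iff by blast
  qed
  have inj: "inj_on d products" by (rule inj_onI) (metis dvd dvd_antisym)
  \<comment> \<open>From k <= 4 and j <= 2: the factor by which \<open>d n\<close> can exceed
    n.\<close>
  define R where "R = real (4 * p0 ^ 2)"
  have R: "R > 0" using p0pos by (simp add: R_def)
  have dle: "of_int (d n) \<le> R * real n" if "n \<in> products" for n
  proof -
    have "p0 ^ j n \<le> p0 ^ 2" using j(1)[OF that] p0pos by (intro power_increasing) auto
    then have "k * (n * p0 ^ j n) \<le> 4 * (n * p0 ^ 2)" using k(1) by (intro mult_mono) auto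
    then have "real (k * (n * p0 ^ j n)) \<le> real (4 * (n * p0 ^ 2))" by (simp only: of_nat_le_iff)
    then show ?thesis by (simp add: d_def R_def mult_ac)
  qed
  have cnt: "real (card {n \<in> products. real n \<le> X / R}) \<le> real (card {D \<in> cubefree_upto X. good_twist D})" for X
  proof -
    have "finite (cubefree_upto X)"
    proof (rule finite_subset)
      show "cubefree_upto X \<subseteq> {0..\<lfloor>X\<rfloor>}" by (auto simp: cubefree_upto_def le_floor_iff)
    qed simp
    moreover have "d ` {n \<in> products. real n \<le> X / R} \<subseteq> {D \<in> cubefree_upto X. good_twist D}"
    proof (rule image_subsetI)
      fix n assume n: "n \<in> {n \<in> products. real n \<le> X / R}"
      then have "R * real n \<le> X" using R by (simp add: field_simps)
      then have "of_int (d n) \<le> X" using dle[of n] n by simp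
      then show "d n \<in> {D \<in> cubefree_upto X. good_twist D}"
        using good[of n] n by (simp add: cubefree_upto_def good_twist_def)
    qed
    moreover have "inj_on d {n \<in> products. real n \<le> X / R}" using inj by (rule inj_on_subset) blast
    ultimately have "card {n \<in> products. real n \<le> X / R} \<le> card {D \<in> cubefree_upto X. good_twist D}"
      by (intro card_inj_on_le[of d]) auto
    then show ?thesis by (simp only: of_nat_le_iff)
  qed
  obtain c where c: "c > 0"
    "\<forall>\<^sub>F X in at_top. real (card {n \<in> products. real n \<le> X}) \<ge> c * (X / ln X powr (1 - kappa))"
    by (rule count_products) (rule that)
  have "filterlim (\<lambda>X. X / R) at_top at_top"
    unfolding divide_inverse mult.commute[of _ "inverse R"]
    using R by (intro filterlim_tendsto_pos_mult_at_top[OF tendsto_const] filterlim_ident) simp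
  then have "\<forall>\<^sub>F X in at_top. real (card {n \<in> products. real n \<le> X / R}) \<ge> c * (X / R / ln (X / R) powr (1 - kappa))"
    using c(2) by (rule eventually_compose_filterlim[rotated])
  moreover have "\<forall>\<^sub>F X in at_top. X > max R 1" by (rule eventually_gt_at_top)
  ultimately have "\<forall>\<^sub>F X in at_top. real (card {D \<in> cubefree_upto X. good_twist D}) \<ge> c / R * (X / ln X powr (1 - kappa))"
  proof eventually_elim
    case (elim X)
    have X: "X > R" "X > 1" using elim(2) by auto
    have "real p0 ^ 2 \<ge> 1" using p0pos by (intro one_le_power) simp
    then have "R \<ge> 1" by (simp add: R_def)
    then have "X / R \<le> X" using X by (simp add: field_simps)
    moreover have "X / R > 1" using X R by (simp add: field_simps)
    ultimately have "0 < ln (X / R)" "ln (X / R) \<le> ln X" using X by simp_all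
    then have "0 < ln (X / R) powr (1 - kappa)" "ln (X / R) powr (1 - kappa) \<le> ln X powr (1 - kappa)"
      using kappa by (auto intro!: powr_mono2)
    then have "X / R / ln X powr (1 - kappa) \<le> X / R / ln (X / R) powr (1 - kappa)"
      using X R by (intro divide_left_mono mult_pos_pos) auto
    then have "c * (X / R / ln X powr (1 - kappa)) \<le> c * (X / R / ln (X / R) powr (1 - kappa))"
      using c(1) by (intro mult_left_mono) simp_all
    also have "\<dots> \<le> real (card {D \<in> cubefree_upto X. good_twist D})" using elim(1) cnt[of X] by linarith
    finally show ?case by simp
  qed
  then show ?thesis using that[of "1 - kappa" "c / R"] kappa c(1) R by simp
qed

end

theorem corollary4p13:
  fixes A :: int
  assumes "A > 0" and "squarefree A"
    and "[A = 1] (mod 36) \<or> [A = 25] (mod 36)"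
    and "torsion_dim 3 (class_group (quadratic_field (- A))) = 0"
  shows "\<exists>\<epsilon>::real. 0 < \<epsilon> \<and> \<epsilon> < 1 \<and>
    (\<exists>c>0. \<forall>\<^sub>F X::real in at_top.
       real (card {D \<in> cubefree_upto X. abelian_rank (cubic_twist_group A D) = 0})
         \<ge> c * (X / (ln X) powr \<epsilon>))"
proof -
  have "A mod 36 = 1 \<or> A mod 36 = 25" using assms(3) by (simp add: Cong.cong_def)
  \<comment> \<open>25 is 1 modulo 4 and 3, and 7 modulo 9.\<close>
  moreover have "A mod 4 = A mod 36 mod 4" "A mod 3 = A mod 36 mod 3" "A mod 9 = A mod 36 mod 9"
    by (simp_all add: mod_mod_cancel)
  ultimately have m: "A mod 4 = 1" "A mod 3 = 1" "A mod 9 = 1 \<or> A mod 9 = 7"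
    by (elim disjE; simp only:; simp)+
  interpret trivial_3_torsion A
    using assms(1,2,4) m(1,2) by unfold_locales
  obtain \<epsilon> c :: real where e: "0 < \<epsilon>" "\<epsilon> < 1" "c > 0"
    "\<forall>\<^sub>F X in at_top. real (card {D \<in> cubefree_upto X. good_twist D}) \<ge> c * (X / ln X powr \<epsilon>)"
    by (rule many_good_twists[OF m(3)]) (rule that)
  have "card {D \<in> cubefree_upto X. good_twist D} \<le> card {D \<in> cubefree_upto X. abelian_rank (cubic_twist_group A D) = 0}" for X
  proof (rule card_mono)
    have "cubefree_upto X \<subseteq> {0..\<lfloor>X\<rfloor>}" by (auto simp: cubefree_upto_def le_floor_iff)
    then show "finite {D \<in> cubefree_upto X. abelian_rank (cubic_twist_group A D) = 0}"
      using finite_subset by fastforce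
    show "{D \<in> cubefree_upto X. good_twist D} \<subseteq> {D \<in> cubefree_upto X. abelian_rank (cubic_twist_group A D) = 0}"
      using good_twist_rank_0 by blast
  qed
  then have "\<forall>\<^sub>F X in at_top. real (card {D \<in> cubefree_upto X. abelian_rank (cubic_twist_group A D) = 0}) \<ge> c * (X / ln X powr \<epsilon>)"
    using e(4) by (auto elim!: eventually_mono intro: order_trans)
  then show ?thesis using e(1-3) by blast
qed

end
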